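(* Let $K$ be a field and $S=K[x_1,\dots,x_n]$ with the standard grading. Let $M$ be a finitely generated graded $S$-module, $p\in\{0,\dots,n\}$ and $k\geq 0$ an integer. Suppose that $\beta_p^{lin}(M)\neq 0$ and that $M$ is the $k$-th syzygy module in a minimal graded free resolution. Then: (i) If $k=0$, then $\beta_i^{lin}(M)\geq\binom{p}{i}$ for $i=0,\dots,p$. (ii) If $k=1$, then $\beta_i^{lin}(M)\geq\binom{p+1}{i+1}$ for $i=0,\dots,p$. (iii) If $k>1$ and $p>0$, then $\beta_{p-1}^{lin}(M)\geq p+k$.
   Context: $\beta_{i,i+j}(M)=\dim_K \operatorname{Tor}^S_i(M,K)_{i+j}$ are the graded Betti numbers. If $d$ is the initial degree of $M$ (i.e. $M_i=0$ for $i<d$ and $M_d\neq 0$), then $\beta_i^{lin}(M)=\beta_{i,i+d}(M)$. "$M$ is the $k$-th syzygy module in a minimal graded free resolution" means that there is a finitely generated graded $S$-module $N$ with minimal graded free resolution $\cdots\to F_1\to F_0\to N\to 0$ such that $M\cong\Omega_k(N)$ as graded modules, where $\Omega_0(N)=N$ and $\Omega_k(N)=\operatorname{Im}(F_k\to F_{k-1})$ for $k\geq 1$. *)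

theory Defs
  imports "HOL-Algebra.Algebra" "HOL-Algebra.Algebraic_Closure_Type" "HOL-Library.Poly_Mapping"
begin

section \<open>Modules over a commutative ring\<close>

text \<open>
  Modules are records of HOL-Algebra. The fields \<open>mult\<close> and \<open>one\<close>, which a module record
  inherits from the ring record, play no role for modules and are left unspecified.
\<close>

definition submodule_gen ::
    "('a, 'x) ring_scheme \<Rightarrow> ('a, 'b, 'y) module_scheme \<Rightarrow> 'b set \<Rightarrow> 'b set" where
  "submodule_gen R M A = \<Inter> {H. submodule H R M \<and> A \<subseteq> H}"

definition finitely_generated ::
    "('a, 'x) ring_scheme \<Rightarrow> ('a, 'b, 'y) module_scheme \<Rightarrow> bool" where
  "finitely_generated R M \<longleftrightarrow>
     (\<exists>A. finite A \<and> A \<subseteq> carrier M \<and> submodule_gen R M A = carrier M)"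

definition module_homs ::
    "('a, 'x) ring_scheme \<Rightarrow> ('a, 'b, 'y) module_scheme \<Rightarrow> ('a, 'c, 'z) module_scheme \<Rightarrow> ('b \<Rightarrow> 'c) set" where
  "module_homs R M N = {h \<in> carrier M \<rightarrow> carrier N.
     (\<forall>x\<in>carrier M. \<forall>y\<in>carrier M. h (x \<oplus>\<^bsub>M\<^esub> y) = h x \<oplus>\<^bsub>N\<^esub> h y) \<and>
     (\<forall>r\<in>carrier R. \<forall>x\<in>carrier M. h (r \<odot>\<^bsub>M\<^esub> x) = r \<odot>\<^bsub>N\<^esub> h x)}"

text \<open>Finitely supported functions on \<open>B\<close>, extended by zero outside \<open>B\<close>.\<close>

definition free_module :: "('a, 'x) ring_scheme \<Rightarrow> 'i set \<Rightarrow> ('a, 'i \<Rightarrow> 'a) module" where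
  "free_module R B =
     \<lparr>carrier = {v. (\<forall>b. v b \<in> carrier R) \<and> (\<forall>b. b \<notin> B \<longrightarrow> v b = \<zero>\<^bsub>R\<^esub>) \<and> finite {b. v b \<noteq> \<zero>\<^bsub>R\<^esub>}},
      monoid.mult = undefined, one = undefined,
      ring.zero = (\<lambda>_. \<zero>\<^bsub>R\<^esub>), add = (\<lambda>u v b. u b \<oplus>\<^bsub>R\<^esub> v b),
      module.smult = (\<lambda>r v b. r \<otimes>\<^bsub>R\<^esub> v b)\<rparr>"

definition basis_vec :: "('a, 'x) ring_scheme \<Rightarrow> 'i \<Rightarrow> 'i \<Rightarrow> 'a" where
  "basis_vec R b = (\<lambda>c. if c = b then \<one>\<^bsub>R\<^esub> else \<zero>\<^bsub>R\<^esub>)"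

text \<open>For a coset \<open>A\<close>, the sets united in the scalar product all coincide.\<close>

definition quotient_module :: "('a, 'b, 'y) module_scheme \<Rightarrow> 'b set \<Rightarrow> ('a, 'b set) module" where
  "quotient_module M H =
     \<lparr>carrier = a_rcosets\<^bsub>M\<^esub> H, monoid.mult = undefined, one = undefined,
      ring.zero = H, add = set_add M,
      module.smult = (\<lambda>r A. \<Union>x\<in>A. H +>\<^bsub>M\<^esub> (r \<odot>\<^bsub>M\<^esub> x))\<rparr>"

text \<open>
  The dimension of a finite-dimensional vector space \<open>V\<close> over the field \<open>R\<close> is the number of
  elements of a basis, and \<open>0\<close> is returned as a default value if there is no finite basis.
\<close>

definition is_finite_basis :: "('a, 'x) ring_scheme \<Rightarrow> ('a, 'b, 'y) module_scheme \<Rightarrow> 'b set \<Rightarrow> bool" where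
  "is_finite_basis R V B \<longleftrightarrow> finite B \<and> B \<subseteq> carrier V \<and>
     (\<forall>v\<in>carrier V. \<exists>!c. c \<in> B \<rightarrow>\<^sub>E carrier R \<and> v = (\<Oplus>\<^bsub>V\<^esub>b\<in>B. c b \<odot>\<^bsub>V\<^esub> b))"

definition vdim :: "('a, 'x) ring_scheme \<Rightarrow> ('a, 'b, 'y) module_scheme \<Rightarrow> nat" where
  "vdim R V = (if \<exists>B. is_finite_basis R V B then THE d. \<exists>B. is_finite_basis R V B \<and> card B = d else 0)"


section \<open>Gradings and tensor products\<close>

record ('a, 'b) graded_module = "('a, 'b) module" +
  hom_part :: "int \<Rightarrow> 'b set"

definition with_grading :: "('a, 'b) module \<Rightarrow> (int \<Rightarrow> 'b set) \<Rightarrow> ('a, 'b) graded_module" where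
  "with_grading M g = module.extend M (graded_module.fields g)"

definition graded_sub :: "('a, 'b) graded_module \<Rightarrow> 'b set \<Rightarrow> ('a, 'b) graded_module" where
  "graded_sub M A = M\<lparr>carrier := A, hom_part := (\<lambda>j. hom_part M j \<inter> A)\<rparr>"

definition graded_quotient :: "('a, 'b) graded_module \<Rightarrow> 'b set \<Rightarrow> ('a, 'b set) graded_module" where
  "graded_quotient M H =
     with_grading (quotient_module M H) (\<lambda>j. (\<lambda>x. H +>\<^bsub>M\<^esub> x) ` hom_part M j)"

definition graded_homs ::
    "('a, 'x) ring_scheme \<Rightarrow> ('a, 'b) graded_module \<Rightarrow> ('a, 'c) graded_module \<Rightarrow> ('b \<Rightarrow> 'c) set" where
  "graded_homs R M N = {h \<in> module_homs R M N. \<forall>j. h ` hom_part M j \<subseteq> hom_part N j}"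

definition graded_iso ::
    "('a, 'x) ring_scheme \<Rightarrow> ('a, 'b) graded_module \<Rightarrow> ('a, 'c) graded_module \<Rightarrow> bool" where
  "graded_iso R M N \<longleftrightarrow> (\<exists>h\<in>graded_homs R M N.
     bij_betw h (carrier M) (carrier N) \<and> (\<forall>j. h ` hom_part M j = hom_part N j))"

definition tensor_relations ::
    "('a, 'x) ring_scheme \<Rightarrow> ('a, 'b) graded_module \<Rightarrow> ('a, 'c) graded_module \<Rightarrow> ('b \<times> 'c \<Rightarrow> 'a) set" where
  "tensor_relations R M N =
    (let F = free_module R (carrier M \<times> carrier N); e = basis_vec R in
     {e (x \<oplus>\<^bsub>M\<^esub> x', y) \<ominus>\<^bsub>F\<^esub> (e (x, y) \<oplus>\<^bsub>F\<^esub> e (x', y)) | x x' y.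
        x \<in> carrier M \<and> x' \<in> carrier M \<and> y \<in> carrier N} \<union>
     {e (x, y \<oplus>\<^bsub>N\<^esub> y') \<ominus>\<^bsub>F\<^esub> (e (x, y) \<oplus>\<^bsub>F\<^esub> e (x, y')) | x y y'.
        x \<in> carrier M \<and> y \<in> carrier N \<and> y' \<in> carrier N} \<union>
     {e (r \<odot>\<^bsub>M\<^esub> x, y) \<ominus>\<^bsub>F\<^esub> r \<odot>\<^bsub>F\<^esub> e (x, y) | r x y.
        r \<in> carrier R \<and> x \<in> carrier M \<and> y \<in> carrier N} \<union>
     {e (x, r \<odot>\<^bsub>N\<^esub> y) \<ominus>\<^bsub>F\<^esub> r \<odot>\<^bsub>F\<^esub> e (x, y) | r x y.
        r \<in> carrier R \<and> x \<in> carrier M \<and> y \<in> carrier N})"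

definition tensor_null ::
    "('a, 'x) ring_scheme \<Rightarrow> ('a, 'b) graded_module \<Rightarrow> ('a, 'c) graded_module \<Rightarrow> ('b \<times> 'c \<Rightarrow> 'a) set" where
  "tensor_null R M N =
     submodule_gen R (free_module R (carrier M \<times> carrier N)) (tensor_relations R M N)"

definition pure_tensor ::
    "('a, 'x) ring_scheme \<Rightarrow> ('a, 'b) graded_module \<Rightarrow> ('a, 'c) graded_module \<Rightarrow>
     'b \<Rightarrow> 'c \<Rightarrow> ('b \<times> 'c \<Rightarrow> 'a) set" where
  "pure_tensor R M N x y =
     tensor_null R M N +>\<^bsub>free_module R (carrier M \<times> carrier N)\<^esub> basis_vec R (x, y)"

definition tensor ::
    "('a, 'x) ring_scheme \<Rightarrow> ('a, 'b) graded_module \<Rightarrow> ('a, 'c) graded_module \<Rightarrow>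
     ('a, ('b \<times> 'c \<Rightarrow> 'a) set) graded_module" where
  "tensor R M N =
    (let Q = quotient_module (free_module R (carrier M \<times> carrier N)) (tensor_null R M N) in
     with_grading Q (\<lambda>j. generate (add_monoid Q)
       {pure_tensor R M N x y | x y a b. x \<in> hom_part M a \<and> y \<in> hom_part N b \<and> a + b = j}))"

text \<open>The homomorphism \<open>f \<otimes> id\<close> from \<open>M \<otimes> N\<close> to \<open>M' \<otimes> N\<close>.\<close>

definition tensor_map ::
    "('a, 'x) ring_scheme \<Rightarrow> ('a, 'b) graded_module \<Rightarrow> ('a, 'd) graded_module \<Rightarrow>
     ('a, 'c) graded_module \<Rightarrow> ('b \<Rightarrow> 'd) \<Rightarrow> ('b \<times> 'c \<Rightarrow> 'a) set \<Rightarrow> ('d \<times> 'c \<Rightarrow> 'a) set" where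
  "tensor_map R M M' N f =
    (THE h. h \<in> module_homs R (tensor R M N) (tensor R M' N) \<and>
        h \<in> extensional (carrier (tensor R M N)) \<and>
        (\<forall>x\<in>carrier M. \<forall>y\<in>carrier N. h (pure_tensor R M N x y) = pure_tensor R M' N (f x) y))"


section \<open>Graded modules over a polynomial ring\<close>

type_synonym 'k mpoly = "(nat \<Rightarrow>\<^sub>0 nat) \<Rightarrow>\<^sub>0 'k"

text \<open>\<open>mpoly_ring n\<close> is \<open>K[x\<^sub>0, \<dots>, x\<^bsub>n-1\<^esub>]\<close>, where \<open>K\<close> is the field given by the type \<open>'k\<close>.\<close>

definition mpoly_ring :: "nat \<Rightarrow> 'k::field mpoly ring" where
  "mpoly_ring n = ring_of_type_algebra
     \<lparr>carrier := {f. \<forall>m\<in>Poly_Mapping.keys f. Poly_Mapping.keys m \<subseteq> {..<n}}\<rparr>"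

definition mpoly_hom_part :: "nat \<Rightarrow> int \<Rightarrow> 'k::field mpoly set" where
  "mpoly_hom_part n a =
     {f \<in> carrier (mpoly_ring n).
        \<forall>m\<in>Poly_Mapping.keys f. int (\<Sum>i\<in>Poly_Mapping.keys m. Poly_Mapping.lookup m i) = a}"

definition irrelevant_ideal :: "nat \<Rightarrow> 'k::field mpoly set" where
  "irrelevant_ideal n =
     genideal (mpoly_ring n) ((\<lambda>i. Poly_Mapping.single (Poly_Mapping.single i 1) 1) ` {..<n})"

definition is_graded_module :: "nat \<Rightarrow> ('k::field mpoly, 'b) graded_module \<Rightarrow> bool" where
  "is_graded_module n M \<longleftrightarrow>
     Module.module (mpoly_ring n) M \<and>
     (\<forall>j. additive_subgroup (hom_part M j) M) \<and>
     (\<forall>x\<in>carrier M. \<exists>!c. (\<forall>j. c j \<in> hom_part M j) \<and> finite {j. c j \<noteq> \<zero>\<^bsub>M\<^esub>} \<and>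
         x = (\<Oplus>\<^bsub>M\<^esub>j\<in>{j. c j \<noteq> \<zero>\<^bsub>M\<^esub>}. c j)) \<and>
     (\<forall>a j. \<forall>f\<in>mpoly_hom_part n a. \<forall>x\<in>hom_part M j. f \<odot>\<^bsub>M\<^esub> x \<in> hom_part M (a + j))"

definition initial_degree :: "('k mpoly, 'b) graded_module \<Rightarrow> int" where
  "initial_degree M = (THE d. hom_part M d \<noteq> {\<zero>\<^bsub>M\<^esub>} \<and> (\<forall>i<d. hom_part M i = {\<zero>\<^bsub>M\<^esub>}))"

text \<open>The field \<open>K\<close> as a module over the polynomial ring, concentrated in degree \<open>0\<close>.\<close>

definition residue_field :: "('k::field mpoly, 'k) graded_module" where
  "residue_field =
     \<lparr>carrier = UNIV, monoid.mult = undefined, one = undefined, ring.zero = 0, add = (+),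
      module.smult = (\<lambda>f c. Poly_Mapping.lookup f 0 * c), hom_part = (\<lambda>j. if j = 0 then UNIV else {0})\<rparr>"

text \<open>The homogeneous component of degree \<open>j\<close> as a vector space over \<open>K\<close>.\<close>

definition hom_component :: "('k::field mpoly, 'b) graded_module \<Rightarrow> int \<Rightarrow> ('k, 'b) module" where
  "hom_component M j =
     \<lparr>carrier = hom_part M j, monoid.mult = undefined, one = undefined, ring.zero = \<zero>\<^bsub>M\<^esub>, add = add M,
      module.smult = (\<lambda>c x. Poly_Mapping.single 0 c \<odot>\<^bsub>M\<^esub> x)\<rparr>"

text \<open>The direct sum of the shifted modules \<open>S(-g b)\<close> for \<open>b \<in> B\<close>.\<close>

definition graded_free :: "nat \<Rightarrow> 'i set \<Rightarrow> ('i \<Rightarrow> int) \<Rightarrow> ('k::field mpoly, 'i \<Rightarrow> 'k mpoly) graded_module" where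
  "graded_free n B g =
    (let F = free_module (mpoly_ring n) B in
     with_grading F (\<lambda>j. {v \<in> carrier F. \<forall>b\<in>B. v b \<in> mpoly_hom_part n (j - g b)}))"


section \<open>Resolutions, syzygies and Betti numbers\<close>

text \<open>
  A graded free resolution \<open>\<dots> \<rightarrow> F 1 \<rightarrow> F 0 \<rightarrow> M \<rightarrow> 0\<close> with augmentation \<open>\<epsilon>\<close> and differentials
  \<open>\<delta> i\<close> from \<open>F (i + 1)\<close> to \<open>F i\<close>. The bases are indexed by sets of natural numbers, so ranks
  are at most countable. Every finitely generated \<open>M\<close> has such a resolution, and if it is
  minimal, then its ranks are automatically finite.
\<close>

definition graded_free_resolution ::
    "nat \<Rightarrow> ('k::field mpoly, 'b) graded_module \<Rightarrow>
     (nat \<Rightarrow> ('k mpoly, nat \<Rightarrow> 'k mpoly) graded_module) \<Rightarrow>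
     ((nat \<Rightarrow> 'k mpoly) \<Rightarrow> 'b) \<Rightarrow>
     (nat \<Rightarrow> (nat \<Rightarrow> 'k mpoly) \<Rightarrow> (nat \<Rightarrow> 'k mpoly)) \<Rightarrow> bool" where
  "graded_free_resolution n M F \<epsilon> \<delta> \<longleftrightarrow>
     (\<forall>i. \<exists>B g. F i = graded_free n B g) \<and>
     \<epsilon> \<in> graded_homs (mpoly_ring n) (F 0) M \<and>
     (\<forall>i. \<delta> i \<in> graded_homs (mpoly_ring n) (F (Suc i)) (F i)) \<and>
     \<epsilon> ` carrier (F 0) = carrier M \<and>
     \<delta> 0 ` carrier (F 1) = {v \<in> carrier (F 0). \<epsilon> v = \<zero>\<^bsub>M\<^esub>} \<and>
     (\<forall>i. \<delta> (Suc i) ` carrier (F (Suc (Suc i))) = {v \<in> carrier (F (Suc i)). \<delta> i v = \<zero>\<^bsub>F i\<^esub>})"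

definition minimal_graded_free_resolution ::
    "nat \<Rightarrow> ('k::field mpoly, 'b) graded_module \<Rightarrow>
     (nat \<Rightarrow> ('k mpoly, nat \<Rightarrow> 'k mpoly) graded_module) \<Rightarrow>
     ((nat \<Rightarrow> 'k mpoly) \<Rightarrow> 'b) \<Rightarrow>
     (nat \<Rightarrow> (nat \<Rightarrow> 'k mpoly) \<Rightarrow> (nat \<Rightarrow> 'k mpoly)) \<Rightarrow> bool" where
  "minimal_graded_free_resolution n M F \<epsilon> \<delta> \<longleftrightarrow>
     graded_free_resolution n M F \<epsilon> \<delta> \<and>
     (\<forall>i. \<delta> i ` carrier (F (Suc i)) \<subseteq>
        submodule_gen (mpoly_ring n) (F i)
          {f \<odot>\<^bsub>F i\<^esub> v | f v. f \<in> irrelevant_ideal n \<and> v \<in> carrier (F i)})"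

text \<open>\<open>M\<close> is isomorphic to the \<open>k\<close>-th syzygy module in a minimal graded free resolution of \<open>N\<close>.\<close>

definition is_kth_syzygy ::
    "nat \<Rightarrow> nat \<Rightarrow> ('k::field mpoly, 'c) graded_module \<Rightarrow> ('k mpoly, 'b) graded_module \<Rightarrow> bool" where
  "is_kth_syzygy n k N M \<longleftrightarrow>
     (\<exists>F \<epsilon> \<delta>. minimal_graded_free_resolution n N F \<epsilon> \<delta> \<and>
       (case k of
          0 \<Rightarrow> graded_iso (mpoly_ring n) M N
        | Suc l \<Rightarrow> graded_iso (mpoly_ring n) M (graded_sub (F l) (\<delta> l ` carrier (F (Suc l))))))"

text \<open>Homology at position \<open>i\<close> of the complex \<open>\<dots> \<rightarrow> F 1 \<otimes> N \<rightarrow> F 0 \<otimes> N \<rightarrow> 0\<close>.\<close>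

definition tensor_homology ::
    "nat \<Rightarrow> (nat \<Rightarrow> ('k::field mpoly, 'f) graded_module) \<Rightarrow> (nat \<Rightarrow> 'f \<Rightarrow> 'f) \<Rightarrow>
     ('k mpoly, 'c) graded_module \<Rightarrow> nat \<Rightarrow> ('k mpoly, ('f \<times> 'c \<Rightarrow> 'k mpoly) set set) graded_module" where
  "tensor_homology n F \<delta> N i =
    (let C = (\<lambda>i. tensor (mpoly_ring n) (F i) N);
         d = (\<lambda>i. tensor_map (mpoly_ring n) (F (Suc i)) (F i) N (\<delta> i));
         Z = (case i of 0 \<Rightarrow> carrier (C 0) | Suc l \<Rightarrow> {z \<in> carrier (C (Suc l)). d l z = \<zero>\<^bsub>C l\<^esub>})
     in graded_quotient (graded_sub (C i) Z) (d i ` carrier (C (Suc i))))"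

text \<open>
  For finitely generated \<open>M\<close> a resolution exists, and up to graded isomorphism the result does
  not depend on the one that is chosen here.
\<close>

definition Tor ::
    "nat \<Rightarrow> nat \<Rightarrow> ('k::field mpoly, 'b) graded_module \<Rightarrow> ('k mpoly, 'c) graded_module \<Rightarrow>
     ('k mpoly, ((nat \<Rightarrow> 'k mpoly) \<times> 'c \<Rightarrow> 'k mpoly) set set) graded_module" where
  "Tor n i M N =
    (let (F, \<epsilon>, \<delta>) = (SOME (F, \<epsilon>, \<delta>). graded_free_resolution n M F \<epsilon> \<delta>)
     in tensor_homology n F \<delta> N i)"

definition graded_betti :: "nat \<Rightarrow> ('k::field mpoly, 'b) graded_module \<Rightarrow> nat \<Rightarrow> int \<Rightarrow> nat" where
  "graded_betti n M i j =
     vdim (ring_of_type_algebra :: 'k ring) (hom_component (Tor n i M residue_field) j)"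

definition linear_betti :: "nat \<Rightarrow> ('k::field mpoly, 'b) graded_module \<Rightarrow> nat \<Rightarrow> nat" where
  "linear_betti n M i = graded_betti n M i (int i + initial_degree M)"

end

theory Submission
  imports Defs "HOL-Library.Function_Algebras"
begin

text \<open>
  Let \<open>d\<close> be the initial degree of \<open>M\<close>, and let \<open>V\<close> be the space of linear forms. As \<open>M\<close> vanishes in degree \<open>d - 1\<close>, a chase
  in the double complex formed by a free resolution of \<open>M\<close> and the Koszul complex of the variables identifies
  \<open>Tor\<^sub>i(M, K)\<close> in degree \<open>i + d\<close> with the space \<open>Z\<^sub>i\<close> of Koszul cycles in \<open>\<And>\<^sup>i V \<otimes> M\<^sub>d\<close>.
  Contraction by a basis vector \<open>v\<close> maps \<open>Z\<^bsub>i+1\<^esub>\<close> to \<open>Z\<^sub>i\<close> and has square zero, so that the images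
  \<open>Z'\<^sub>i\<close> satisfy \<open>dim Z\<^sub>i \<ge> dim Z'\<^bsub>i-1\<^esub> + dim Z'\<^sub>i\<close>. Choosing \<open>v\<close> with \<open>Z'\<^bsub>p-1\<^esub> \<noteq> 0\<close>, induction
  on \<open>p\<close> and Pascal's rule yield (i). If \<open>M\<close> is a submodule of a free module, then \<open>Z'\<^sub>0\<close> is a proper subspace of
  \<open>Z\<^sub>0\<close>, which improves the start of the induction and yields (ii).

  For (iii), let \<open>0 \<noteq> z \<in> Z\<^sub>p\<close>, and suppose that the contractions of \<open>z\<close>, which lie in \<open>Z\<^bsub>p-1\<^esub>\<close>, span a space of
  dimension less than \<open>p + k\<close>. After a linear change of coordinates, \<open>z\<close> is a cycle of the Koszul complex
  of fewer than \<open>p + k\<close> linear forms, which are a regular sequence on free modules. Shifting along the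
  resolution, of which \<open>M\<close> is the \<open>k\<close>-th syzygy module, shows that \<open>z\<close> is the boundary of an element with coefficients
  in degree \<open>d - 1\<close> of \<open>M\<close>, whence \<open>z = 0\<close>.
\<close>

section \<open>Koszul complexes\<close>

text \<open>\<open>Tor\<close> is read off an arbitrarily chosen free resolution, possibly of
  infinite ranks and far from minimal, so Betti numbers cannot be counted as ranks. Vanishing in
  degree \<open>d - 1\<close> matters because it leaves no Koszul boundaries with coefficients in
  degree \<open>d\<close>: contraction acts on spaces of cycles, never on quotients.

  The number \<open>p + k\<close> has its origin in the exterior algebra. Each of the
  \<open>k\<close> syzygy steps trades a resolution degree for an exterior degree, so that a cycle
  in position \<open>p\<close> leads to position \<open>p + k\<close>, and the exterior power of
  that degree on fewer than \<open>p + k\<close> generators is zero.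

  Dimension theory lives on types, whereas \<open>M\<close> is a record. Its component of degree
  \<open>d\<close> is therefore carried into a type of families of polynomials: through a complement
  of the relations in general, and through the inclusion into a free module for (ii) and (iii),
  where \<open>cycles\<close> then consists of genuine Koszul cycles with polynomial entries. Thus
  two resolutions coexist: the one inside \<open>Tor\<close>, and that of \<open>N\<close>, which
  only describes how \<open>M\<close> sits in a free module.\<close>

definition signed :: "nat \<Rightarrow> 'g::ab_group_add \<Rightarrow> 'g" where
  "signed m x = (if even m then x else - x)"

lemma signed_0 [simp]: "signed m 0 = 0"
  and signed_eq_0_iff [simp]: "signed m x = 0 \<longleftrightarrow> x = 0"
  by (auto simp: signed_def)

text \<open>
  A family \<open>u\<close> indexed by finite sets \<open>Q\<close> stands for \<open>\<Sum>Q. e\<^sub>Q \<otimes> u Q\<close> in an exterior algebra.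
\<close>

definition contr :: "nat \<Rightarrow> (nat set \<Rightarrow> 'g::ab_group_add) \<Rightarrow> nat set \<Rightarrow> 'g" where
  "contr v u = (\<lambda>Q. if v \<in> Q then 0 else signed (card {w\<in>Q. w < v}) (u (insert v Q)))"

text \<open>Membership in the \<open>m\<close>-th exterior power on the index set \<open>A\<close>,
  with coefficients in a group. Finiteness of \<open>Q\<close> is recorded because infinite sets
  have cardinality \<open>0\<close>.\<close>

definition supp_fam :: "nat set \<Rightarrow> nat \<Rightarrow> (nat set \<Rightarrow> 'g::ab_group_add) \<Rightarrow> bool" where
  "supp_fam A m u \<longleftrightarrow> (\<forall>Q. u Q \<noteq> 0 \<longrightarrow> Q \<subseteq> A \<and> finite Q \<and> card Q = m)"

lemma contr_diff: "contr v (u - u') = contr v u - contr v u'"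
  by (rule ext) (auto simp: contr_def signed_def)

lemma contr_add: "contr v (u + u') = contr v u + contr v u'"
  by (rule ext) (auto simp: contr_def signed_def)

lemma contr_0: "contr v 0 = 0"
  by (rule ext) (auto simp: contr_def)

lemma contr_map:
  assumes "f 0 = 0" and "\<And>x. f (- x) = - f x"
  shows "contr v (\<lambda>Q. f (u Q)) = (\<lambda>Q. f (contr v u Q))"
  by (rule ext) (auto simp: contr_def signed_def assms)

lemma card_insert_less:
  assumes "v \<notin> Q"
  shows "card {x\<in>insert v Q. x < (w::nat)} = card {x\<in>Q. x < w} + (if v < w then 1 else 0)"
proof (cases "v < w")
  case True
  then have "{x\<in>insert v Q. x < w} = insert v {x\<in>Q. x < w}" by auto
  moreover have "finite {x\<in>Q. x < w}" by (rule finite_subset[of _ "{..<w}"]) auto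
  ultimately show ?thesis using assms True by simp
next
  case False
  then have "{x\<in>insert v Q. x < w} = {x\<in>Q. x < w}" by auto
  then show ?thesis using False by simp
qed

text \<open>For \<open>v < w\<close>, the presence of \<open>v\<close> shifts the position of
  \<open>w\<close> by one, while the presence of \<open>w\<close> does not move \<open>v\<close>; so
  the two orders differ by exactly one sign. If \<open>v = w\<close>, or if one of them is already
  in \<open>Q\<close>, both sides vanish.\<close>

lemma contr_contr: "contr v (contr w u) = - contr w (contr v u)"
proof (rule ext)
  fix Q
  show "contr v (contr w u) Q = (- contr w (contr v u)) Q"
  proof (cases "v \<in> Q \<or> w \<in> Q \<or> v = w")
    case True
    then show ?thesis by (auto simp: contr_def)
  next
    case False
    then show ?thesis
      using card_insert_less[of v Q w] card_insert_less[of w Q v]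
      by (cases "v < w") (auto simp: contr_def signed_def insert_commute)
  qed
qed

lemma contr_self: "contr v (contr v u) = 0"
  by (rule ext) (auto simp: contr_def)

lemma supp_fam_contr:
  assumes "supp_fam A (Suc m) u"
  shows "supp_fam A m (contr v u)"
proof -
  have "Q \<subseteq> A \<and> finite Q \<and> card Q = m" if "contr v u Q \<noteq> 0" for Q
  proof -
    have v: "v \<notin> Q" "u (insert v Q) \<noteq> 0" using that by (auto simp: contr_def split: if_splits)
    then have "insert v Q \<subseteq> A" "finite (insert v Q)" "card (insert v Q) = Suc m"
      using assms[unfolded supp_fam_def, rule_format, OF v(2)] by simp_all
    then show ?thesis using v by auto
  qed
  then show ?thesis by (auto simp: supp_fam_def)
qed

lemma supp_fam_diff: "supp_fam A m u \<Longrightarrow> supp_fam A m u' \<Longrightarrow> supp_fam A m (u - u')"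
  unfolding supp_fam_def by (metis fun_diff_def diff_self)

lemma supp_fam_0: "supp_fam A m 0"
  by (auto simp: supp_fam_def)

lemma supp_fam_map: "supp_fam A m u \<Longrightarrow> f 0 = 0 \<Longrightarrow> supp_fam A m (\<lambda>Q. f (u Q))"
  unfolding supp_fam_def by (intro allI impI) (metis (no_types))

text \<open>Positive exterior degree makes every support set nonempty, and taking an element
  \<open>v\<close> out of one keeps its coefficient, up to sign, as a coefficient of the
  contraction.\<close>

lemma nonzero_contr_exists:
  assumes "supp_fam A (Suc m) u" and "u \<noteq> 0"
  shows "\<exists>v\<in>A. contr v u \<noteq> 0"
proof -
  obtain Q where Q: "u Q \<noteq> 0" using assms(2) by (auto simp: fun_eq_iff)
  then have c: "Q \<subseteq> A" "finite Q" "card Q = Suc m" using assms(1) by (auto simp: supp_fam_def)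
  then obtain v where v: "v \<in> Q" by fastforce
  then have "contr v u (Q - {v}) \<noteq> 0" using Q by (auto simp: contr_def insert_absorb)
  then show ?thesis using v c by (auto simp: fun_eq_iff)
qed

section \<open>The Koszul differential of commuting endomorphisms\<close>

locale commuting_endomorphisms =
  fixes act :: "nat \<Rightarrow> 'g \<Rightarrow> 'g::ab_group_add"
  assumes act_diff: "act v (x - y) = act v x - act v y"
    and act_commute: "act v (act w x) = act w (act v x)"
begin

lemma act_0 [simp]: "act v 0 = 0"
  using act_diff[of v 0 0] by simp

lemma act_minus: "act v (- x) = - act v x"
  using act_diff[of v 0 x] by simp

lemma act_add: "act v (x + y) = act v x + act v y"
  using act_diff[of v x "- y"] by (simp add: act_minus)

lemma act_sum: "act v (sum f I) = (\<Sum>i\<in>I. act v (f i))"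
  by (induction I rule: infinite_finite_induct) (auto simp: act_add)

lemma act_signed: "act v (signed m x) = signed m (act v x)"
  by (simp add: signed_def act_minus)

text \<open>The usual Koszul differential, read on coefficients: position \<open>Q\<close> collects
  what comes from the sets that exceed \<open>Q\<close> by one element of \<open>A\<close>. Since it
  is written with contractions, its signs are governed by \<open>contr_contr\<close>.\<close>

definition kos :: "nat set \<Rightarrow> (nat set \<Rightarrow> 'g) \<Rightarrow> nat set \<Rightarrow> 'g" where
  "kos A u = (\<lambda>Q. \<Sum>v\<in>A. act v (contr v u Q))"

lemma kos_diff: "kos A (u - u') = kos A u - kos A u'"
  by (rule ext) (simp add: kos_def contr_diff act_diff sum_subtractf)

lemma kos_0: "kos A 0 = 0"
  using kos_diff[of A 0 0] by simp

lemma kos_minus: "kos A (- u) = - kos A u"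
  using kos_diff[of A 0 u] by (simp add: kos_0)

lemma kos_map:
  assumes "f 0 = 0" and "\<And>x. f (- x) = - f x"
    and "\<And>g. f (\<Sum>v\<in>A. g v) = (\<Sum>v\<in>A. f (g v))" and "\<And>v x. f (act v x) = act v (f x)"
  shows "kos A (\<lambda>Q. f (u Q)) = (\<lambda>Q. f (kos A u Q))"
  unfolding kos_def contr_map[of f, OF assms(1,2)] assms(3) assms(4) ..

lemma supp_fam_kos:
  assumes "supp_fam A (Suc m) u"
  shows "supp_fam A m (kos A u)"
proof -
  have "Q \<subseteq> A \<and> finite Q \<and> card Q = m" if "kos A u Q \<noteq> 0" for Q
  proof -
    have "\<exists>v. act v (contr v u Q) \<noteq> 0"
      using that by (rule contrapos_np) (simp add: kos_def)
    then obtain v where "act v (contr v u Q) \<noteq> 0" ..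
    then have "contr v u Q \<noteq> 0" by auto
    then show ?thesis using supp_fam_contr[OF assms, of v] by (auto simp: supp_fam_def)
  qed
  then show ?thesis by (auto simp: supp_fam_def)
qed

lemma kos_supp_0:
  assumes "supp_fam A 0 u"
  shows "kos A u = 0"
proof (rule ext)
  fix Q
  have "contr v u Q = 0" for v
  proof (cases "v \<in> Q")
    case False
    have "u (insert v Q) = 0" using assms by (auto simp: supp_fam_def)
    then show ?thesis by (simp add: contr_def)
  qed (simp add: contr_def)
  then show "kos A u Q = 0 Q" by (simp add: kos_def)
qed

text \<open>With \<open>b\<close> above all of \<open>A\<close>, the complex for
  \<open>insert b A\<close> is the mapping cone of \<open>act b\<close> on the complex for
  \<open>A\<close>. This lemma and the next give its differential on the part without
  \<open>b\<close> and on the part with \<open>b\<close>. All elements of \<open>Q\<close> lie below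
  \<open>b\<close>, which explains the sign \<open>card Q\<close>.\<close>

lemma kos_insert_outside:
  assumes "finite A" and "\<And>a. a \<in> A \<Longrightarrow> a < b" and "Q \<subseteq> A"
  shows "kos (insert b A) u Q = kos A u Q + signed (card Q) (act b (u (insert b Q)))"
proof -
  have b: "b \<notin> A" using assms(2) by blast
  have "{w\<in>Q. w < b} = Q" using assms by auto
  then show ?thesis using b assms unfolding kos_def
    by (auto simp: contr_def act_signed add.commute)
qed

lemma kos_insert_inside:
  assumes "finite A" and "\<And>a. a \<in> A \<Longrightarrow> a < b" and "Q \<subseteq> A"
  shows "kos (insert b A) u (insert b Q) = kos A (\<lambda>R. u (insert b R)) Q"
proof -
  have b: "b \<notin> A" using assms(2) by blast
  have "contr v u (insert b Q) = contr v (\<lambda>R. u (insert b R)) Q" if "v \<in> A" for v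
  proof -
    have "{w \<in> insert b Q. w < v} = {w \<in> Q. w < v}" using assms(2)[OF that] by auto
    moreover have "v \<noteq> b" using that b by blast
    ultimately show ?thesis by (simp add: contr_def insert_commute)
  qed
  moreover have "contr b u (insert b Q) = 0" by (simp add: contr_def)
  ultimately show ?thesis using b assms(1) unfolding kos_def by simp
qed

lemma kos_cong:
  assumes "\<And>R. R \<subseteq> A \<Longrightarrow> u R = u' R" and "Q \<subseteq> A"
  shows "kos A u Q = kos A u' Q"
proof -
  have "contr v u Q = contr v u' Q" if "v \<in> A" for v
    using assms(1)[of "insert v Q"] assms(2) that by (simp add: contr_def)
  then show ?thesis by (simp add: kos_def)
qed

text \<open>When a largest index \<open>b\<close> is added, the mixed terms cancel because the
  actions commute and the contractions anticommute; the term with \<open>b\<close> twice vanishes by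
  \<open>contr_self\<close>.\<close>

lemma kos_kos: "kos A (kos A u) = 0"
proof (cases "finite A")
  case False
  then show ?thesis by (simp add: kos_def fun_eq_iff)
next
  case True
  then show ?thesis
  proof (rule finite_linorder_max_induct)
    show "kos {} (kos {} u) = 0" by (simp add: kos_def fun_eq_iff)
  next
    fix b A
    assume A: "finite A" "\<forall>a\<in>A. a < b" and IH: "kos A (kos A u) = 0"
    have contr_sum: "contr v (\<lambda>R. \<Sum>w\<in>A. f w R) Q = (\<Sum>w\<in>A. contr v (f w) Q)"
      for v Q and f :: "nat \<Rightarrow> nat set \<Rightarrow> 'g"
      by (auto simp: contr_def signed_def sum_negf)
    have act_contr: "contr v (\<lambda>R. act w (f R)) Q = act w (contr v f Q)"
      for v w Q and f :: "nat set \<Rightarrow> 'g"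
      by (auto simp: contr_def act_signed)
    have b: "b \<notin> A" using A by blast
    have ins: "kos (insert b A) u = (\<lambda>R. act b (contr b u R)) + kos A u" for u
      using A(1) b by (auto simp: kos_def)
    show "kos (insert b A) (kos (insert b A) u) = 0"
    proof (rule ext)
      fix Q
      have 1: "contr b (kos A u) Q = (\<Sum>w\<in>A. act w (contr b (contr w u) Q))"
        by (simp only: kos_def contr_sum act_contr)
      have 2: "kos A (\<lambda>R. act b (contr b u R)) Q = (\<Sum>w\<in>A. act b (act w (contr w (contr b u) Q)))"
        by (simp add: kos_def act_contr act_commute[of b])
      have 3: "act b (contr b (kos A u) Q) + kos A (\<lambda>R. act b (contr b u R)) Q = 0"
        unfolding 1 2 contr_contr[of b] act_sum by (simp add: act_minus sum_negf)
      have 4: "contr b (\<lambda>R. act b (contr b u R)) Q = 0"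
        unfolding act_contr contr_self by simp
      have 5: "kos A (x + y) = kos A x + kos A y" for x y
        using kos_diff[of A x "- y"] by (simp add: kos_minus)
      show "kos (insert b A) (kos (insert b A) u) Q = 0 Q"
        unfolding ins[of "kos (insert b A) u"] unfolding ins[of u] contr_add 5 IH
        using 3 4 by (simp add: act_add)
    qed
  qed
qed

text \<open>Weak regularity of the sequence in increasing order of indices: \<open>act a\<close> is
  a nonzerodivisor modulo its predecessors. The set \<open>G\<close> is the module inside the
  ambient group.\<close>

definition regular_on :: "'g set \<Rightarrow> nat set \<Rightarrow> bool" where
  "regular_on G A \<longleftrightarrow> (\<forall>a\<in>A. \<forall>f\<in>G. \<forall>c\<in>UNIV \<rightarrow> G. act a f = (\<Sum>b\<in>A \<inter> {..<a}. act b (c b)) \<longrightarrow>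
     (\<exists>c'\<in>UNIV \<rightarrow> G. f = (\<Sum>b\<in>A \<inter> {..<a}. act b (c' b))))"

lemma regular_onD:
  assumes "regular_on G A" and "a \<in> A" and "f \<in> G" and "\<And>b. c b \<in> G"
    and "act a f = (\<Sum>b\<in>A \<inter> {..<a}. act b (c b))"
  obtains c' where "\<And>b. c' b \<in> G" and "f = (\<Sum>b\<in>A \<inter> {..<a}. act b (c' b))"
proof -
  have "c \<in> UNIV \<rightarrow> G" using assms(4) by blast
  then have "\<exists>c'\<in>UNIV \<rightarrow> G. f = (\<Sum>b\<in>A \<inter> {..<a}. act b (c' b))"
    using assms(1)[unfolded regular_on_def, rule_format, OF assms(2,3) _ assms(5)] by simp
  then show ?thesis using that by (meson Pi_mem UNIV_I)
qed

text \<open>The mapping cone argument, adding the largest index \<open>b\<close>. Write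
  \<open>u\<close> as \<open>u0\<close> without \<open>b\<close> and \<open>u1\<close> with
  \<open>b\<close>. Then \<open>u1\<close> is a cycle for \<open>A\<close>, hence the boundary of
  some \<open>t1\<close>; subtracting from \<open>u0\<close> the contribution of \<open>t1\<close>
  leaves a cycle for \<open>A\<close>, which is the boundary of some \<open>t0\<close>. Regularity
  enters when \<open>u1\<close> has exterior degree \<open>0\<close>.\<close>

lemma kos_exact:
  assumes "finite A" and "regular_on G A"
    and zero: "0 \<in> G" and diff: "\<And>x y. x \<in> G \<Longrightarrow> y \<in> G \<Longrightarrow> x - y \<in> G"
    and closed: "\<And>a x. a \<in> A \<Longrightarrow> x \<in> G \<Longrightarrow> act a x \<in> G"
    and "supp_fam A (Suc m) u" and "range u \<subseteq> G" and "kos A u = 0"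
  shows "\<exists>t. supp_fam A (Suc (Suc m)) t \<and> range t \<subseteq> G \<and> kos A t = u"
  using assms(1,2,5-8)
proof (induction A arbitrary: m u rule: finite_linorder_max_induct)
  case empty
  have "u Q = 0" for Q
  proof (rule ccontr)
    assume "u Q \<noteq> 0"
    then have "Q \<subseteq> {}" "card Q = Suc m" using empty(3) by (auto simp: supp_fam_def)
    then show False by auto
  qed
  then have "supp_fam {} (Suc (Suc m)) u" "range u \<subseteq> G" "kos {} u = u"
    using zero by (auto simp: supp_fam_def fun_eq_iff kos_def)
  then show ?case by blast
next
  case (insert b A)
  have b: "\<And>a. a \<in> A \<Longrightarrow> a < b" "b \<notin> A" using insert.hyps(2) by auto
  have neg: "- x \<in> G" if "x \<in> G" for x using diff[OF zero that] by simp
  have sgn: "signed k x \<in> G" if "x \<in> G" for x k using neg[OF that] that by (simp add: signed_def)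
  have regA: "regular_on G A"
    unfolding regular_on_def
  proof (intro ballI impI)
    fix a f c
    assume a: "a \<in> A" and f: "f \<in> G" and c: "c \<in> UNIV \<rightarrow> G"
      and e: "act a f = (\<Sum>b\<in>A \<inter> {..<a}. act b (c b))"
    have i: "insert b A \<inter> {..<a} = A \<inter> {..<a}" using b(1)[OF a] by auto
    show "\<exists>c'\<in>UNIV \<rightarrow> G. f = (\<Sum>b\<in>A \<inter> {..<a}. act b (c' b))"
      using insert.prems(1) a f c e unfolding regular_on_def i[symmetric] by blast
  qed
  have uG: "u Q \<in> G" for Q using insert.prems(4) by blast
  have actA: "\<And>a x. a \<in> A \<Longrightarrow> x \<in> G \<Longrightarrow> act a x \<in> G" using insert.prems(2) by blast
  define u0 where "u0 = (\<lambda>Q. if Q \<subseteq> A then u Q else 0)"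
  define u1 where "u1 = (\<lambda>Q. if Q \<subseteq> A then u (insert b Q) else 0)"
  have s: "u Q \<noteq> 0 \<Longrightarrow> Q \<subseteq> insert b A \<and> finite Q \<and> card Q = Suc m" for Q
    using insert.prems(3) by (auto simp: supp_fam_def)
  have s0: "supp_fam A (Suc m) u0" using s by (auto simp: supp_fam_def u0_def)
  have s1: "supp_fam A m u1"
    unfolding supp_fam_def
  proof (intro allI impI)
    fix Q assume "u1 Q \<noteq> 0"
    then have Q: "Q \<subseteq> A" "u (insert b Q) \<noteq> 0" by (auto simp: u1_def split: if_splits)
    then have "b \<notin> Q" using b(2) by blast
    then show "Q \<subseteq> A \<and> finite Q \<and> card Q = m" using Q s[OF Q(2)] by auto
  qed
  have k0: "kos A u0 Q + signed (card Q) (act b (u1 Q)) = 0" if "Q \<subseteq> A" for Q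
    using kos_insert_outside[OF insert.hyps(1) b(1) that, of u]
      kos_cong[of A u u0, OF _ that] that insert.prems(5)
    by (simp add: u0_def u1_def)
  have k1: "kos A u1 Q = 0" if "Q \<subseteq> A" for Q
    using kos_insert_inside[OF insert.hyps(1) b(1) that, of u]
      kos_cong[of A "\<lambda>R. u (insert b R)" u1, OF _ that] that insert.prems(5)
    by (simp add: u1_def)
  have "\<exists>t1. supp_fam A (Suc m) t1 \<and> range t1 \<subseteq> G \<and> kos A t1 = u1"
  proof (cases m)
    case 0
    \<comment> \<open>In exterior degree \<open>0\<close> the induction hypothesis says nothing
      about \<open>u1\<close>. The cycle condition on \<open>u\<close> places
      \<open>act b (u1 {})\<close> in the span of the images of the earlier actions, and regularity
      cancels \<open>act b\<close>.\<close>
    have "act b (u1 {}) = - kos A u0 {}" using k0[of "{}"] by (simp add: signed_def eq_neg_iff_add_eq_0 add.commute)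
    also have "\<dots> = (\<Sum>a\<in>A. act a (- u0 {a}))"
      by (simp add: kos_def contr_def signed_def sum_negf act_minus)
    finally have "act b (u1 {}) = (\<Sum>a\<in>insert b A \<inter> {..<b}. act a (- u0 {a}))"
      using b by (simp add: Int_absorb2 subset_iff)
    moreover have "u1 {} \<in> G" "- u0 {a} \<in> G" for a
      using uG zero neg by (auto simp: u1_def u0_def)
    ultimately obtain c where c: "\<And>a. c a \<in> G" "u1 {} = (\<Sum>a\<in>insert b A \<inter> {..<b}. act a (c a))"
      using regular_onD[OF insert.prems(1), of b "u1 {}" "\<lambda>a. - u0 {a}"] by blast
    then have c2: "u1 {} = (\<Sum>a\<in>A. act a (c a))"
      using b by (simp add: Int_absorb2 subset_iff)
    define t where "t = (\<lambda>Q. if Q \<subseteq> A \<and> card Q = 1 then c (the_elem Q) else 0)"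
    have st: "supp_fam A (Suc m) t"
      using insert.hyps(1) by (auto simp: supp_fam_def t_def 0 dest: finite_subset)
    have "kos A t {} = (\<Sum>a\<in>A. act a (c a))"
      unfolding kos_def by (rule sum.cong) (auto simp: contr_def signed_def t_def)
    then have kt: "kos A t {} = u1 {}" using c2 by simp
    have "kos A t Q = u1 Q" for Q
    proof (cases "Q = {}")
      case False
      have "kos A t Q = 0"
        using supp_fam_kos[OF st] False unfolding 0 supp_fam_def by (metis card_0_eq)
      moreover have "u1 Q = 0"
        using s1 False unfolding 0 supp_fam_def by (metis card_0_eq)
      ultimately show ?thesis by simp
    qed (simp add: kt)
    moreover have "range t \<subseteq> G" using c(1) zero by (auto simp: t_def)
    ultimately show ?thesis using st by blast
  next
    case (Suc m')
    have "kos A u1 Q = 0" for Q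
    proof (cases "Q \<subseteq> A")
      case False
      then show ?thesis using supp_fam_kos[OF s1[unfolded Suc]] by (auto simp: supp_fam_def)
    qed (rule k1)
    then have "kos A u1 = 0" by (simp add: fun_eq_iff)
    moreover have "range u1 \<subseteq> G" using uG zero by (auto simp: u1_def)
    ultimately show ?thesis using insert.IH[OF regA actA s1[unfolded Suc]] Suc by blast
  qed
  then obtain t1 where t1: "supp_fam A (Suc m) t1" "range t1 \<subseteq> G" "kos A t1 = u1" by blast
  \<comment> \<open>The subtracted term is what \<open>t1\<close>, placed on the sets containing
    \<open>b\<close>, contributes to the sets without \<open>b\<close>; these have
    \<open>Suc m\<close> elements, whence the sign.\<close>
  define w where "w = u0 - (\<lambda>Q. signed (Suc m) (act b (t1 Q)))"
  have ks: "kos A (\<lambda>Q. signed (Suc m) (act b (t1 Q))) = (\<lambda>Q. signed (Suc m) (act b (u1 Q)))"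
    unfolding t1(3)[symmetric]
    by (rule kos_map) (auto simp: act_signed act_minus act_sum signed_def sum_negf act_commute)
  have sw: "supp_fam A (Suc m) w"
    unfolding w_def by (intro supp_fam_diff s0 supp_fam_map[OF t1(1)]) auto
  have "kos A w Q = 0" for Q
  proof (cases "Q \<subseteq> A \<and> card Q = m")
    case True
    have "signed (Suc m) (act b (u1 Q)) = - signed (card Q) (act b (u1 Q))"
      using True by (simp add: signed_def)
    then show ?thesis using k0[of Q] True by (simp add: w_def kos_diff ks)
  next
    case False
    then show ?thesis using supp_fam_kos[OF sw] by (auto simp: supp_fam_def)
  qed
  then have kw: "kos A w = 0" by (simp add: fun_eq_iff)
  have "range w \<subseteq> G"
  proof -
    have "t1 Q \<in> G" for Q using t1(2) by blast
    then show ?thesis using uG zero by (auto simp: w_def u0_def intro!: diff sgn insert.prems(2))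
  qed
  then obtain t0 where t0: "supp_fam A (Suc (Suc m)) t0" "range t0 \<subseteq> G" "kos A t0 = w"
    using insert.IH[OF regA actA sw _ kw] by blast
  define t where "t = (\<lambda>Q. if b \<in> Q then t1 (Q - {b}) else t0 Q)"
  have st: "supp_fam (insert b A) (Suc (Suc m)) t"
    unfolding supp_fam_def
  proof (intro allI impI)
    fix Q assume "t Q \<noteq> 0"
    then consider "b \<in> Q" "t1 (Q - {b}) \<noteq> 0" | "b \<notin> Q" "t0 Q \<noteq> 0"
      by (auto simp: t_def split: if_splits)
    then show "Q \<subseteq> insert b A \<and> finite Q \<and> card Q = Suc (Suc m)"
    proof cases
      case 1
      then have "Q - {b} \<subseteq> A" "finite (Q - {b})" "card (Q - {b}) = Suc m"
        using t1(1)[unfolded supp_fam_def, rule_format, OF 1(2)] by simp_all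
      then show ?thesis using 1(1) by auto
    next
      case 2
      then show ?thesis using t0(1) by (auto simp: supp_fam_def)
    qed
  qed
  have "kos (insert b A) t R = u R" for R
  proof (cases "R \<subseteq> insert b A \<and> card R = Suc m")
    case False
    then have "u R = 0" using s by blast
    moreover have "kos (insert b A) t R = 0"
      using supp_fam_kos[OF st] False by (auto simp: supp_fam_def)
    ultimately show ?thesis by simp
  next
    case R: True
    show ?thesis
    proof (cases "b \<in> R")
      case True
      define Q where "Q = R - {b}"
      have Q: "Q \<subseteq> A" "R = insert b Q" using R True by (auto simp: Q_def)
      have "kos (insert b A) t R = kos A (\<lambda>S. t (insert b S)) Q"
        unfolding Q(2) by (rule kos_insert_inside[OF insert.hyps(1) b(1) Q(1)])
      also have "\<dots> = kos A t1 Q"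
      proof (rule kos_cong[OF _ Q(1)])
        fix S assume "S \<subseteq> A"
        then have "insert b S - {b} = S" using b(2) by auto
        then show "t (insert b S) = t1 S" by (simp add: t_def)
      qed
      also have "\<dots> = u R" using Q by (simp add: t1(3) u1_def)
      finally show ?thesis .
    next
      case False
      then have Q: "R \<subseteq> A" using R by auto
      have "kos A t R = kos A t0 R"
        by (rule kos_cong[OF _ Q]) (use b(2) in \<open>auto simp: t_def\<close>)
      moreover have "t (insert b R) = t1 R" using False by (simp add: t_def)
      ultimately have "kos (insert b A) t R = w R + signed (Suc m) (act b (t1 R))"
        using kos_insert_outside[OF insert.hyps(1) b(1) Q, of t] R t0(3) by simp
      then show ?thesis using Q by (simp add: w_def u0_def)
    qed
  qed
  moreover have "range t \<subseteq> G" using t0(2) t1(2) by (auto simp: t_def)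
  ultimately show ?case using st by (metis ext)
qed

end

section \<open>Chasing a double complex\<close>

text \<open>The indices are the resolution degree \<open>l\<close>, the exterior degree
  \<open>m\<close> and the internal degree \<open>j\<close> of the coefficients, which
  \<open>ks\<close> raises since it multiplies by linear forms. Both differentials are exact in
  positive positions, and zigzags compare the homology left at \<open>l = 0\<close> with that left
  at \<open>m = 0\<close>. Additivity of \<open>D\<close> is confined to the components, as a module
  homomorphism is arbitrary outside its carrier.\<close>

locale double_complex =
  fixes C :: "nat \<Rightarrow> nat \<Rightarrow> int \<Rightarrow> 'c::ab_group_add set"
    and D :: "nat \<Rightarrow> 'c \<Rightarrow> 'c" and ks :: "'c \<Rightarrow> 'c"
  assumes zero_in: "0 \<in> C l m j"
    and diff_in: "x \<in> C l m j \<Longrightarrow> y \<in> C l m j \<Longrightarrow> x - y \<in> C l m j"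
    and D_in: "x \<in> C (Suc l) m j \<Longrightarrow> D l x \<in> C l m j"
    and D_diff: "x \<in> C (Suc l) m j \<Longrightarrow> y \<in> C (Suc l) m j \<Longrightarrow> D l (x - y) = D l x - D l y"
    and ks_in: "x \<in> C l (Suc m) j \<Longrightarrow> ks x \<in> C l m (j + 1)"
    and ks_diff: "ks (x - y) = ks x - ks y"
    and D_D: "x \<in> C (Suc (Suc l)) m j \<Longrightarrow> D l (D (Suc l) x) = 0"
    and ks_ks: "ks (ks x) = 0"
    and ks_D: "x \<in> C (Suc l) m j \<Longrightarrow> ks (D l x) = D l (ks x)"
    and D_exact: "x \<in> C (Suc l) m j \<Longrightarrow> D l x = 0 \<Longrightarrow> \<exists>y\<in>C (Suc (Suc l)) m j. D (Suc l) y = x"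
    and ks_exact: "x \<in> C l (Suc m) j \<Longrightarrow> ks x = 0 \<Longrightarrow> \<exists>y\<in>C l (Suc (Suc m)) (j - 1). ks y = x"
begin

text \<open>
  \<open>zigzag l m j y x\<close> means that \<open>y \<in> C 0 (m + l) (j - l)\<close> and \<open>x \<in> C l m j\<close> are the ends of a
  staircase \<open>y = x\<^sub>0, x\<^sub>1, \<dots>, x\<^sub>l = x\<close> with \<open>ks x\<^sub>i = D i x\<^bsub>i+1\<^esub>\<close>.
\<close>

fun zigzag :: "nat \<Rightarrow> nat \<Rightarrow> int \<Rightarrow> 'c \<Rightarrow> 'c \<Rightarrow> bool" where
  "zigzag 0 m j y x \<longleftrightarrow> x = y \<and> x \<in> C 0 m j"
| "zigzag (Suc l) m j y x \<longleftrightarrow> x \<in> C (Suc l) m j \<and> (\<exists>x'. zigzag l (Suc m) (j - 1) y x' \<and> ks x' = D l x)"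

lemma add_in: "x \<in> C l m j \<Longrightarrow> y \<in> C l m j \<Longrightarrow> x + y \<in> C l m j"
  using diff_in[of x l m j "- y"] diff_in[OF zero_in, of y l m j] by simp

lemma zigzag_right: "zigzag l m j y x \<Longrightarrow> x \<in> C l m j"
  by (cases l) auto

lemma zigzag_left: "zigzag l m j y x \<Longrightarrow> y \<in> C 0 (m + l) (j - int l)"
  by (induction l arbitrary: m j x) (force simp: algebra_simps)+

lemma zigzag_diff:
  "zigzag l m j y x \<Longrightarrow> zigzag l m j y' x' \<Longrightarrow> zigzag l m j (y - y') (x - x')"
proof (induction l arbitrary: m j x x')
  case (Suc l)
  then obtain z z' where "zigzag l (Suc m) (j - 1) y z" "ks z = D l x"
    "zigzag l (Suc m) (j - 1) y' z'" "ks z' = D l x'" by auto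
  then have "zigzag l (Suc m) (j - 1) (y - y') (z - z')" "ks (z - z') = D l (x - x')"
    using Suc D_diff by (auto simp: ks_diff)
  then show ?case using Suc.prems by (auto intro: diff_in)
qed (auto intro: diff_in)

lemma zigzag_map:
  assumes "\<And>l m j x. x \<in> C l m j \<Longrightarrow> s x \<in> C l m j"
    and "\<And>l m j x. x \<in> C (Suc l) m j \<Longrightarrow> D l (s x) = s (D l x)" and "\<And>x. ks (s x) = s (ks x)"
  shows "zigzag l m j y x \<Longrightarrow> zigzag l m j (s y) (s x)"
proof (induction l arbitrary: m j x)
  case (Suc l)
  then obtain z where z: "zigzag l (Suc m) (j - 1) y z" "ks z = D l x" "x \<in> C (Suc l) m j" by auto
  then have "zigzag l (Suc m) (j - 1) (s y) (s z)" "ks (s z) = D l (s x)" "s x \<in> C (Suc l) m j"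
    using Suc.IH assms by auto
  then show ?case by auto
qed (auto intro: assms)

text \<open>Each step lifts \<open>ks x\<^sub>i\<close> through \<open>D\<close>. For positive
  \<open>i\<close> a lift exists by exactness, because \<open>ks\<close> has square zero and
  commutes with \<open>D\<close>; at \<open>i = 0\<close> there is a cokernel, hence the hypothesis
  on \<open>ks y\<close>.\<close>

lemma zigzag_from_left:
  assumes "y \<in> C 0 (m + l) (j - int l)" and "l = 0 \<or> ks y \<in> D 0 ` C 1 (m + l - 1) (j - int l + 1)"
  shows "\<exists>x. zigzag l m j y x"
  using assms
proof (induction l arbitrary: m j)
  case (Suc l)
  have "y \<in> C 0 (Suc m + l) (j - 1 - int l)" using Suc.prems(1) by (simp add: algebra_simps)
  then obtain x' where x': "zigzag l (Suc m) (j - 1) y x'"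
    using Suc.IH[of "Suc m" "j - 1"] Suc.prems(2) by (auto simp: algebra_simps)
  have "\<exists>x\<in>C (Suc l) m j. D l x = ks x'"
  proof (cases l)
    case 0
    then show ?thesis using x' Suc.prems(2) by auto
  next
    case (Suc l')
    have xin: "x' \<in> C (Suc l') (Suc m) (j - 1)" using zigzag_right[OF x'] Suc by simp
    obtain x'' where x'': "ks x'' = D l' x'" using x' Suc by auto
    have "D l' (ks x') = 0" using ks_D[OF xin] x'' ks_ks by metis
    then show ?thesis using D_exact[of "ks x'" l' m j] ks_in[OF xin] Suc by auto
  qed
  then show ?case using x' by fastforce
qed auto

text \<open>The mirror image of \<open>zigzag_from_left\<close>: later steps live in positive
  exterior degree, where \<open>ks\<close> is exact, so only the first one, which may start at
  \<open>m = 0\<close>, has to be supplied.\<close>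

lemma zigzag_from_right:
  assumes "x \<in> C l m j" and "l = 0 \<or> (\<exists>x'\<in>C (l - 1) (Suc m) (j - 1). ks x' = D (l - 1) x)"
  shows "\<exists>y. zigzag l m j y x"
  using assms
proof (induction l arbitrary: m j x)
  case (Suc l)
  then obtain x' where x': "x' \<in> C l (Suc m) (j - 1)" "ks x' = D l x" by auto
  have "l = 0 \<or> (\<exists>x''\<in>C (l - 1) (Suc (Suc m)) (j - 1 - 1). ks x'' = D (l - 1) x')"
  proof (cases l)
    case (Suc l')
    have "ks (D l' x') = 0"
      using ks_D[of x' l'] D_D[of x l'] x' Suc Suc.prems(1) by auto
    then show ?thesis using ks_exact[OF D_in, of x' l' m "j - 1"] x' Suc by auto
  qed simp
  then obtain y where "zigzag l (Suc m) (j - 1) y x'" using Suc.IH[OF x'(1)] by blast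
  then show ?case using x' Suc.prems(1) by auto
qed auto

text \<open>A decomposition travels along the staircase: if \<open>x' = ks u + D l u'\<close>, then
  \<open>D l\<close> kills \<open>x - ks u'\<close>, and exactness of \<open>D\<close> yields the
  next pair. The old \<open>u'\<close> becomes the new \<open>u\<close>.\<close>

lemma zigzag_left_boundary:
  assumes "zigzag l m j y x" and "y \<in> D 0 ` C 1 (m + l) (j - int l)"
  shows "\<exists>u\<in>C l (Suc m) (j - 1). \<exists>u'\<in>C (Suc l) m j. x = ks u + D l u'"
  using assms
proof (induction l arbitrary: m j x)
  case 0
  then obtain u' where "u' \<in> C 1 m j" "x = D 0 u'" by auto
  then show ?case using zero_in ks_diff[of 0 0] by (intro bexI[of _ 0] bexI[of _ u']) auto
next
  case (Suc l)
  then obtain x' where x': "zigzag l (Suc m) (j - 1) y x'" "ks x' = D l x" "x \<in> C (Suc l) m j" by auto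
  have "y \<in> D 0 ` C 1 (Suc m + l) (j - 1 - int l)" using Suc.prems(2) by (simp add: algebra_simps)
  then obtain u u' where u: "u \<in> C l (Suc (Suc m)) (j - 1 - 1)" "u' \<in> C (Suc l) (Suc m) (j - 1)"
    "x' = ks u + D l u'" using Suc.IH[OF x'(1)] by blast
  have in': "ks u' \<in> C (Suc l) m j" using ks_in[OF u(2)] by simp
  have "ks x' = D l (ks u')"
    using u(3) ks_diff[of "ks u + D l u'" "D l u'"] ks_D[OF u(2)] by (simp add: ks_ks)
  then have "D l (x - ks u') = 0" using D_diff[OF x'(3) in'] x'(2) by simp
  then obtain u'' where "u'' \<in> C (Suc (Suc l)) m j" "D (Suc l) u'' = x - ks u'"
    using D_exact[OF diff_in[OF x'(3) in']] by blast
  then show ?case using u(2) by (intro bexI[of _ u'] bexI[of _ u'']) auto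
qed

text \<open>The same in the other direction, with exactness of \<open>ks\<close> in place of that of
  \<open>D\<close>. Together with \<open>zigzag_left_boundary\<close> it makes the zigzag
  correspondence injective modulo boundaries both ways.\<close>

lemma zigzag_right_boundary:
  assumes "zigzag l m j y x" and "u \<in> C l (Suc m) (j - 1)" and "u' \<in> C (Suc l) m j"
    and "x = ks u + D l u'"
  shows "\<exists>v\<in>C 0 (Suc (m + l)) (j - int l - 1). \<exists>v'\<in>C 1 (m + l) (j - int l). y = ks v + D 0 v'"
  using assms
proof (induction l arbitrary: m j x u u')
  case (Suc l)
  then obtain x' where x': "zigzag l (Suc m) (j - 1) y x'" "ks x' = D l x" by auto
  have in': "ks u \<in> C (Suc l) m j" using ks_in[OF Suc.prems(2)] by simp
  have "D l x = D l (ks u)"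
    using D_diff[OF Suc.prems(3)[THEN D_in, THEN add_in[OF in']] in'] D_D[OF Suc.prems(3)] Suc.prems(4) by simp
  then have "ks (x' - D l u) = 0" using x'(2) ks_D[OF Suc.prems(2)] by (simp add: ks_diff)
  moreover have "x' - D l u \<in> C l (Suc m) (j - 1)"
    using zigzag_right[OF x'(1)] D_in[OF Suc.prems(2)] by (rule diff_in)
  ultimately obtain w where w: "w \<in> C l (Suc (Suc m)) (j - 1 - 1)" "ks w = x' - D l u"
    using ks_exact by blast
  have "x' = ks w + D l u" using w(2) by simp
  from Suc.IH[OF x'(1) w(1) Suc.prems(2) this] show ?case by (simp add: algebra_simps)
qed auto

end

section \<open>Dimension bounds from contractions\<close>

context vector_space
begin

text \<open>Rank-nullity as a statement on finite independent sets: preimages of \<open>T\<close>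
  are independent modulo the kernel, which contains \<open>S\<close>. In this form lower bounds can
  be propagated without knowing any dimension.\<close>

lemma independent_kernel_image:
  assumes add: "\<And>x y. f (x + y) = f x + f y" and scale: "\<And>c x. f (c *s x) = c *s f x"
    and S: "finite S" "independent S" "S \<subseteq> W" "\<And>x. x \<in> S \<Longrightarrow> f x = 0"
    and T: "finite T" "independent T" "T \<subseteq> f ` W"
  shows "\<exists>B\<subseteq>W. finite B \<and> independent B \<and> card B = card S + card T"
proof -
  have f0: "f 0 = 0" using scale[of 0 0] by simp
  have fsum: "f (\<Sum>x\<in>I. g x) = (\<Sum>x\<in>I. f (g x))" for I and g :: "'b \<Rightarrow> 'b"
    by (induction I rule: infinite_finite_induct) (auto simp: f0 add)
  have "\<exists>x. x \<in> W \<and> f x = t" if "t \<in> T" for t using T(3) that by auto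
  then obtain g where g: "g t \<in> W" "f (g t) = t" if "t \<in> T" for t by metis
  have inj: "inj_on g T" by (rule inj_onI) (metis g(2))
  have T0: "0 \<notin> T" using T(2) dependent_zero by blast
  have "g t \<notin> S" if "t \<in> T" for t using S(4)[of "g t"] g(2)[OF that] T0 that by auto
  then have disj: "S \<inter> g ` T = {}" by blast
  have "independent (S \<union> g ` T)"
  proof (rule independent_if_scalars_zero)
    show "finite (S \<union> g ` T)" using S(1) T(1) by simp
  next
    fix a x
    assume e: "(\<Sum>x\<in>S \<union> g ` T. a x *s x) = 0" and x: "x \<in> S \<union> g ` T"
    have e2: "(\<Sum>x\<in>S. a x *s x) + (\<Sum>t\<in>T. a (g t) *s g t) = 0"
      using e S(1) T(1) disj by (simp add: sum.union_disjoint sum.reindex[OF inj])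
    have "(\<Sum>t\<in>T. a (g t) *s t) = f ((\<Sum>x\<in>S. a x *s x) + (\<Sum>t\<in>T. a (g t) *s g t))"
      using S(4) g(2) by (simp add: add fsum scale)
    then have "(\<Sum>t\<in>T. a (g t) *s t) = 0" using e2 f0 by simp
    then have aT: "a (g t) = 0" if "t \<in> T" for t
      using independentD[OF T(2,1) subset_refl, of "\<lambda>t. a (g t)" t] that by blast
    then have "(\<Sum>x\<in>S. a x *s x) = 0" using e2 by simp
    then have aS: "a x = 0" if "x \<in> S" for x
      using independentD[OF S(2,1) subset_refl, of a x] that by blast
    show "a x = 0" using aS aT x by blast
  qed
  moreover have "card (S \<union> g ` T) = card S + card T"
    using S(1) T(1) disj inj by (simp add: card_Un_disjoint card_image)
  ultimately show ?thesis using S(1,3) T(1) g(1) by (intro exI[of _ "S \<union> g ` T"]) auto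
qed

text \<open>The finite set \<open>W\<close> guards against an infinite basis, whose cardinality, and
  with it \<open>dim\<close>, would be \<open>0\<close>.\<close>

lemma independent_card_le_dim_of_spanned:
  assumes "independent S" "S \<subseteq> U" "U \<subseteq> span W" "finite W"
  shows "finite S \<and> card S \<le> dim U"
proof -
  obtain B where B: "B \<subseteq> U" "independent B" "U \<subseteq> span B" "card B = dim U"
    using basis_exists by blast
  have "finite B" using independent_span_bound[OF assms(4) B(2)] B(1) assms(3) by blast
  then show ?thesis using independent_span_bound[OF _ assms(1), of B] assms(2) B by auto
qed

text \<open>Indices are selected, rather than vectors: \<open>B\<close> becomes the index set of a
  smaller Koszul complex, and the coefficients \<open>l\<close> become those of its linear
  forms.\<close>

lemma extract_spanning_indices:
  fixes f :: "nat \<Rightarrow> 'b"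
  assumes "finite A"
  obtains B and l :: "nat \<Rightarrow> nat \<Rightarrow> 'a" where "B \<subseteq> A" "inj_on f B" "independent (f ` B)"
    "\<And>v. v \<in> A \<Longrightarrow> f v = (\<Sum>b\<in>B. scale (l v b) (f b))"
proof -
  obtain Y where Y: "Y \<subseteq> f ` A" "independent Y" "f ` A \<subseteq> span Y"
    using maximal_independent_subset[of "f ` A"] by blast
  obtain B where B: "B \<subseteq> A" "inj_on f B" "Y = f ` B" using Y(1) subset_image_inj by metis
  have fin: "finite B" using B(1) assms finite_subset by blast
  have "\<exists>l. f v = (\<Sum>b\<in>B. scale (l b) (f b))" if "v \<in> A" for v
  proof -
    have "f v \<in> span (f ` B)" using Y(3) B(3) that by blast
    then obtain l where "f v = (\<Sum>y\<in>f ` B. scale (l y) y)"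
      unfolding span_finite[OF finite_imageI[OF fin]] by auto
    then have "f v = (\<Sum>b\<in>B. scale (l (f b)) (f b))" by (simp add: sum.reindex[OF B(2)])
    then show ?thesis by (rule exI[of _ "\<lambda>b. l (f b)"])
  qed
  then obtain l where "f v = (\<Sum>b\<in>B. scale (l v b) (f b))" if "v \<in> A" for v by metis
  then show ?thesis using that B Y(2) by blast
qed

lemma vector_space_pointwise: "vector_space (\<lambda>c (u :: 'i \<Rightarrow> 'b) i. scale c (u i))"
  by unfold_locales (auto simp: fun_eq_iff scale_right_distrib scale_left_distrib)

end

section \<open>Families of subspaces stable under contraction\<close>

locale family_space = vector_space scale for scale :: "'k::field \<Rightarrow> 'v::ab_group_add \<Rightarrow> 'v"
begin

definition fscale :: "'k \<Rightarrow> (nat set \<Rightarrow> 'v) \<Rightarrow> nat set \<Rightarrow> 'v" where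
  "fscale = (\<lambda>c u Q. scale c (u Q))"

sublocale fam: vector_space fscale
  unfolding fscale_def by (rule vector_space_pointwise)

lemma contr_scale: "contr v (fscale c u) = fscale c (contr v u)"
  by (rule ext) (auto simp: contr_def fscale_def signed_def)

text \<open>The structure on Koszul cycles that survives an induction on \<open>p\<close>: graded
  subspaces of an exterior algebra with coefficients, stable under contraction by the indices in
  \<open>A\<close>.\<close>

definition contr_closed :: "nat set \<Rightarrow> (nat \<Rightarrow> (nat set \<Rightarrow> 'v) set) \<Rightarrow> bool" where
  "contr_closed A U \<longleftrightarrow> (\<forall>a. fam.subspace (U a)) \<and> (\<forall>a. \<forall>u\<in>U a. supp_fam A a u) \<and>
     (\<forall>a. \<forall>v\<in>A. \<forall>u\<in>U (Suc a). contr v u \<in> U a)"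

lemma subspace_contr_image:
  assumes "fam.subspace W"
  shows "fam.subspace (contr v ` W)"
proof (rule fam.subspaceI)
  show "0 \<in> contr v ` W" using contr_0[of v] fam.subspace_0[OF assms] by (metis imageI)
next
  fix x y assume "x \<in> contr v ` W" "y \<in> contr v ` W"
  then obtain a b where "x = contr v a" "y = contr v b" "a \<in> W" "b \<in> W" by blast
  then show "x + y \<in> contr v ` W"
    using fam.subspace_add[OF assms, of a b] contr_add[of v a b] by (metis imageI)
next
  fix c x assume "x \<in> contr v ` W"
  then obtain a where "x = contr v a" "a \<in> W" by blast
  then show "fscale c x \<in> contr v ` W"
    using fam.subspace_scale[OF assms, of a c] contr_scale[of v c a] by (metis imageI)
qed

text \<open>Contractions anticommute, so contracting \<open>contr v t\<close> by \<open>w\<close>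
  gives \<open>contr v (- contr w t)\<close>, again in the image. Hence the images of one
  contraction can replace \<open>U\<close> in an induction.\<close>

lemma contr_closed_image:
  assumes "contr_closed A U" and "v \<in> A"
  shows "contr_closed A (\<lambda>a. contr v ` U (Suc a))"
  unfolding contr_closed_def
proof (intro conjI allI ballI)
  fix a
  show "fam.subspace (contr v ` U (Suc a))"
    using assms(1) by (intro subspace_contr_image) (simp add: contr_closed_def)
  show "supp_fam A a u" if "u \<in> contr v ` U (Suc a)" for u
  proof -
    obtain t where "t \<in> U (Suc a)" "u = contr v t" using \<open>u \<in> _\<close> by blast
    then show ?thesis using assms(1) by (auto simp: contr_closed_def intro: supp_fam_contr)
  qed
  fix w u assume w: "w \<in> A" and "u \<in> contr v ` U (Suc (Suc a))"
  then obtain t where t: "t \<in> U (Suc (Suc a))" "u = contr v t" by blast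
  have "contr w t \<in> U (Suc a)" using t(1) w assms(1) by (simp add: contr_closed_def)
  then have "- contr w t \<in> U (Suc a)" using assms(1) fam.subspace_neg by (simp add: contr_closed_def)
  moreover have "contr w u = contr v (- contr w t)"
    using contr_contr[of w v t] contr_diff[of v 0 "contr w t"] by (simp add: t(2) contr_0)
  ultimately show "contr w u \<in> contr v ` U (Suc a)" by blast
qed

lemma contr_image_subset: "contr_closed A U \<Longrightarrow> v \<in> A \<Longrightarrow> contr v ` U (Suc a) \<subseteq> U a"
  by (auto simp: contr_closed_def)

text \<open>The image of \<open>contr v\<close> from degree \<open>Suc (Suc a)\<close> lies in the
  kernel of \<open>contr v\<close> on degree \<open>Suc a\<close>, since \<open>contr v\<close>
  squares to zero; rank-nullity adds the image in degree \<open>a\<close>.\<close>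

lemma contr_closed_extend_independent:
  assumes "contr_closed A U" and "v \<in> A"
    and "S \<subseteq> contr v ` U (Suc (Suc a))" "finite S" "fam.independent S"
    and "T \<subseteq> contr v ` U (Suc a)" "finite T" "fam.independent T"
  shows "\<exists>B\<subseteq>U (Suc a). finite B \<and> fam.independent B \<and> card B = card S + card T"
proof (rule fam.independent_kernel_image)
  show "contr v (x + y) = contr v x + contr v y" "contr v (fscale c x) = fscale c (contr v x)" for x y c
    by (rule contr_add, rule contr_scale)
  show "S \<subseteq> U (Suc a)" using assms(3) contr_image_subset[OF assms(1,2)] by blast
  show "contr v x = 0" if "x \<in> S" for x using assms(3) that contr_self by blast
qed (use assms in auto)

lemma binomial_bound:
  assumes "contr_closed A U" and "z \<in> U p" and "z \<noteq> 0" and "i \<le> p"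
  shows "\<exists>S\<subseteq>U i. finite S \<and> fam.independent S \<and> card S = p choose i"
  using assms
proof (induction p arbitrary: U z i)
  case 0
  then show ?case by (intro exI[of _ "{z}"]) auto
next
  case (Suc p)
  have "supp_fam A (Suc p) z" using Suc.prems(1,2) by (auto simp: contr_closed_def)
  then obtain v where v: "v \<in> A" "contr v z \<noteq> 0" using nonzero_contr_exists Suc.prems(3) by blast
  note IH = Suc.IH[OF contr_closed_image[OF Suc.prems(1) v(1)] imageI[OF Suc.prems(2)] v(2)]
  show ?case
  proof (cases i)
    case 0
    obtain S where "S \<subseteq> contr v ` U (Suc 0)" "finite S \<and> fam.independent S \<and> card S = p choose 0"
      using IH[of 0] by blast
    then show ?thesis using contr_image_subset[OF Suc.prems(1) v(1), of 0] 0 by auto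
  next
    case i: (Suc i')
    obtain T where T: "T \<subseteq> contr v ` U (Suc i')" "finite T" "fam.independent T" "card T = p choose i'"
      using IH[of i'] Suc.prems(4) i by auto
    \<comment> \<open>In the top position \<open>i = Suc p\<close> the induction hypothesis is out
      of range, but there \<open>p choose Suc i'\<close> is zero.\<close>
    have "\<exists>S\<subseteq>contr v ` U (Suc (Suc i')). finite S \<and> fam.independent S \<and> card S = p choose (Suc i')"
    proof (cases "Suc i' \<le> p")
      case True
      then show ?thesis using IH[of "Suc i'"] by auto
    next
      case False
      then show ?thesis by (intro exI[of _ "{}"]) (auto simp: binomial_eq_0 fam.independent_empty)
    qed
    then obtain S where S: "S \<subseteq> contr v ` U (Suc (Suc i'))" "finite S" "fam.independent S"
      "card S = p choose (Suc i')" by blast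
    have "Suc p choose i = card S + card T" using S(4) T(4) i by simp
    then show ?thesis
      using contr_closed_extend_independent[OF Suc.prems(1) v(1) S(1-3) T(1-3)] i by simp
  qed
qed

lemma contr_closed_nonzero_0:
  assumes "contr_closed A U" and "z \<in> U p" and "z \<noteq> 0"
  shows "\<exists>w\<in>U 0. w \<noteq> 0"
proof -
  obtain S where S: "S \<subseteq> U 0" "finite S" "fam.independent S" "card S = 1"
    using binomial_bound[OF assms, of 0] by auto
  then obtain w where "S = {w}" using card_1_singletonE by blast
  then show ?thesis using S by auto
qed

text \<open>
  In case \<open>Z\<close> picks out Koszul cycles over a torsion-free module, the hypothesis \<open>strict\<close>
  holds, and the bound of \<open>binomial_bound\<close> improves.
\<close>

lemma binomial_bound_strict:
  assumes strict: "\<And>W v. contr_closed A W \<Longrightarrow> (\<forall>a. \<forall>u\<in>W a. Z u) \<Longrightarrow> v \<in> A \<Longrightarrow>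
      \<exists>w\<in>W 0. w \<noteq> 0 \<Longrightarrow> \<exists>w\<in>W 0. w \<notin> contr v ` W 1"
    and Z: "\<And>v u. v \<in> A \<Longrightarrow> Z u \<Longrightarrow> Z (contr v u)"
    and "contr_closed A U" and "\<forall>a. \<forall>u\<in>U a. Z u" and "z \<in> U p" and "z \<noteq> 0" and "i \<le> p"
  shows "\<exists>S\<subseteq>U i. finite S \<and> fam.independent S \<and> card S = Suc p choose Suc i"
  using assms(3-)
proof (induction p arbitrary: U z i)
  case 0
  then show ?case by (intro exI[of _ "{z}"]) auto
next
  case (Suc p)
  have "supp_fam A (Suc p) z" using Suc.prems(1,3) by (auto simp: contr_closed_def)
  then obtain v where v: "v \<in> A" "contr v z \<noteq> 0" using nonzero_contr_exists Suc.prems(4) by blast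
  have "\<forall>a. \<forall>u\<in>contr v ` U (Suc a). Z u" using Suc.prems(2) Z[OF v(1)] by blast
  note IH = Suc.IH[OF contr_closed_image[OF Suc.prems(1) v(1)] this imageI[OF Suc.prems(3)] v(2)]
  show ?case
  proof (cases i)
    case 0
    \<comment> \<open>The images alone give \<open>Suc p\<close> independent vectors in degree
      \<open>0\<close>; the extra one required by \<open>Suc (Suc p)\<close> is an element outside
      \<open>contr v\<close> of the next degree, and hence outside the span of
      \<open>S\<close>.\<close>
    obtain S where S: "S \<subseteq> contr v ` U (Suc 0)" "finite S" "fam.independent S" "card S = Suc p choose 1"
      using IH[of 0] by auto
    obtain w where w: "w \<in> U 0" "w \<notin> contr v ` U 1"
      using strict[OF Suc.prems(1,2) v(1)] contr_closed_nonzero_0[OF Suc.prems(1,3,4)] by auto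
    have "fam.subspace (contr v ` U 1)"
      using Suc.prems(1) by (intro subspace_contr_image) (simp add: contr_closed_def)
    then have "fam.span S \<subseteq> contr v ` U 1" using S(1) by (intro fam.span_minimal) auto
    then have "w \<notin> fam.span S" using w(2) by blast
    then have "fam.independent (insert w S)" "w \<notin> S"
      using S(3) fam.independent_insertI fam.span_base by blast+
    then show ?thesis
      using S w(1) contr_image_subset[OF Suc.prems(1) v(1), of 0] 0
      by (intro exI[of _ "insert w S"]) auto
  next
    case i: (Suc i')
    obtain T where T: "T \<subseteq> contr v ` U (Suc i')" "finite T" "fam.independent T"
      "card T = Suc p choose Suc i'"
      using IH[of i'] Suc.prems(5) i by auto
    have "\<exists>S\<subseteq>contr v ` U (Suc (Suc i')). finite S \<and> fam.independent S \<and> card S = Suc p choose (Suc (Suc i'))"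
    proof (cases "Suc i' \<le> p")
      case True
      then show ?thesis using IH[of "Suc i'"] by auto
    next
      case False
      then show ?thesis by (intro exI[of _ "{}"]) (auto simp: binomial_eq_0 fam.independent_empty)
    qed
    then obtain S where S: "S \<subseteq> contr v ` U (Suc (Suc i'))" "finite S" "fam.independent S"
      "card S = Suc p choose (Suc (Suc i'))" by blast
    have "Suc (Suc p) choose Suc i = card S + card T" using S(4) T(4) i by simp
    then show ?thesis
      using contr_closed_extend_independent[OF Suc.prems(1) v(1) S(1-3) T(1-3)] i by simp
  qed
qed

end

section \<open>Dimensions of module records\<close>

context vector_space
begin

text \<open>\<open>vdim\<close> selects by \<open>THE\<close> the cardinality of a finite basis in
  the sense of unique representation. Such bases correspond under \<open>\<phi>\<close> to bases of
  \<open>U\<close>, so the cardinality is unique; the finite spanning set provides one, so that the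
  default value \<open>0\<close> is avoided.\<close>

lemma vdim_eq_dim:
  fixes V :: "('a, 'v) module" and \<phi> :: "'v \<Rightarrow> 'b"
  assumes bij: "bij_betw \<phi> (carrier V) U"
    and add: "\<And>x y. x \<in> carrier V \<Longrightarrow> y \<in> carrier V \<Longrightarrow> x \<oplus>\<^bsub>V\<^esub> y \<in> carrier V \<and> \<phi> (x \<oplus>\<^bsub>V\<^esub> y) = \<phi> x + \<phi> y"
    and smult: "\<And>c x. x \<in> carrier V \<Longrightarrow> c \<odot>\<^bsub>V\<^esub> x \<in> carrier V \<and> \<phi> (c \<odot>\<^bsub>V\<^esub> x) = scale c (\<phi> x)"
    and zero: "\<zero>\<^bsub>V\<^esub> \<in> carrier V" "\<phi> \<zero>\<^bsub>V\<^esub> = 0"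
    and spanned: "U \<subseteq> span W" "finite W"
  shows "vdim (ring_of_type_algebra :: 'a ring) V = dim U"
proof -
  let ?R = "ring_of_type_algebra :: 'a ring"
  have R: "carrier ?R = UNIV" by (simp add: ring_of_type_algebra_def)
  have inj: "x = y" if "\<phi> x = \<phi> y" "x \<in> carrier V" "y \<in> carrier V" for x y
    using bij that by (auto simp: bij_betw_def inj_on_def)
  \<comment> \<open>\<open>V\<close> is a bare record; the laws that \<open>finsum\<close> relies on
    are pulled back along the injective \<open>\<phi>\<close>.\<close>
  interpret abelian_monoid V
  proof (rule abelian_monoidI)
    fix x y z assume xyz: "x \<in> carrier V" "y \<in> carrier V" "z \<in> carrier V"
    show "x \<oplus>\<^bsub>V\<^esub> y \<oplus>\<^bsub>V\<^esub> z = x \<oplus>\<^bsub>V\<^esub> (y \<oplus>\<^bsub>V\<^esub> z)"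
      by (rule inj) (simp_all add: add xyz add.assoc)
    show "x \<oplus>\<^bsub>V\<^esub> y = y \<oplus>\<^bsub>V\<^esub> x"
      by (rule inj) (simp_all add: add xyz add.commute)
    show "\<zero>\<^bsub>V\<^esub> \<oplus>\<^bsub>V\<^esub> x = x"
      by (rule inj) (simp_all add: add xyz zero)
  qed (simp_all add: add zero)
  have phi_sum: "\<phi> (\<Oplus>\<^bsub>V\<^esub>b\<in>B. c b \<odot>\<^bsub>V\<^esub> b) = (\<Sum>b\<in>B. scale (c b) (\<phi> b))"
    if "finite B" "B \<subseteq> carrier V" for B c
    using that
  proof (induction B)
    case (insert b B)
    have mem: "(\<lambda>b. c b \<odot>\<^bsub>V\<^esub> b) \<in> B \<rightarrow> carrier V" using insert.prems smult by auto
    then have "(\<Oplus>\<^bsub>V\<^esub>b\<in>B. c b \<odot>\<^bsub>V\<^esub> b) \<in> carrier V" by (rule finsum_closed)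
    then show ?case using insert mem smult add by simp
  qed (simp add: zero)
  have card: "card B = dim U" if B: "is_finite_basis ?R V B" for B
  proof -
    have fin: "finite B" "B \<subseteq> carrier V" using B by (auto simp: is_finite_basis_def)
    have repr: "\<exists>!c. c \<in> B \<rightarrow>\<^sub>E UNIV \<and> v = (\<Oplus>\<^bsub>V\<^esub>b\<in>B. c b \<odot>\<^bsub>V\<^esub> b)" if "v \<in> carrier V" for v
      using B that by (simp add: is_finite_basis_def R)
    have injB: "inj_on \<phi> B" using fin(2) by (intro inj_onI) (auto intro: inj)
    have "independent (\<phi> ` B)"
    proof (rule independent_if_scalars_zero)
      show "finite (\<phi> ` B)" using fin by simp
      fix d x assume e: "(\<Sum>x\<in>\<phi> ` B. scale (d x) x) = 0" and x: "x \<in> \<phi> ` B"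
      define c where "c = restrict (\<lambda>b. d (\<phi> b)) B"
      have "(\<Sum>b\<in>B. scale (c b) (\<phi> b)) = 0"
        using e by (simp add: sum.reindex[OF injB] c_def)
      then have "\<phi> (\<Oplus>\<^bsub>V\<^esub>b\<in>B. c b \<odot>\<^bsub>V\<^esub> b) = \<phi> \<zero>\<^bsub>V\<^esub>" using phi_sum[OF fin] zero(2) by simp
      moreover have mem: "(\<lambda>b. a b \<odot>\<^bsub>V\<^esub> b) \<in> B \<rightarrow> carrier V" for a using fin(2) smult by auto
      ultimately have 1: "\<zero>\<^bsub>V\<^esub> = (\<Oplus>\<^bsub>V\<^esub>b\<in>B. c b \<odot>\<^bsub>V\<^esub> b)"
        using inj zero(1) finsum_closed[OF mem[of c]] by metis
      \<comment> \<open>The zero coefficients in extensional form. Both \<open>c\<close> and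
        \<open>o'\<close> represent the zero vector, so uniqueness of representation forces
        \<open>c = o'\<close>.\<close>
      define o' where "o' = restrict (\<lambda>b. 0 :: 'a) B"
      have "\<phi> (\<Oplus>\<^bsub>V\<^esub>b\<in>B. o' b \<odot>\<^bsub>V\<^esub> b) = \<phi> \<zero>\<^bsub>V\<^esub>"
        unfolding phi_sum[OF fin] zero(2) by (simp add: o'_def)
      then have 2: "\<zero>\<^bsub>V\<^esub> = (\<Oplus>\<^bsub>V\<^esub>b\<in>B. o' b \<odot>\<^bsub>V\<^esub> b)"
        using inj zero(1) finsum_closed[OF mem[of o']] by metis
      have "c \<in> B \<rightarrow>\<^sub>E UNIV" "o' \<in> B \<rightarrow>\<^sub>E UNIV" by (auto simp: c_def o'_def)
      then have "c = o'" using repr[OF zero(1)] 1 2 by blast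
      then show "d x = 0" using x by (auto simp: c_def o'_def fun_eq_iff split: if_splits)
    qed
    moreover have "U \<subseteq> span (\<phi> ` B)"
    proof
      fix u assume "u \<in> U"
      then obtain v where v: "v \<in> carrier V" "u = \<phi> v" using bij by (auto simp: bij_betw_def)
      then obtain c where "v = (\<Oplus>\<^bsub>V\<^esub>b\<in>B. c b \<odot>\<^bsub>V\<^esub> b)" using repr by blast
      then have u: "u = (\<Sum>b\<in>B. scale (c b) (\<phi> b))" using v(2) phi_sum[OF fin] by simp
      show "u \<in> span (\<phi> ` B)" unfolding u by (intro span_sum span_scale span_base) auto
    qed
    moreover have "\<phi> ` B \<subseteq> U" using fin(2) bij by (auto simp: bij_betw_def)
    ultimately have "card (\<phi> ` B) = dim U" using basis_card_eq_dim by blast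
    then show ?thesis by (simp add: card_image[OF injB])
  qed
  have "\<exists>B. is_finite_basis ?R V B"
  proof -
    obtain Y where Y: "Y \<subseteq> U" "independent Y" "U \<subseteq> span Y" using basis_exists[of U] by metis
    have finY: "finite Y" using independent_span_bound[OF spanned(2) Y(2)] Y(1) spanned(1) by blast
    define g where "g = inv_into (carrier V) \<phi>"
    have g: "g y \<in> carrier V" "\<phi> (g y) = y" if "y \<in> Y" for y
      using that Y(1) bij by (auto simp: g_def bij_betw_def inv_into_into f_inv_into_f subset_iff)
    have injg: "inj_on g Y" by (rule inj_onI) (metis g(2))
    have fin: "finite (g ` Y)" "g ` Y \<subseteq> carrier V" using finY g by auto
    have mem: "(\<lambda>b. a b \<odot>\<^bsub>V\<^esub> b) \<in> g ` Y \<rightarrow> carrier V" for a using fin(2) smult by auto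
    have phi_sum': "\<phi> (\<Oplus>\<^bsub>V\<^esub>b\<in>g ` Y. c b \<odot>\<^bsub>V\<^esub> b) = (\<Sum>y\<in>Y. scale (c (g y)) y)" for c
      unfolding phi_sum[OF fin] using g by (simp add: sum.reindex[OF injg])
    have "\<forall>v\<in>carrier V. \<exists>!c. c \<in> g ` Y \<rightarrow>\<^sub>E UNIV \<and> v = (\<Oplus>\<^bsub>V\<^esub>b\<in>g ` Y. c b \<odot>\<^bsub>V\<^esub> b)"
    proof (intro ballI ex_ex1I)
      fix v assume v: "v \<in> carrier V"
      have "\<phi> v \<in> span Y" using v Y(3) bij by (auto simp: bij_betw_def)
      then obtain a where a: "\<phi> v = (\<Sum>y\<in>Y. scale (a y) y)" unfolding span_finite[OF finY] by auto
      define c where "c = restrict (\<lambda>b. a (\<phi> b)) (g ` Y)"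
      have "\<phi> (\<Oplus>\<^bsub>V\<^esub>b\<in>g ` Y. c b \<odot>\<^bsub>V\<^esub> b) = \<phi> v"
        unfolding phi_sum' a by (rule sum.cong) (auto simp: c_def g)
      then have "v = (\<Oplus>\<^bsub>V\<^esub>b\<in>g ` Y. c b \<odot>\<^bsub>V\<^esub> b)"
        using inj v finsum_closed[OF mem[of c]] by metis
      then show "\<exists>c. c \<in> g ` Y \<rightarrow>\<^sub>E UNIV \<and> v = (\<Oplus>\<^bsub>V\<^esub>b\<in>g ` Y. c b \<odot>\<^bsub>V\<^esub> b)"
        by (intro exI[of _ c]) (auto simp: c_def)
    next
      fix v c c'
      assume c: "c \<in> g ` Y \<rightarrow>\<^sub>E UNIV \<and> v = (\<Oplus>\<^bsub>V\<^esub>b\<in>g ` Y. c b \<odot>\<^bsub>V\<^esub> b)"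
        and c': "c' \<in> g ` Y \<rightarrow>\<^sub>E UNIV \<and> v = (\<Oplus>\<^bsub>V\<^esub>b\<in>g ` Y. c' b \<odot>\<^bsub>V\<^esub> b)"
      have "(\<Sum>y\<in>Y. scale (c (g y)) y) = (\<Sum>y\<in>Y. scale (c' (g y)) y)"
        using c c' phi_sum' by metis
      then have "(\<Sum>y\<in>Y. scale (c (g y) - c' (g y)) y) = 0"
        by (simp add: scale_left_diff_distrib sum_subtractf)
      then have eq: "c (g y) = c' (g y)" if "y \<in> Y" for y
        using independentD[OF Y(2) finY subset_refl, of "\<lambda>y. c (g y) - c' (g y)" y] that by simp
      show "c = c'"
      proof (rule PiE_ext)
        show "c \<in> g ` Y \<rightarrow>\<^sub>E UNIV" "c' \<in> g ` Y \<rightarrow>\<^sub>E UNIV" using c c' by auto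
      qed (use eq in auto)
    qed
    then have "is_finite_basis ?R V (g ` Y)"
      unfolding is_finite_basis_def R by (intro conjI fin)
    then show ?thesis ..
  qed
  then obtain B where B: "is_finite_basis ?R V B" ..
  then have "(THE d. \<exists>B. is_finite_basis ?R V B \<and> card B = d) = dim U"
    using card by (intro the_equality) auto
  then show ?thesis using B by (auto simp: vdim_def)
qed

text \<open>The isomorphism may be given as a relation; this saves choosing representatives.\<close>

lemma vdim_eq_dim_rel:
  fixes V :: "('a, 'v) module" and T :: "'v \<Rightarrow> 'b \<Rightarrow> bool"
  assumes dom: "\<And>x. x \<in> carrier V \<Longrightarrow> \<exists>u. T x u" and ran: "\<And>u. u \<in> U \<Longrightarrow> \<exists>x. T x u"
    and mem: "\<And>x u. T x u \<Longrightarrow> x \<in> carrier V \<and> u \<in> U"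
    and functional: "\<And>x u u'. T x u \<Longrightarrow> T x u' \<Longrightarrow> u = u'" and inj: "\<And>x x' u. T x u \<Longrightarrow> T x' u \<Longrightarrow> x = x'"
    and add: "\<And>x y u w. T x u \<Longrightarrow> T y w \<Longrightarrow> T (x \<oplus>\<^bsub>V\<^esub> y) (u + w)"
    and smult: "\<And>c x u. T x u \<Longrightarrow> T (c \<odot>\<^bsub>V\<^esub> x) (scale c u)"
    and zero: "T \<zero>\<^bsub>V\<^esub> 0"
    and spanned: "U \<subseteq> span W" "finite W"
  shows "vdim (ring_of_type_algebra :: 'a ring) V = dim U"
proof -
  define \<phi> where "\<phi> x = (THE u. T x u)" for x
  have phi: "\<phi> x = u" if "T x u" for x u
    unfolding \<phi>_def using that functional by (intro the_equality)
  have T: "T x (\<phi> x)" if "x \<in> carrier V" for x using dom[OF that] phi by auto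
  show ?thesis
  proof (rule vdim_eq_dim[OF _ _ _ _ _ spanned])
    show "bij_betw \<phi> (carrier V) U"
      unfolding bij_betw_def
    proof
      show "inj_on \<phi> (carrier V)" using T inj by (intro inj_onI) metis
      show "\<phi> ` carrier V = U"
      proof
        show "\<phi> ` carrier V \<subseteq> U" using T mem by blast
        show "U \<subseteq> \<phi> ` carrier V"
        proof
          fix u assume "u \<in> U"
          then obtain x where "T x u" using ran by blast
          then show "u \<in> \<phi> ` carrier V" using phi mem by (metis imageI)
        qed
      qed
    qed
  next
    fix x y assume "x \<in> carrier V" "y \<in> carrier V"
    then have "T (x \<oplus>\<^bsub>V\<^esub> y) (\<phi> x + \<phi> y)" using T add by blast
    then show "x \<oplus>\<^bsub>V\<^esub> y \<in> carrier V \<and> \<phi> (x \<oplus>\<^bsub>V\<^esub> y) = \<phi> x + \<phi> y" using mem phi by blast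
  next
    fix c x assume "x \<in> carrier V"
    then have "T (c \<odot>\<^bsub>V\<^esub> x) (scale c (\<phi> x))" using T smult by blast
    then show "c \<odot>\<^bsub>V\<^esub> x \<in> carrier V \<and> \<phi> (c \<odot>\<^bsub>V\<^esub> x) = scale c (\<phi> x)" using mem phi by blast
  next
    show "\<zero>\<^bsub>V\<^esub> \<in> carrier V" "\<phi> \<zero>\<^bsub>V\<^esub> = 0" using zero mem phi by auto
  qed
qed

end

section \<open>Polynomials\<close>

abbreviation coef :: "('m \<Rightarrow>\<^sub>0 'k::zero) \<Rightarrow> 'm \<Rightarrow> 'k" where
  "coef \<equiv> Poly_Mapping.lookup"

abbreviation monom_keys :: "('m \<Rightarrow>\<^sub>0 'k::zero) \<Rightarrow> 'm set" where
  "monom_keys \<equiv> Poly_Mapping.keys"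

abbreviation mterm :: "'m \<Rightarrow> 'k::zero \<Rightarrow> 'm \<Rightarrow>\<^sub>0 'k" where
  "mterm \<equiv> Poly_Mapping.single"

abbreviation mconst :: "'k::field \<Rightarrow> 'k mpoly" where
  "mconst c \<equiv> mterm 0 c"

definition mvar :: "nat \<Rightarrow> 'k::field mpoly" where
  "mvar v = mterm (mterm v 1) 1"

definition mpolys :: "nat \<Rightarrow> 'k::field mpoly set" where
  "mpolys n = {f. \<forall>m\<in>monom_keys f. monom_keys m \<subseteq> {..<n}}"

definition mdeg :: "(nat \<Rightarrow>\<^sub>0 nat) \<Rightarrow> nat" where
  "mdeg m = (\<Sum>i\<in>monom_keys m. coef m i)"

lemma mdeg_superset: "finite I \<Longrightarrow> monom_keys m \<subseteq> I \<Longrightarrow> mdeg m = (\<Sum>i\<in>I. coef m i)"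
  unfolding mdeg_def by (rule sum.mono_neutral_left) (auto simp: in_keys_iff)

lemma mdeg_add: "mdeg (m + m') = mdeg m + mdeg m'"
proof -
  let ?I = "monom_keys m \<union> monom_keys m'"
  have "mdeg (m + m') = (\<Sum>i\<in>?I. coef (m + m') i)"
    by (rule mdeg_superset) (auto simp: keys_add)
  also have "\<dots> = mdeg m + mdeg m'"
    using mdeg_superset[of ?I m] mdeg_superset[of ?I m'] by (simp add: lookup_add sum.distrib)
  finally show ?thesis .
qed

lemma mdeg_0 [simp]: "mdeg 0 = 0"
  by (simp add: mdeg_def)

lemma mdeg_single [simp]: "mdeg (mterm v e) = e"
  by (cases "e = 0") (auto simp: mdeg_def)

lemma coef_le_mdeg: "coef m v \<le> mdeg m"
proof (cases "v \<in> monom_keys m")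
  case True
  then show ?thesis unfolding mdeg_def by (intro member_le_sum) auto
qed (simp add: in_keys_iff)

lemma keys_add_nat: "monom_keys (m + m') = monom_keys m \<union> monom_keys (m' :: nat \<Rightarrow>\<^sub>0 nat)"
  by (auto simp: in_keys_iff lookup_add)

lemma sum_terms: "f = (\<Sum>m\<in>monom_keys f. mterm m (coef f m))"
proof (rule poly_mapping_eqI)
  fix k
  have "coef (\<Sum>m\<in>monom_keys f. mterm m (coef f m)) k = (\<Sum>m\<in>monom_keys f. if m = k then coef f m else 0)"
    unfolding lookup_sum by (rule sum.cong) (auto simp: lookup_single when_def)
  also have "\<dots> = coef f k" by (auto simp: sum.delta in_keys_iff)
  finally show "coef f k = coef (\<Sum>m\<in>monom_keys f. mterm m (coef f m)) k" ..
qed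

lemma carrier_mpoly_ring: "carrier (mpoly_ring n) = mpolys n"
  by (simp add: mpoly_ring_def mpolys_def)

lemma mpoly_ring_simps:
  "\<zero>\<^bsub>mpoly_ring n\<^esub> = 0" "\<one>\<^bsub>mpoly_ring n\<^esub> = 1"
  "f \<oplus>\<^bsub>mpoly_ring n\<^esub> g = f + g" "f \<otimes>\<^bsub>mpoly_ring n\<^esub> g = f * g"
  by (simp_all add: mpoly_ring_def ring_of_type_algebra_def)

lemma mpolys_0 [simp]: "0 \<in> mpolys n" and mpolys_const [simp]: "mconst c \<in> mpolys n"
  and mpolys_1 [simp]: "1 \<in> mpolys n"
  by (auto simp: mpolys_def)

lemma mpolys_term: "monom_keys m \<subseteq> {..<n} \<Longrightarrow> mterm m c \<in> mpolys n"
  by (auto simp: mpolys_def)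

lemma mpolys_var: "v < n \<Longrightarrow> mvar v \<in> mpolys n"
  by (auto simp: mpolys_def mvar_def)

lemma mpolys_add: "f \<in> mpolys n \<Longrightarrow> g \<in> mpolys n \<Longrightarrow> f + g \<in> mpolys n"
  using keys_add[of f g] unfolding mpolys_def by blast

lemma mpolys_uminus: "f \<in> mpolys n \<Longrightarrow> - f \<in> mpolys n"
  unfolding mpolys_def by (auto simp: in_keys_iff)

lemma mpolys_diff: "f \<in> mpolys n \<Longrightarrow> g \<in> mpolys n \<Longrightarrow> f - g \<in> mpolys n"
  using mpolys_add[of f n "- g"] mpolys_uminus[of g n] by simp

lemma mpolys_mult: "f \<in> mpolys n \<Longrightarrow> g \<in> mpolys n \<Longrightarrow> f * g \<in> mpolys n"
  unfolding mpolys_def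
proof (intro CollectI ballI)
  fix m assume f: "f \<in> {f. \<forall>m\<in>monom_keys f. monom_keys m \<subseteq> {..<n}}"
    and g: "g \<in> {f. \<forall>m\<in>monom_keys f. monom_keys m \<subseteq> {..<n}}" and "m \<in> monom_keys (f * g)"
  then obtain a b where "m = a + b" "a \<in> monom_keys f" "b \<in> monom_keys g"
    using keys_mult[of f g] by blast
  then show "monom_keys m \<subseteq> {..<n}" using f g by (auto simp: keys_add_nat)
qed

lemma mpolys_sum: "(\<And>i. i \<in> I \<Longrightarrow> f i \<in> mpolys n) \<Longrightarrow> (\<Sum>i\<in>I. f i) \<in> mpolys n"
  by (induction I rule: infinite_finite_induct) (auto intro: mpolys_add)

lemma mconst_mult: "mconst c * mconst d = mconst (c * d)"
  by (simp add: mult_single)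

lemma monom_split:
  assumes "v \<in> monom_keys (m :: nat \<Rightarrow>\<^sub>0 nat)"
  shows "m = mterm v 1 + (m - mterm v 1)"
proof (rule poly_mapping_eqI)
  fix k
  show "coef m k = coef (mterm v 1 + (m - mterm v 1)) k"
    using assms by (auto simp: lookup_add lookup_minus lookup_single when_def in_keys_iff)
qed

text \<open>A term is a product of variables and a constant, by induction on its degree, and a
  polynomial is the sum of its terms. This reduces claims on substitutions to the ring
  generators.\<close>

lemma mpoly_induct [consumes 1, case_names const var add mult]:
  assumes "f \<in> mpolys n"
    and const: "\<And>c. P (mconst c)" and var: "\<And>v. v < n \<Longrightarrow> P (mvar v)"
    and add: "\<And>f g. f \<in> mpolys n \<Longrightarrow> g \<in> mpolys n \<Longrightarrow> P f \<Longrightarrow> P g \<Longrightarrow> P (f + g)"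
    and mult: "\<And>f g. f \<in> mpolys n \<Longrightarrow> g \<in> mpolys n \<Longrightarrow> P f \<Longrightarrow> P g \<Longrightarrow> P (f * g)"
  shows "P f"
proof -
  have term_P: "P (mterm m c)" if "monom_keys m \<subseteq> {..<n}" for m c
    using that
  proof (induction "mdeg m" arbitrary: m)
    case 0
    then have "m = 0" by (auto simp: mdeg_def poly_mapping_eq_iff fun_eq_iff in_keys_iff)
    then show ?case by (simp add: const)
  next
    case (Suc d)
    then have "m \<noteq> 0" by (metis mdeg_0 nat.distinct(1))
    then obtain v where v: "v \<in> monom_keys m" by fastforce
    define m' where "m' = m - mterm v 1"
    have m: "m = mterm v 1 + m'" unfolding m'_def by (rule monom_split[OF v])
    have k: "monom_keys m' \<subseteq> {..<n}" using Suc.prems unfolding m by (simp add: keys_add_nat)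
    have "d = mdeg m'" using Suc.hyps(2) unfolding m mdeg_add by simp
    then have "P (mterm m' c)" using Suc.hyps(1) k by blast
    moreover have "v < n" using v Suc.prems by auto
    ultimately have "P (mvar v * mterm m' c)"
      using mult[OF mpolys_var mpolys_term] var k by blast
    then show ?case by (simp add: m mult_single mvar_def)
  qed
  have "P (\<Sum>m\<in>I. mterm m (coef f m)) \<and> (\<Sum>m\<in>I. mterm m (coef f m)) \<in> mpolys n"
    if "finite I" "I \<subseteq> monom_keys f" for I
    using that
  proof (induction I)
    case empty
    then show ?case using const[of 0] by simp
  next
    case (insert m I)
    then have "monom_keys m \<subseteq> {..<n}" using assms(1) by (auto simp: mpolys_def)
    then have "P (mterm m (coef f m))" "mterm m (coef f m) \<in> mpolys n"
      using term_P mpolys_term by auto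
    moreover have "(\<Sum>m\<in>I. mterm m (coef f m)) \<in> mpolys n" "P (\<Sum>m\<in>I. mterm m (coef f m))"
      using insert by auto
    ultimately show ?case
      unfolding sum.insert[OF insert.hyps] by (intro conjI add mpolys_add)
  qed
  then have "P (\<Sum>m\<in>monom_keys f. mterm m (coef f m))" by simp
  then show ?thesis using sum_terms[of f] by simp
qed

lemma coef_term_mult: "coef (mterm k c * f) (k + m) = c * coef f (m :: nat \<Rightarrow>\<^sub>0 nat)"
  for c :: "'k::field"
proof -
  have "coef (mterm k c * f) (k + m) = (\<Sum>a\<in>monom_keys f. coef (mterm k c * mterm a (coef f a)) (k + m))"
    by (subst (1) sum_terms[of f]) (simp add: sum_distrib_left lookup_sum)
  also have "\<dots> = (\<Sum>a\<in>monom_keys f. if a = m then c * coef f a else 0)"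
    by (rule sum.cong) (auto simp: mult_single lookup_single when_def)
  also have "\<dots> = c * coef f m" by (auto simp: sum.delta in_keys_iff)
  finally show ?thesis .
qed

lemma coef_term_mult_nonzero:
  fixes c :: "'k::field"
  assumes "coef (mterm k c * f) a \<noteq> 0"
  obtains m where "a = k + m" and "coef f m \<noteq> 0"
proof -
  have "a \<in> monom_keys (mterm k c * f)" using assms by (simp add: in_keys_iff)
  then obtain x y where "a = x + y" "x \<in> monom_keys (mterm k c)" "y \<in> monom_keys f"
    using keys_mult by blast
  then show ?thesis using that by (auto split: if_splits simp: in_keys_iff)
qed

subsection \<open>Homogeneous parts\<close>

text \<open>The degree is an integer, so that shifts \<open>j - g b\<close> may become negative
  without a case distinction; the part is then zero.\<close>

definition hpart :: "int \<Rightarrow> 'k::field mpoly \<Rightarrow> 'k mpoly" where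
  "hpart e f = Poly_Mapping.mapp (\<lambda>m c. if int (mdeg m) = e then c else 0) f"

lemma coef_hpart: "coef (hpart e f) m = (if int (mdeg m) = e then coef f m else 0)"
  by (auto simp: hpart_def lookup_mapp when_def in_keys_iff)

lemma hpart_0 [simp]: "hpart e 0 = 0"
  by (rule poly_mapping_eqI) (simp add: coef_hpart)

lemma hpart_diff: "hpart e (f - g) = hpart e f - hpart e g"
  by (rule poly_mapping_eqI) (simp add: coef_hpart lookup_minus)

lemma hpart_add: "hpart e (f + g) = hpart e f + hpart e g"
  by (rule poly_mapping_eqI) (simp add: coef_hpart lookup_add)

lemma hpart_sum: "hpart e (sum f I) = (\<Sum>i\<in>I. hpart e (f i))"
  by (induction I rule: infinite_finite_induct) (auto simp: hpart_add)

lemma hpart_hpart: "hpart e (hpart e' f) = (if e = e' then hpart e f else 0)"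
  by (rule poly_mapping_eqI) (simp add: coef_hpart)

lemma hpart_term_mult: "hpart e (mterm k c * f) = mterm k c * hpart (e - int (mdeg k)) f"
proof -
  have t: "hpart e (mterm m d) = (if int (mdeg m) = e then mterm m d else 0)" for e and m and d :: 'a
    by (rule poly_mapping_eqI) (auto simp: coef_hpart lookup_single when_def)
  have "hpart e (mterm k c * mterm m d) = mterm k c * hpart (e - int (mdeg k)) (mterm m d)" for m d
    by (auto simp: mult_single t mdeg_add)
  then have "hpart e (mterm k c * (\<Sum>m\<in>monom_keys f. mterm m (coef f m)))
      = mterm k c * hpart (e - int (mdeg k)) (\<Sum>m\<in>monom_keys f. mterm m (coef f m))"
    by (simp add: sum_distrib_left hpart_sum)
  then show ?thesis using sum_terms[of f] by simp
qed

lemma hpart_in_mpolys: "f \<in> mpolys n \<Longrightarrow> hpart e f \<in> mpolys n"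
  by (auto simp: mpolys_def in_keys_iff coef_hpart split: if_splits)

text \<open>Being homogeneous becomes being fixed by a projection, which turns degree bookkeeping
  into equational reasoning.\<close>

lemma mpoly_hom_part_iff: "f \<in> mpoly_hom_part n e \<longleftrightarrow> f \<in> mpolys n \<and> hpart e f = f"
proof -
  have "hpart e f = f \<longleftrightarrow> (\<forall>m\<in>monom_keys f. int (mdeg m) = e)"
    by (auto simp: poly_mapping_eq_iff fun_eq_iff coef_hpart in_keys_iff)
  then show ?thesis unfolding mpoly_hom_part_def carrier_mpoly_ring mdeg_def by auto
qed

subsection \<open>Substitution\<close>

definition monom_value :: "(nat \<Rightarrow> 'k::field mpoly) \<Rightarrow> (nat \<Rightarrow>\<^sub>0 nat) \<Rightarrow> 'k mpoly" where
  "monom_value \<sigma> m = (\<Prod>v\<in>monom_keys m. \<sigma> v ^ coef m v)"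

definition subst :: "(nat \<Rightarrow> 'k::field mpoly) \<Rightarrow> 'k mpoly \<Rightarrow> 'k mpoly" where
  "subst \<sigma> f = (\<Sum>m\<in>monom_keys f. mconst (coef f m) * monom_value \<sigma> m)"

lemma monom_value_add: "monom_value \<sigma> (m + m') = monom_value \<sigma> m * monom_value \<sigma> m'"
proof -
  have sup: "monom_value \<sigma> m = (\<Prod>v\<in>I. \<sigma> v ^ coef m v)" if "finite I" "monom_keys m \<subseteq> I" for m I
    unfolding monom_value_def using that by (intro prod.mono_neutral_left) (auto simp: in_keys_iff)
  let ?I = "monom_keys m \<union> monom_keys m'"
  show ?thesis
    using sup[of ?I "m + m'"] sup[of ?I m] sup[of ?I m']
    by (simp add: keys_add_nat lookup_add power_add prod.distrib)
qed

lemma subst_superset: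
  "finite I \<Longrightarrow> monom_keys f \<subseteq> I \<Longrightarrow> subst \<sigma> f = (\<Sum>m\<in>I. mconst (coef f m) * monom_value \<sigma> m)"
  unfolding subst_def by (intro sum.mono_neutral_left) (auto simp: in_keys_iff)

lemma subst_add: "subst \<sigma> (f + g) = subst \<sigma> f + subst \<sigma> g"
proof -
  let ?I = "monom_keys f \<union> monom_keys g"
  show ?thesis
    using subst_superset[of ?I "f + g" \<sigma>] subst_superset[of ?I f \<sigma>] subst_superset[of ?I g \<sigma>] keys_add[of f g]
    by (simp add: lookup_add single_add distrib_right sum.distrib)
qed

lemma subst_term: "subst \<sigma> (mterm m c) = mconst c * monom_value \<sigma> m"
  by (simp add: subst_def)

lemma subst_0 [simp]: "subst \<sigma> 0 = 0"
  by (simp add: subst_def)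

lemma subst_sum: "subst \<sigma> (sum f I) = (\<Sum>i\<in>I. subst \<sigma> (f i))"
  by (induction I rule: infinite_finite_induct) (auto simp: subst_add)

lemma subst_mult: "subst \<sigma> (f * g) = subst \<sigma> f * subst \<sigma> g"
proof -
  have t: "subst \<sigma> (mterm a c * mterm b d) = subst \<sigma> (mterm a c) * subst \<sigma> (mterm b d)" for a b c d
  proof -
    have "subst \<sigma> (mterm a c * mterm b d) = mconst (c * d) * (monom_value \<sigma> a * monom_value \<sigma> b)"
      by (simp add: mult_single subst_term monom_value_add)
    also have "\<dots> = mconst c * mconst d * (monom_value \<sigma> a * monom_value \<sigma> b)"
      by (simp only: mconst_mult)
    finally show ?thesis by (simp only: subst_term ac_simps)
  qed
  let ?s = "\<lambda>f. \<Sum>m\<in>monom_keys f. mterm m (coef f m)"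
  have "subst \<sigma> (?s f * ?s g) = subst \<sigma> (?s f) * subst \<sigma> (?s g)"
    by (simp add: sum_product subst_sum t)
  then show ?thesis using sum_terms[of f] sum_terms[of g] by simp
qed

lemma subst_const [simp]: "subst \<sigma> (mconst c) = mconst c"
  by (simp add: subst_term monom_value_def)

lemma subst_var [simp]: "subst \<sigma> (mvar v) = \<sigma> v"
  by (simp add: mvar_def subst_term monom_value_def)

lemma subst_in_mpolys:
  assumes "f \<in> mpolys n" and "\<And>v. v < n \<Longrightarrow> \<sigma> v \<in> mpolys n"
  shows "subst \<sigma> f \<in> mpolys n"
  using assms(1)
  by (induction rule: mpoly_induct) (auto simp: subst_add subst_mult intro: assms(2) mpolys_add mpolys_mult)

text \<open>A polynomial agrees with its substitution modulo the differences of variables and their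
  values. Products telescope as \<open>f * g - f' * g' = (f - f') * g' + f * (g - g')\<close>.
  Special substitutions then yield generators of the kernel of an evaluation.\<close>

lemma subst_congruent:
  assumes "f \<in> mpolys n" and \<sigma>: "\<And>v. v < n \<Longrightarrow> \<sigma> v \<in> mpolys n"
  shows "\<exists>c. (\<forall>v. c v \<in> mpolys n) \<and> f - subst \<sigma> f = (\<Sum>v<n. (mvar v - \<sigma> v) * c v)"
  using assms(1)
proof (induction rule: mpoly_induct)
  case (const c)
  show ?case by (intro exI[of _ "\<lambda>_. 0"]) simp
next
  case (var v)
  have "(\<Sum>w<n. (mvar w - \<sigma> w) * (if w = v then 1 else 0)) = mvar v - \<sigma> v"
    using var by (simp add: if_distrib cong: if_cong)
  then show ?case by (intro exI[of _ "\<lambda>w. if w = v then 1 else 0"]) simp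
next
  case (add f g)
  then obtain c d where c: "\<forall>v. c v \<in> mpolys n" "f - subst \<sigma> f = (\<Sum>v<n. (mvar v - \<sigma> v) * c v)"
    and d: "\<forall>v. d v \<in> mpolys n" "g - subst \<sigma> g = (\<Sum>v<n. (mvar v - \<sigma> v) * d v)" by blast
  have "f + g - subst \<sigma> (f + g) = (f - subst \<sigma> f) + (g - subst \<sigma> g)"
    by (simp add: subst_add)
  also have "\<dots> = (\<Sum>v<n. (mvar v - \<sigma> v) * (c v + d v))"
    unfolding c d by (simp add: distrib_left sum.distrib)
  finally show ?case using c d by (intro exI[of _ "\<lambda>v. c v + d v"]) (auto intro: mpolys_add)
next
  case (mult f g)
  then obtain c d where c: "\<forall>v. c v \<in> mpolys n" "f - subst \<sigma> f = (\<Sum>v<n. (mvar v - \<sigma> v) * c v)"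
    and d: "\<forall>v. d v \<in> mpolys n" "g - subst \<sigma> g = (\<Sum>v<n. (mvar v - \<sigma> v) * d v)" by blast
  have "f * g - subst \<sigma> (f * g) = (f - subst \<sigma> f) * subst \<sigma> g + f * (g - subst \<sigma> g)"
    by (simp add: subst_mult algebra_simps)
  also have "\<dots> = (\<Sum>v<n. (mvar v - \<sigma> v) * (c v * subst \<sigma> g + f * d v))"
    unfolding c d by (simp add: sum_distrib_left sum_distrib_right distrib_left sum.distrib ac_simps)
  finally show ?case
    using c d mult(1,2) subst_in_mpolys[OF mult(2) \<sigma>]
    by (intro exI[of _ "\<lambda>v. c v * subst \<sigma> g + f * d v"]) (auto intro!: mpolys_add mpolys_mult)
qed

lemma subst_zero: "subst (\<lambda>_. 0) f = mconst (coef f 0)"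
proof -
  have "monom_value (\<lambda>_. 0) m = (if m = 0 then 1 else (0 :: 'a mpoly))" for m
  proof (cases "m = 0")
    case False
    then obtain v where "v \<in> monom_keys m" by fastforce
    then show ?thesis using False
      unfolding monom_value_def by (auto intro!: prod_zero bexI[of _ v] simp: in_keys_iff)
  qed (simp add: monom_value_def)
  then have "subst (\<lambda>_. 0) f = (\<Sum>m\<in>monom_keys f. if m = 0 then mconst (coef f m) else 0)"
    unfolding subst_def by (intro sum.cong) auto
  then show ?thesis by (auto simp: sum.delta in_keys_iff)
qed

lemma coef_0_mult: "coef (f * g) 0 = coef f 0 * coef g (0 :: nat \<Rightarrow>\<^sub>0 nat)" for f :: "'k::field mpoly"
proof -
  have "mconst (coef (f * g) 0) = mconst (coef f 0 * coef g 0)"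
    using subst_mult[of "\<lambda>_. 0" f g] by (simp add: subst_zero mconst_mult)
  then show ?thesis by (metis lookup_single_eq)
qed

lemma coef_mvar_0: "coef (mvar v) 0 = 0"
proof -
  have "mterm v (1::nat) \<noteq> 0" by (metis lookup_single_eq lookup_zero zero_neq_one)
  then show ?thesis by (simp add: mvar_def lookup_single when_def del: One_nat_def)
qed

lemma const_free_decomp:
  assumes "f \<in> mpolys n" and "coef f 0 = 0"
  shows "\<exists>c. (\<forall>v. c v \<in> mpolys n) \<and> f = (\<Sum>v<n. mvar v * c v)"
  using subst_congruent[OF assms(1), of "\<lambda>_. 0"] assms(2) by (simp add: subst_zero)

subsection \<open>Linear forms in echelon shape\<close>

text \<open>These forms arise from \<open>\<Sum>v<n. mvar v * contr v z\<close> when each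
  contraction with \<open>b\<close> outside \<open>A\<close> is replaced by the combination of the
  \<open>contr a z\<close>, \<open>a\<close> in \<open>A\<close>, with coefficients
  \<open>l b a\<close>. Their leading variables are distinct, and for \<open>A = {..<n}\<close> they
  are the variables themselves.\<close>

definition echelon_form :: "nat \<Rightarrow> nat set \<Rightarrow> (nat \<Rightarrow> nat \<Rightarrow> 'k::field) \<Rightarrow> nat \<Rightarrow> 'k mpoly" where
  "echelon_form n A l a = mvar a + (\<Sum>b\<in>{..<n} - A. mconst (l b a) * mvar b)"

lemma echelon_form_full: "echelon_form n {..<n} l a = mvar a"
  by (simp add: echelon_form_def)

lemma echelon_form_in_mpolys: "a < n \<Longrightarrow> echelon_form n A l a \<in> mpolys n"
  unfolding echelon_form_def by (intro mpolys_add mpolys_var mpolys_sum mpolys_mult mpolys_const) auto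

lemma hpart_echelon_form_mult: "hpart e (echelon_form n A l a * f) = echelon_form n A l a * hpart (e - 1) f"
  by (simp add: echelon_form_def distrib_right hpart_add hpart_sum sum_distrib_right mult.assoc
      hpart_term_mult mvar_def)

lemma echelon_form_nonzero:
  fixes l :: "nat \<Rightarrow> nat \<Rightarrow> 'k::field"
  assumes "a \<in> A"
  shows "echelon_form n A l a \<noteq> 0"
proof -
  have "coef (mconst c * mvar b) (mterm a 1) = 0" if "b \<in> {..<n} - A" for b and c :: 'k
  proof -
    have "mterm b (1::nat) \<noteq> mterm a 1" using that assms by (metis DiffD2 keys_single singleton_inject zero_neq_one)
    then show ?thesis by (simp add: mvar_def mult_single lookup_single when_def)
  qed
  then have "coef (echelon_form n A l a) (mterm a 1) = 1"
    by (simp add: echelon_form_def lookup_add lookup_sum mvar_def[of a])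
  then show ?thesis by (metis lookup_zero zero_neq_one)
qed

text \<open>The substitution \<open>\<sigma>\<close> solves the forms with index below
  \<open>a\<close> for their leading variables. It kills those forms and fixes the form of
  \<open>a\<close>, so it kills \<open>f\<close>; then \<open>subst_congruent\<close> writes
  \<open>f\<close> through the differences \<open>mvar v - \<sigma> v\<close>, which are exactly the
  earlier forms.\<close>

lemma echelon_form_regular:
  assumes "A \<subseteq> {..<n}" and "a \<in> A" and f: "f \<in> mpolys n"
    and eq: "echelon_form n A l a * f = (\<Sum>b\<in>A \<inter> {..<a}. echelon_form n A l b * c b)"
  shows "\<exists>c'. (\<forall>b. c' b \<in> mpolys n) \<and> f = (\<Sum>b\<in>A \<inter> {..<a}. echelon_form n A l b * c' b)"
proof -
  let ?Y = "echelon_form n A l"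
  define \<sigma> where "\<sigma> v = (if v \<in> A \<inter> {..<a} then - (\<Sum>b\<in>{..<n} - A. mconst (l b v) * mvar b) else mvar v)" for v
  have sig: "\<sigma> v \<in> mpolys n" if "v < n" for v
    using that unfolding \<sigma>_def
    by (auto intro!: mpolys_uminus mpolys_sum mpolys_mult mpolys_var)
  have out: "subst \<sigma> (\<Sum>b\<in>{..<n} - A. mconst (l b v) * mvar b) = (\<Sum>b\<in>{..<n} - A. mconst (l b v) * mvar b)" for v
    unfolding subst_sum by (rule sum.cong) (auto simp: subst_mult \<sigma>_def)
  have Y0: "subst \<sigma> (?Y v) = 0" if "v \<in> A \<inter> {..<a}" for v
    using that by (simp add: echelon_form_def subst_add out) (simp add: \<sigma>_def)
  have Ya: "subst \<sigma> (?Y a) = ?Y a"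
    by (simp add: echelon_form_def subst_add out) (simp add: \<sigma>_def)
  have "?Y a * subst \<sigma> f = subst \<sigma> (?Y a * f)" by (simp add: subst_mult Ya)
  also have "\<dots> = 0" unfolding eq subst_sum by (rule sum.neutral) (simp add: subst_mult Y0)
  finally have "subst \<sigma> f = 0" using echelon_form_nonzero[OF assms(2), of n l] by simp
  then obtain c' where c': "\<forall>v. c' v \<in> mpolys n" "f = (\<Sum>v<n. (mvar v - \<sigma> v) * c' v)"
    using subst_congruent[OF f, of \<sigma>] sig by auto
  have "(\<Sum>v<n. (mvar v - \<sigma> v) * c' v) = (\<Sum>v\<in>A \<inter> {..<a}. ?Y v * c' v)"
    by (rule sum.mono_neutral_cong_right) (use assms(1) in \<open>auto simp: \<sigma>_def echelon_form_def\<close>)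
  then show ?thesis using c' by blast
qed

section \<open>Free modules and complexes\<close>

definition pscale :: "'k::field mpoly \<Rightarrow> ('i \<Rightarrow> 'k mpoly) \<Rightarrow> 'i \<Rightarrow> 'k mpoly" where
  "pscale f v = (\<lambda>b. f * v b)"

lemma sum_fun_apply: "(\<Sum>i\<in>I. f i) b = (\<Sum>i\<in>I. f i b)" for f :: "'i \<Rightarrow> 'j \<Rightarrow> 'a::comm_monoid_add"
  by (induction I rule: infinite_finite_induct) auto

lemma pscale_apply [simp]: "pscale f v b = f * v b"
  by (simp add: pscale_def)

interpretation pk: commuting_endomorphisms "\<lambda>v. pscale (Y v)" for Y :: "nat \<Rightarrow> 'k::field mpoly"
  by unfold_locales (auto simp: pscale_def fun_eq_iff right_diff_distrib mult.left_commute)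

text \<open>The carrier of the free module on plain functions, where the pointwise operations of the
  type classes take the place of record operations.\<close>

definition fpolys :: "nat \<Rightarrow> 'i set \<Rightarrow> ('i \<Rightarrow> 'k::field mpoly) set" where
  "fpolys n B = {v. (\<forall>b. v b \<in> mpolys n) \<and> (\<forall>b. b \<notin> B \<longrightarrow> v b = 0) \<and> finite {b. v b \<noteq> 0}}"

definition prj :: "(nat \<Rightarrow> int) \<Rightarrow> int \<Rightarrow> (nat \<Rightarrow> 'k::field mpoly) \<Rightarrow> nat \<Rightarrow> 'k mpoly" where
  "prj g j v = (\<lambda>b. hpart (j - g b) (v b))"

definition fgr :: "nat \<Rightarrow> nat set \<Rightarrow> (nat \<Rightarrow> int) \<Rightarrow> int \<Rightarrow> (nat \<Rightarrow> 'k::field mpoly) set" where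
  "fgr n B g j = {v \<in> fpolys n B. prj g j v = v}"

lemma graded_free_simps:
  "carrier (graded_free n B g) = fpolys n B"
  "hom_part (graded_free n B g) j = fgr n B g j"
  "\<zero>\<^bsub>graded_free n B g\<^esub> = 0"
  "u \<oplus>\<^bsub>graded_free n B g\<^esub> v = u + v"
  "f \<odot>\<^bsub>graded_free n B g\<^esub> v = pscale f v"
proof -
  show c: "carrier (graded_free n B g) = fpolys n B"
    by (simp add: graded_free_def with_grading_def module.extend_def graded_module.fields_def
        free_module_def fpolys_def carrier_mpoly_ring mpoly_ring_simps Let_def)
  have "hom_part (graded_free n B g) j = {v \<in> fpolys n B. \<forall>b\<in>B. v b \<in> mpoly_hom_part n (j - g b)}"
    by (simp add: graded_free_def with_grading_def module.extend_def graded_module.fields_def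
        free_module_def fpolys_def carrier_mpoly_ring mpoly_ring_simps Let_def)
  also have "\<dots> = fgr n B g j"
    unfolding fgr_def prj_def mpoly_hom_part_iff fpolys_def fun_eq_iff by auto
  finally show "hom_part (graded_free n B g) j = fgr n B g j" .
  show "\<zero>\<^bsub>graded_free n B g\<^esub> = 0" "u \<oplus>\<^bsub>graded_free n B g\<^esub> v = u + v" "f \<odot>\<^bsub>graded_free n B g\<^esub> v = pscale f v"
    by (simp_all add: graded_free_def with_grading_def module.extend_def graded_module.fields_def
        free_module_def carrier_mpoly_ring mpoly_ring_simps Let_def pscale_def fun_eq_iff)
qed

lemma fpolys_0 [simp]: "0 \<in> fpolys n B"
  by (simp add: fpolys_def)

lemma fpolys_diff: "u \<in> fpolys n B \<Longrightarrow> v \<in> fpolys n B \<Longrightarrow> u - v \<in> fpolys n B"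
  unfolding fpolys_def
  by (auto intro: mpolys_diff rev_finite_subset[OF finite_UnI[of "{b. u b \<noteq> 0}" "{b. v b \<noteq> 0}"]])

lemma fpolys_uminus: "v \<in> fpolys n B \<Longrightarrow> - v \<in> fpolys n B"
  using fpolys_diff[OF fpolys_0] by fastforce

lemma fpolys_add: "u \<in> fpolys n B \<Longrightarrow> v \<in> fpolys n B \<Longrightarrow> u + v \<in> fpolys n B"
  using fpolys_diff[of u n B "- v"] fpolys_uminus[of v n B] by simp

lemma fpolys_sum: "(\<And>i. i \<in> I \<Longrightarrow> f i \<in> fpolys n B) \<Longrightarrow> (\<Sum>i\<in>I. f i) \<in> fpolys n B"
  by (induction I rule: infinite_finite_induct) (auto intro: fpolys_add)

lemma fpolys_pscale: "f \<in> mpolys n \<Longrightarrow> v \<in> fpolys n B \<Longrightarrow> pscale f v \<in> fpolys n B"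
  unfolding fpolys_def by (auto intro: mpolys_mult elim: rev_finite_subset)

lemma prj_diff: "prj g j (u - v) = prj g j u - prj g j v"
  by (rule ext) (simp add: prj_def hpart_diff)

lemma prj_0 [simp]: "prj g j 0 = 0"
  by (rule ext) (simp add: prj_def)

lemma prj_add: "prj g j (u + v) = prj g j u + prj g j v"
  by (rule ext) (simp add: prj_def hpart_add)

lemma prj_minus: "prj g j (- v) = - prj g j v"
  using prj_diff[of g j 0 v] by simp

lemma prj_sum: "prj g j (\<Sum>i\<in>I. f i) = (\<Sum>i\<in>I. prj g j (f i))"
  by (induction I rule: infinite_finite_induct) (simp_all only: sum.infinite sum.empty prj_0 sum.insert prj_add not_False_eq_True)

lemma prj_prj: "prj g j (prj g j' v) = (if j = j' then prj g j v else 0)"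
  by (rule ext) (simp add: prj_def hpart_hpart)

lemma prj_in_fpolys: "v \<in> fpolys n B \<Longrightarrow> prj g j v \<in> fpolys n B"
  unfolding fpolys_def prj_def
  by (auto intro: hpart_in_mpolys elim!: rev_finite_subset)

lemma prj_in_fgr: "v \<in> fpolys n B \<Longrightarrow> prj g j v \<in> fgr n B g j"
  by (simp add: fgr_def prj_in_fpolys prj_prj)

lemma prj_term: "prj g j (pscale (mterm k c) v) = pscale (mterm k c) (prj g (j - int (mdeg k)) v)"
  by (rule ext) (simp add: prj_def hpart_term_mult diff_diff_eq add.commute)

lemma prj_const: "prj g j (pscale (mconst c) v) = pscale (mconst c) (prj g j v)"
  by (simp add: prj_term)

lemma prj_echelon: "prj g j (pscale (echelon_form n A l a) v) = pscale (echelon_form n A l a) (prj g (j - 1) v)"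
  by (rule ext) (simp add: prj_def hpart_echelon_form_mult diff_diff_eq add.commute)

lemma fgr_subset: "fgr n B g j \<subseteq> fpolys n B"
  by (auto simp: fgr_def)

lemma fgr_0 [simp]: "0 \<in> fgr n B g j"
  by (simp add: fgr_def)

lemma fgr_diff: "u \<in> fgr n B g j \<Longrightarrow> v \<in> fgr n B g j \<Longrightarrow> u - v \<in> fgr n B g j"
  by (simp add: fgr_def prj_diff fpolys_diff)

lemma fgr_uminus: "v \<in> fgr n B g j \<Longrightarrow> - v \<in> fgr n B g j"
  by (simp add: fgr_def prj_minus fpolys_uminus)

lemma fgr_add: "u \<in> fgr n B g j \<Longrightarrow> v \<in> fgr n B g j \<Longrightarrow> u + v \<in> fgr n B g j"
  by (simp add: fgr_def prj_add fpolys_add)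

lemma fgr_const: "v \<in> fgr n B g j \<Longrightarrow> pscale (mconst c) v \<in> fgr n B g j"
  by (simp add: fgr_def prj_const fpolys_pscale)

lemma fgr_echelon: "v \<in> fgr n B g j \<Longrightarrow> a < n \<Longrightarrow> pscale (echelon_form n A l a) v \<in> fgr n B g (j + 1)"
  by (simp add: fgr_def prj_echelon fpolys_pscale echelon_form_in_mpolys)

text \<open>\<open>J\<close> collects the shifted degrees of all monomials that occur; finite
  support makes it finite even if \<open>B\<close> is infinite.\<close>

lemma sum_prj:
  assumes "v \<in> fpolys n B"
  obtains J where "finite J" and "v = (\<Sum>j\<in>J. prj g j v)" and "\<And>j. j \<notin> J \<Longrightarrow> prj g j v = 0"
proof -
  define J where "J = (\<Union>b\<in>{b. v b \<noteq> 0}. (\<lambda>m. int (mdeg m) + g b) ` monom_keys (v b))"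
  have fin: "finite J" using assms by (auto simp: J_def fpolys_def)
  have J: "int (mdeg m) + g b \<in> J" if "coef (v b) m \<noteq> 0" for b m
    unfolding J_def using that by (auto simp: in_keys_iff intro!: exI[of _ b] imageI)
  have "v b = (\<Sum>j\<in>J. prj g j v b)" for b
  proof (rule poly_mapping_eqI)
    fix m
    have "coef (\<Sum>j\<in>J. prj g j v b) m = (\<Sum>j\<in>J. if j = int (mdeg m) + g b then coef (v b) m else 0)"
      unfolding lookup_sum by (rule sum.cong) (auto simp: prj_def coef_hpart)
    also have "\<dots> = coef (v b) m" using J fin by (auto simp: sum.delta)
    finally show "coef (v b) m = coef (\<Sum>j\<in>J. prj g j v b) m" ..
  qed
  then have 1: "v = (\<Sum>j\<in>J. prj g j v)" by (auto simp: fun_eq_iff sum_fun_apply)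
  have "prj g j v = 0" if "j \<notin> J" for j
  proof (rule ext)
    fix b
    show "prj g j v b = 0 b"
    proof (rule poly_mapping_eqI)
      fix k
      have "coef (v b) k = 0" if "int (mdeg k) = j - g b"
        using J[of b k] \<open>j \<notin> J\<close> that by auto
      then show "coef (prj g j v b) k = coef (0 b) k" by (simp add: prj_def coef_hpart)
    qed
  qed
  then show ?thesis using that fin 1 by blast
qed

text \<open>Regularity is checked coordinatewise. The coefficients are taken to be zero wherever
  \<open>f\<close> is, as otherwise the collected families might have infinite support.\<close>

lemma regular_on_fpolys:
  assumes "A \<subseteq> {..<n}"
  shows "pk.regular_on (echelon_form n A l) (fpolys n B) A"
  unfolding pk.regular_on_def
proof (intro ballI impI)
  fix a f c
  assume a: "a \<in> A" and f: "f \<in> fpolys n B" and "c \<in> UNIV \<rightarrow> fpolys n B"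
    and eq: "pscale (echelon_form n A l a) f = (\<Sum>b\<in>A \<inter> {..<a}. pscale (echelon_form n A l b) (c b))"
  have "\<exists>c'. (\<forall>b. c' b \<in> mpolys n) \<and> f i = (\<Sum>b\<in>A \<inter> {..<a}. echelon_form n A l b * c' b)
      \<and> (f i = 0 \<longrightarrow> (\<forall>b. c' b = 0))" for i
  proof (cases "f i = 0")
    case True
    then show ?thesis by (intro exI[of _ "\<lambda>_. 0"]) simp
  next
    case False
    have "echelon_form n A l a * f i = (\<Sum>b\<in>A \<inter> {..<a}. echelon_form n A l b * c b i)"
      using fun_cong[OF eq, of i] by (simp add: sum_fun_apply)
    moreover have "f i \<in> mpolys n" using f by (simp add: fpolys_def)
    ultimately show ?thesis using echelon_form_regular[OF assms a, of "f i" l "\<lambda>b. c b i"] False by blast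
  qed
  then obtain c' where c': "\<And>i b. c' i b \<in> mpolys n"
    "\<And>i. f i = (\<Sum>b\<in>A \<inter> {..<a}. echelon_form n A l b * c' i b)"
    "\<And>i b. f i = 0 \<Longrightarrow> c' i b = 0" by metis
  have "(\<lambda>i. c' i b) \<in> fpolys n B" for b
  proof -
    have "{i. c' i b \<noteq> 0} \<subseteq> {i. f i \<noteq> 0}" using c'(3) by auto
    then show ?thesis using f c' by (auto simp: fpolys_def finite_subset)
  qed
  then show "\<exists>c'\<in>UNIV \<rightarrow> fpolys n B. f = (\<Sum>b\<in>A \<inter> {..<a}. pscale (echelon_form n A l b) (c' b))"
    using c'(2) by (intro bexI[of _ "\<lambda>b i. c' i b"]) (auto simp: fun_eq_iff sum_fun_apply)
qed

lemma prj_kos: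
  "(\<lambda>Q. prj g j (pk.kos (echelon_form n A l) A u Q)) = pk.kos (echelon_form n A l) A (\<lambda>Q. prj g (j - 1) (u Q))"
  unfolding pk.kos_def prj_sum prj_echelon contr_map[of "prj g (j - 1)", OF prj_0 prj_minus] ..

text \<open>Any preimage of a homogeneous cycle may be replaced by its component of degree
  \<open>j - 1\<close>, because the differential is homogeneous of degree one.\<close>

lemma kos_exact_graded:
  assumes "A \<subseteq> {..<n}" and "supp_fam A (Suc m) u" and u: "\<And>Q. u Q \<in> fgr n B g j"
    and "pk.kos (echelon_form n A l) A u = 0"
  shows "\<exists>t. supp_fam A (Suc (Suc m)) t \<and> (\<forall>Q. t Q \<in> fgr n B g (j - 1)) \<and> pk.kos (echelon_form n A l) A t = u"
proof -
  have "\<exists>t. supp_fam A (Suc (Suc m)) t \<and> range t \<subseteq> fpolys n B \<and> pk.kos (echelon_form n A l) A t = u"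
  proof (rule pk.kos_exact[OF _ regular_on_fpolys])
    show "finite A" using assms(1) finite_subset by blast
    show "range u \<subseteq> fpolys n B" using u fgr_subset by blast
    show "pscale (echelon_form n A l a) x \<in> fpolys n B" if "a \<in> A" "x \<in> fpolys n B" for a x
      using that assms(1) by (auto intro!: fpolys_pscale echelon_form_in_mpolys)
  qed (use assms in \<open>auto intro: fpolys_diff\<close>)
  then obtain t where t: "supp_fam A (Suc (Suc m)) t" "range t \<subseteq> fpolys n B" "pk.kos (echelon_form n A l) A t = u"
    by blast
  have "pk.kos (echelon_form n A l) A (\<lambda>Q. prj g (j - 1) (t Q)) = (\<lambda>Q. prj g j (u Q))"
    unfolding prj_kos[symmetric] t(3) ..
  also have "\<dots> = u" using u by (auto simp: fgr_def)
  finally have "pk.kos (echelon_form n A l) A (\<lambda>Q. prj g (j - 1) (t Q)) = u" .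
  moreover have "supp_fam A (Suc (Suc m)) (\<lambda>Q. prj g (j - 1) (t Q))"
    using supp_fam_map[OF t(1), of "prj g (j - 1)"] by simp
  moreover have "prj g (j - 1) (t Q) \<in> fgr n B g (j - 1)" for Q
    using t(2) by (intro prj_in_fgr) auto
  ultimately show ?thesis by blast
qed

lemma const_free_decomp_fpolys:
  assumes "v \<in> fpolys n B" and "\<And>b. coef (v b) 0 = 0"
  shows "\<exists>c. (\<forall>x. c x \<in> fpolys n B) \<and> v = (\<Sum>x<n. pscale (mvar x) (c x))"
proof -
  have "\<exists>c. (\<forall>x. c x \<in> mpolys n) \<and> v b = (\<Sum>x<n. mvar x * c x) \<and> (v b = 0 \<longrightarrow> (\<forall>x. c x = 0))" for b
  proof (cases "v b = 0")
    case True
    then show ?thesis by (intro exI[of _ "\<lambda>_. 0"]) simp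
  next
    case False
    then show ?thesis using const_free_decomp[of "v b" n] assms by (auto simp: fpolys_def)
  qed
  then obtain c where c: "\<And>b x. c b x \<in> mpolys n" "\<And>b. v b = (\<Sum>x<n. mvar x * c b x)"
    "\<And>b x. v b = 0 \<Longrightarrow> c b x = 0" by metis
  have "(\<lambda>b. c b x) \<in> fpolys n B" for x
  proof -
    have "{b. c b x \<noteq> 0} \<subseteq> {b. v b \<noteq> 0}" using c(3) by auto
    then show ?thesis using assms(1) c by (auto simp: fpolys_def finite_subset)
  qed
  then show ?thesis
    using c(2) by (intro exI[of _ "\<lambda>x b. c b x"]) (auto simp: fun_eq_iff sum_fun_apply)
qed

definition at_empty :: "'g::ab_group_add \<Rightarrow> nat set \<Rightarrow> 'g" where
  "at_empty w = (\<lambda>Q. if Q = {} then w else 0)"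

lemma at_empty_empty [simp]: "at_empty w {} = w"
  by (simp add: at_empty_def)

lemma supp_fam_at_empty: "supp_fam A 0 (at_empty w)"
  by (auto simp: supp_fam_def at_empty_def)

lemma supp_fam_0_eq: "supp_fam A 0 u \<Longrightarrow> u = at_empty (u {})"
  unfolding supp_fam_def at_empty_def by (rule ext) (metis card_0_eq)

text \<open>The cokernel of the Koszul differential in exterior degree \<open>0\<close> is reduction
  modulo the variables, that is, the tensor product with \<open>K\<close>. This ties the
  \<open>m = 0\<close> edge of the double complex to \<open>Tor\<close>.\<close>

lemma const_free_iff_kos:
  assumes "v \<in> fgr n B g j"
  shows "(\<exists>u. supp_fam {..<n} 1 u \<and> (\<forall>Q. u Q \<in> fgr n B g (j - 1)) \<and>
      pk.kos (echelon_form n {..<n} l) {..<n} u = at_empty v) \<longleftrightarrow> (\<forall>b. coef (v b) 0 = 0)"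
proof
  assume "\<exists>u. supp_fam {..<n} 1 u \<and> (\<forall>Q. u Q \<in> fgr n B g (j - 1)) \<and>
      pk.kos (echelon_form n {..<n} l) {..<n} u = at_empty v"
  then obtain u where "pk.kos (echelon_form n {..<n} l) {..<n} u = at_empty v" by blast
  then have "pk.kos (echelon_form n {..<n} l) {..<n} u {} = v" by simp
  then have "v = (\<Sum>x<n. pscale (mvar x) (contr x u {}))"
    unfolding pk.kos_def echelon_form_full by simp
  then have v: "v b = (\<Sum>x<n. mvar x * contr x u {} b)" for b by (simp add: sum_fun_apply)
  then show "\<forall>b. coef (v b) 0 = 0" by (simp add: lookup_sum coef_0_mult coef_mvar_0)
next
  assume "\<forall>b. coef (v b) 0 = 0"
  then obtain c where c: "\<And>x. c x \<in> fpolys n B" "v = (\<Sum>x<n. pscale (mvar x) (c x))"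
    using const_free_decomp_fpolys[of v n B] assms by (auto simp: fgr_def)
  define u where "u = (\<lambda>Q. if Q \<subseteq> {..<n} \<and> card Q = 1 then prj g (j - 1) (c (the_elem Q)) else 0)"
  have su: "supp_fam {..<n} 1 u" by (auto simp: supp_fam_def u_def dest: finite_subset)
  have "v = prj g j v" using assms by (simp add: fgr_def)
  also have "\<dots> = (\<Sum>x<n. pscale (mvar x) (prj g (j - 1) (c x)))"
    unfolding c(2) prj_sum using prj_echelon[of g j n "{..<n}" l] by (simp add: echelon_form_full)
  also have "\<dots> = pk.kos (echelon_form n {..<n} l) {..<n} u {}"
    unfolding pk.kos_def echelon_form_full
    by (rule sum.cong) (auto simp: contr_def signed_def u_def)
  finally have v: "v = pk.kos (echelon_form n {..<n} l) {..<n} u {}" .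
  have "supp_fam {..<n} 0 (pk.kos (echelon_form n {..<n} l) {..<n} u)"
    using pk.supp_fam_kos su by simp
  then have "pk.kos (echelon_form n {..<n} l) {..<n} u = at_empty v"
    unfolding v by (rule supp_fam_0_eq)
  moreover have "u Q \<in> fgr n B g (j - 1)" for Q using c(1) by (auto simp: u_def intro: prj_in_fgr)
  ultimately show "\<exists>u. supp_fam {..<n} 1 u \<and> (\<forall>Q. u Q \<in> fgr n B g (j - 1)) \<and>
      pk.kos (echelon_form n {..<n} l) {..<n} u = at_empty v" using su by blast
qed

text \<open>Here \<open>f\<close> is linear only on \<open>fpolys n C\<close>, so
  \<open>kos_map\<close>, which asks for linearity everywhere, does not apply and membership is
  tracked through the sum.\<close>

lemma kos_linear:
  fixes f :: "(nat \<Rightarrow> 'k::field mpoly) \<Rightarrow> nat \<Rightarrow> 'k mpoly"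
  assumes A: "A \<subseteq> {..<n}" and u: "\<And>Q. u Q \<in> fpolys n C"
    and add: "\<And>x y. x \<in> fpolys n C \<Longrightarrow> y \<in> fpolys n C \<Longrightarrow> f (x + y) = f x + f y"
    and scale: "\<And>r x. r \<in> mpolys n \<Longrightarrow> x \<in> fpolys n C \<Longrightarrow> f (pscale r x) = pscale r (f x)"
  shows "pk.kos (echelon_form n A c) A (\<lambda>Q. f (u Q)) = (\<lambda>Q. f (pk.kos (echelon_form n A c) A u Q))"
proof (rule ext)
  fix Q
  let ?Y = "echelon_form n A c"
  have f0: "f 0 = 0" using add[OF fpolys_0 fpolys_0] by simp
  have minus: "f (- x) = - f x" if "x \<in> fpolys n C" for x
    using add[OF fpolys_uminus[OF that] that] f0 by (simp add: eq_neg_iff_add_eq_0)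
  have cu: "contr v u Q \<in> fpolys n C" for v
    using u fpolys_uminus[OF u] by (simp add: contr_def signed_def)
  have cf: "contr v (\<lambda>Q. f (u Q)) Q = f (contr v u Q)" for v
    by (simp add: contr_def signed_def minus[OF u] f0)
  have Y: "?Y v \<in> mpolys n" if "v \<in> A" for v
    using that A by (intro echelon_form_in_mpolys) auto
  have "f (\<Sum>v\<in>J. pscale (?Y v) (contr v u Q)) = (\<Sum>v\<in>J. pscale (?Y v) (f (contr v u Q)))" if "J \<subseteq> A" for J
    using that
  proof (induction J rule: infinite_finite_induct)
    case (insert v J)
    have v: "pscale (?Y v) (contr v u Q) \<in> fpolys n C" using insert.prems by (intro fpolys_pscale Y cu) auto
    have J: "(\<Sum>v\<in>J. pscale (?Y v) (contr v u Q)) \<in> fpolys n C"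
      using insert.prems by (intro fpolys_sum fpolys_pscale Y cu) auto
    show ?case
      unfolding sum.insert[OF insert.hyps(1,2)] add[OF v J]
      using insert.IH insert.prems scale[OF Y cu, of v v] by (simp only: insert_subset)
  qed (simp_all only: sum.infinite sum.empty f0 not_False_eq_True)
  then show "pk.kos ?Y A (\<lambda>Q. f (u Q)) Q = f (pk.kos ?Y A u Q)"
    unfolding pk.kos_def cf by simp
qed

text \<open>A graded complex of free modules without augmentation, exact in positive positions; the
  module that it resolves is the cokernel of \<open>\<delta> 0\<close>.\<close>

locale free_complex =
  fixes n :: nat and B :: "nat \<Rightarrow> nat set" and gs :: "nat \<Rightarrow> nat \<Rightarrow> int"
    and \<delta> :: "nat \<Rightarrow> (nat \<Rightarrow> 'k::field mpoly) \<Rightarrow> nat \<Rightarrow> 'k mpoly"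
  assumes d_in: "v \<in> fpolys n (B (Suc l)) \<Longrightarrow> \<delta> l v \<in> fpolys n (B l)"
    and d_add: "u \<in> fpolys n (B (Suc l)) \<Longrightarrow> v \<in> fpolys n (B (Suc l)) \<Longrightarrow> \<delta> l (u + v) = \<delta> l u + \<delta> l v"
    and d_scale: "f \<in> mpolys n \<Longrightarrow> v \<in> fpolys n (B (Suc l)) \<Longrightarrow> \<delta> l (pscale f v) = pscale f (\<delta> l v)"
    and d_graded: "v \<in> fgr n (B (Suc l)) (gs (Suc l)) j \<Longrightarrow> \<delta> l v \<in> fgr n (B l) (gs l) j"
    and d_d: "v \<in> fpolys n (B (Suc (Suc l))) \<Longrightarrow> \<delta> l (\<delta> (Suc l) v) = 0"
    and d_exact: "v \<in> fpolys n (B (Suc l)) \<Longrightarrow> \<delta> l v = 0 \<Longrightarrow> v \<in> \<delta> (Suc l) ` fpolys n (B (Suc (Suc l)))"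
begin

lemma d_0 [simp]: "\<delta> l 0 = 0"
  using d_add[of 0 l 0] by simp

lemma d_diff:
  assumes "u \<in> fpolys n (B (Suc l))" and "v \<in> fpolys n (B (Suc l))"
  shows "\<delta> l (u - v) = \<delta> l u - \<delta> l v"
  using d_add[OF fpolys_diff[OF assms] assms(2)] by simp

lemma d_minus: "v \<in> fpolys n (B (Suc l)) \<Longrightarrow> \<delta> l (- v) = - \<delta> l v"
  using d_diff[OF fpolys_0] by fastforce

lemma d_sum:
  "(\<And>i. i \<in> I \<Longrightarrow> f i \<in> fpolys n (B (Suc l))) \<Longrightarrow> \<delta> l (\<Sum>i\<in>I. f i) = (\<Sum>i\<in>I. \<delta> l (f i))"
proof (induction I rule: infinite_finite_induct)
  case (insert i I)
  then have "(\<Sum>i\<in>I. f i) \<in> fpolys n (B (Suc l))" by (intro fpolys_sum) auto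
  moreover have "\<delta> l (\<Sum>i\<in>I. f i) = (\<Sum>i\<in>I. \<delta> l (f i))" using insert by simp
  ultimately show ?case
    using d_add[of "f i" l "\<Sum>i\<in>I. f i"] insert.prems by (simp only: sum.insert[OF insert.hyps] insertI1)
qed (simp_all only: sum.infinite sum.empty d_0 not_False_eq_True)

text \<open>Homogeneous components are mapped into their own degrees, so the component of the image
  is the image of the component. This allows homogeneous preimages throughout.\<close>

lemma d_prj:
  assumes v: "v \<in> fpolys n (B (Suc l))"
  shows "\<delta> l (prj (gs (Suc l)) j v) = prj (gs l) j (\<delta> l v)"
proof -
  let ?p = "prj (gs (Suc l))"
  obtain J where J: "finite J" "v = (\<Sum>i\<in>J. ?p i v)" "\<And>j. j \<notin> J \<Longrightarrow> ?p j v = 0"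
    using sum_prj[OF v] by blast
  have pd: "prj (gs l) j (\<delta> l (?p i v)) = (if i = j then \<delta> l (?p i v) else 0)" for i
  proof -
    have "\<delta> l (?p i v) \<in> fgr n (B l) (gs l) i" by (intro d_graded prj_in_fgr v)
    then have e: "\<delta> l (?p i v) = prj (gs l) i (\<delta> l (?p i v))" by (simp add: fgr_def)
    show ?thesis by (subst e, subst prj_prj) (use e in auto)
  qed
  have "\<delta> l v = (\<Sum>i\<in>J. \<delta> l (?p i v))"
    using d_sum[of J "\<lambda>i. ?p i v" l] prj_in_fpolys[OF v] J(2) by simp
  then have "prj (gs l) j (\<delta> l v) = (\<Sum>i\<in>J. if i = j then \<delta> l (?p i v) else 0)"
    by (simp only: prj_sum pd)
  also have "\<dots> = \<delta> l (?p j v)" using J(1,3) by (auto simp: sum.delta)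
  finally show ?thesis by simp
qed

text \<open>The degree \<open>j\<close> is that of the coefficients alone: the exterior generators
  count as degree \<open>0\<close>, and the Koszul differential therefore raises \<open>j\<close> by
  one.\<close>

definition Cx :: "nat set \<Rightarrow> nat \<Rightarrow> nat \<Rightarrow> int \<Rightarrow> (nat set \<Rightarrow> nat \<Rightarrow> 'k mpoly) set" where
  "Cx A l m j = {u. supp_fam A m u \<and> (\<forall>Q. u Q \<in> fgr n (B l) (gs l) j)}"

definition Df :: "nat \<Rightarrow> (nat set \<Rightarrow> nat \<Rightarrow> 'k mpoly) \<Rightarrow> nat set \<Rightarrow> nat \<Rightarrow> 'k mpoly" where
  "Df l u = (\<lambda>Q. \<delta> l (u Q))"

lemma Cx_fpolys: "u \<in> Cx A l m j \<Longrightarrow> u Q \<in> fpolys n (B l)"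
  by (auto simp: Cx_def fgr_def)

text \<open>Preimages are chosen separately for each \<open>Q\<close>, made homogeneous by
  projection, and set to zero where \<open>w\<close> is zero so that the support does not
  grow.\<close>

lemma lift_Df:
  assumes w: "w \<in> Cx A l m j" and im: "\<And>Q. w Q \<in> \<delta> l ` fpolys n (B (Suc l))"
  shows "\<exists>u\<in>Cx A (Suc l) m j. Df l u = w"
proof -
  have "\<exists>u. u \<in> fgr n (B (Suc l)) (gs (Suc l)) j \<and> \<delta> l u = w Q \<and> (w Q = 0 \<longrightarrow> u = 0)" for Q
  proof (cases "w Q = 0")
    case True
    then show ?thesis by (intro exI[of _ 0]) simp
  next
    case False
    obtain u where u: "u \<in> fpolys n (B (Suc l))" "w Q = \<delta> l u" using im[of Q] by blast
    have "prj (gs l) j (w Q) = w Q" using w by (simp add: Cx_def fgr_def)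
    then have "\<delta> l (prj (gs (Suc l)) j u) = w Q" using d_prj[OF u(1)] u(2) by simp
    then show ?thesis using prj_in_fgr[OF u(1)] False by blast
  qed
  then obtain u where u: "\<And>Q. u Q \<in> fgr n (B (Suc l)) (gs (Suc l)) j" "\<And>Q. \<delta> l (u Q) = w Q"
    "\<And>Q. w Q = 0 \<Longrightarrow> u Q = 0" by metis
  have "supp_fam A m u"
    unfolding supp_fam_def
  proof (intro allI impI)
    fix Q assume "u Q \<noteq> 0"
    then have "w Q \<noteq> 0" using u(3) by blast
    then show "Q \<subseteq> A \<and> finite Q \<and> card Q = m" using w by (simp add: Cx_def supp_fam_def)
  qed
  then show ?thesis using u by (intro bexI[of _ u]) (auto simp: Cx_def Df_def)
qed

lemma contr_in_fgr: "(\<And>Q. u Q \<in> fgr n b g j) \<Longrightarrow> contr v u Q \<in> fgr n b g j"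
  by (simp add: contr_def signed_def fgr_uminus)

lemma kos_Df:
  assumes "A \<subseteq> {..<n}" and u: "u \<in> Cx A (Suc l) m j"
  shows "pk.kos (echelon_form n A c) A (Df l u) = Df l (pk.kos (echelon_form n A c) A u)"
  unfolding Df_def by (rule kos_linear[OF assms(1) Cx_fpolys[OF u] d_add d_scale])

lemma fgr_sum: "(\<And>i. i \<in> I \<Longrightarrow> f i \<in> fgr n b g j) \<Longrightarrow> (\<Sum>i\<in>I. f i) \<in> fgr n b g j"
  by (induction I rule: infinite_finite_induct) (simp_all only: sum.infinite sum.empty fgr_0 sum.insert fgr_add not_False_eq_True insert_iff simp_thms)

lemma kos_in_Cx:
  assumes "A \<subseteq> {..<n}" and u: "u \<in> Cx A l (Suc m) j"
  shows "pk.kos (echelon_form n A c) A u \<in> Cx A l m (j + 1)"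
proof -
  have "pk.kos (echelon_form n A c) A u Q \<in> fgr n (B l) (gs l) (j + 1)" for Q
    unfolding pk.kos_def
    by (intro fgr_sum fgr_echelon contr_in_fgr) (use assms in \<open>auto simp: Cx_def\<close>)
  then show ?thesis using u pk.supp_fam_kos by (auto simp: Cx_def)
qed

text \<open>Exactness of \<open>Df\<close> is that of the resolution; exactness of
  \<open>kos\<close> holds because echelon forms are a regular sequence on free modules.\<close>

lemma double_complex_Cx:
  assumes A: "A \<subseteq> {..<n}"
  shows "double_complex (Cx A) Df (pk.kos (echelon_form n A c) A)"
proof
  fix l m j
  show "0 \<in> Cx A l m j" by (auto simp: Cx_def supp_fam_0)
  show "x - y \<in> Cx A l m j" if "x \<in> Cx A l m j" "y \<in> Cx A l m j" for x y
    using that by (auto simp: Cx_def supp_fam_diff fgr_diff)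
  show "Df l x \<in> Cx A l m j" if "x \<in> Cx A (Suc l) m j" for x
    using that supp_fam_map[of A m x "\<delta> l"] by (auto simp: Cx_def Df_def d_graded)
  show "Df l (x - y) = Df l x - Df l y" if "x \<in> Cx A (Suc l) m j" "y \<in> Cx A (Suc l) m j" for x y
    using d_diff[OF Cx_fpolys[OF that(1)] Cx_fpolys[OF that(2)]] by (intro ext) (simp add: Df_def)
  show "pk.kos (echelon_form n A c) A x \<in> Cx A l m (j + 1)" if "x \<in> Cx A l (Suc m) j" for x
    using kos_in_Cx[OF A that] .
  show "Df l (Df (Suc l) x) = 0" if "x \<in> Cx A (Suc (Suc l)) m j" for x
    using d_d[OF Cx_fpolys[OF that]] by (intro ext) (simp add: Df_def)
  show "pk.kos (echelon_form n A c) A (Df l x) = Df l (pk.kos (echelon_form n A c) A x)"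
    if "x \<in> Cx A (Suc l) m j" for x
    by (rule kos_Df[OF A that])
  show "\<exists>y\<in>Cx A (Suc (Suc l)) m j. Df (Suc l) y = x" if x: "x \<in> Cx A (Suc l) m j" "Df l x = 0" for x
  proof (rule lift_Df[OF x(1)])
    show "x Q \<in> \<delta> (Suc l) ` fpolys n (B (Suc (Suc l)))" for Q
      using fun_cong[OF x(2), of Q] by (intro d_exact Cx_fpolys[OF x(1)]) (simp add: Df_def)
  qed
  show "\<exists>y\<in>Cx A l (Suc (Suc m)) (j - 1). pk.kos (echelon_form n A c) A y = x"
    if "x \<in> Cx A l (Suc m) j" "pk.kos (echelon_form n A c) A x = 0" for x
    using kos_exact_graded[OF A, of m x "B l" "gs l" j c] that by (auto simp: Cx_def)
qed (rule pk.kos_diff pk.kos_kos)+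

lemma Df_in_image: "x \<in> Cx A (Suc l) m j \<Longrightarrow> Df l x Q \<in> \<delta> l ` fpolys n (B (Suc l))"
  using Cx_fpolys by (auto simp: Df_def)

lemma d_image_add:
  "x \<in> \<delta> l ` fpolys n (B (Suc l)) \<Longrightarrow> y \<in> \<delta> l ` fpolys n (B (Suc l)) \<Longrightarrow> x + y \<in> \<delta> l ` fpolys n (B (Suc l))"
  by (auto simp flip: d_add intro: fpolys_add)

lemma d_image_diff:
  "x \<in> \<delta> l ` fpolys n (B (Suc l)) \<Longrightarrow> y \<in> \<delta> l ` fpolys n (B (Suc l)) \<Longrightarrow> x - y \<in> \<delta> l ` fpolys n (B (Suc l))"
  by (auto simp flip: d_diff intro: fpolys_diff)

lemma d_image_uminus: "x \<in> \<delta> l ` fpolys n (B (Suc l)) \<Longrightarrow> - x \<in> \<delta> l ` fpolys n (B (Suc l))"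
  by (auto simp flip: d_minus intro: fpolys_uminus)

lemma d_image_scale:
  "f \<in> mpolys n \<Longrightarrow> x \<in> \<delta> l ` fpolys n (B (Suc l)) \<Longrightarrow> pscale f x \<in> \<delta> l ` fpolys n (B (Suc l))"
  by (auto simp flip: d_scale intro: fpolys_pscale)

lemma d_image_0: "0 \<in> \<delta> l ` fpolys n (B (Suc l))"
  using d_0 fpolys_0 by (metis imageI)

lemma d_image_sum:
  "(\<And>i. i \<in> I \<Longrightarrow> f i \<in> \<delta> l ` fpolys n (B (Suc l))) \<Longrightarrow> (\<Sum>i\<in>I. f i) \<in> \<delta> l ` fpolys n (B (Suc l))"
  by (induction I rule: infinite_finite_induct) (simp_all only: sum.infinite sum.empty d_image_0 sum.insert d_image_add not_False_eq_True insert_iff simp_thms)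

lemma kos_in_image:
  assumes "A \<subseteq> {..<n}" and "\<And>Q. u Q \<in> \<delta> l ` fpolys n (B (Suc l))"
  shows "pk.kos (echelon_form n A c) A u Q \<in> \<delta> l ` fpolys n (B (Suc l))"
proof -
  have "contr v u Q \<in> \<delta> l ` fpolys n (B (Suc l))" for v
    using assms(2) d_image_uminus d_image_0 by (simp add: contr_def signed_def)
  then show ?thesis
    unfolding pk.kos_def
    by (intro d_image_sum d_image_scale echelon_form_in_mpolys) (use assms(1) in auto)
qed

end

section \<open>The linear strand\<close>

text \<open>
  \<open>H\<close> embeds the lowest component of the cokernel of \<open>\<delta> 0\<close> into a vector space. The Koszul cycles with
  coefficients in this component form the space \<open>cycles i\<close>, which is linked by zigzags to the
  cycles of degree \<open>d + i\<close> of the complex modulo the variables.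
\<close>

locale linear_strand = free_complex n B gs \<delta> + family_space scale
  for n B gs and \<delta> :: "nat \<Rightarrow> (nat \<Rightarrow> 'k::field mpoly) \<Rightarrow> nat \<Rightarrow> 'k mpoly"
    and scale :: "'k \<Rightarrow> 'v::ab_group_add \<Rightarrow> 'v" +
  fixes d :: int and H :: "(nat \<Rightarrow> 'k mpoly) \<Rightarrow> 'v"
  assumes H_add: "x \<in> fgr n (B 0) (gs 0) d \<Longrightarrow> y \<in> fgr n (B 0) (gs 0) d \<Longrightarrow> H (x + y) = H x + H y"
    and H_scale: "x \<in> fgr n (B 0) (gs 0) d \<Longrightarrow> H (pscale (mconst c) x) = scale c (H x)"
    and H_kernel: "x \<in> fgr n (B 0) (gs 0) d \<Longrightarrow> H x = 0 \<longleftrightarrow> x \<in> \<delta> 0 ` fpolys n (B 1)"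
    and low: "fgr n (B 0) (gs 0) (d - 1) \<subseteq> \<delta> 0 ` fpolys n (B 1)"
    and H_spanned: "\<exists>W. finite W \<and> H ` fgr n (B 0) (gs 0) d \<subseteq> span W"
begin

abbreviation "ks \<equiv> pk.kos (echelon_form n {..<n} (\<lambda>_ _. 0)) {..<n}"

sublocale dc: double_complex "Cx {..<n}" Df ks
  by (rule double_complex_Cx) simp

lemma H_0 [simp]: "H 0 = 0"
  using H_add[of 0 0] by simp

lemma H_diff:
  assumes "x \<in> fgr n (B 0) (gs 0) d" and "y \<in> fgr n (B 0) (gs 0) d"
  shows "H (x - y) = H x - H y"
  using H_add[OF fgr_diff[OF assms] assms(2)] by simp

lemma H_minus: "x \<in> fgr n (B 0) (gs 0) d \<Longrightarrow> H (- x) = - H x"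
  using H_diff[OF fgr_0] by fastforce

text \<open>Lifts to \<open>F 0\<close> of Koszul cycles over the cokernel: the differential
  vanishes only modulo the image of \<open>\<delta> 0\<close>. Lifts avoid a quotient module, and
  \<open>H\<close> identifies those that differ by relations.\<close>

definition precycles :: "nat \<Rightarrow> (nat set \<Rightarrow> nat \<Rightarrow> 'k mpoly) set" where
  "precycles i = {y \<in> Cx {..<n} 0 i d. \<forall>Q. ks y Q \<in> \<delta> 0 ` fpolys n (B 1)}"

definition cycles :: "nat \<Rightarrow> (nat set \<Rightarrow> 'v) set" where
  "cycles i = (\<lambda>y Q. H (y Q)) ` precycles i"

lemma precycles_0: "0 \<in> precycles i"
  using d_image_0[of 0] by (simp add: precycles_def dc.zero_in pk.kos_0)

lemma precycles_diff: "y \<in> precycles i \<Longrightarrow> y' \<in> precycles i \<Longrightarrow> y - y' \<in> precycles i"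
  using d_image_diff[of _ 0] by (simp add: precycles_def dc.diff_in pk.kos_diff)

lemma precycles_fgr: "y \<in> precycles i \<Longrightarrow> y Q \<in> fgr n (B 0) (gs 0) d"
  by (simp add: precycles_def Cx_def)

lemma contr_pscale: "contr v (\<lambda>Q. pscale f (u Q)) = (\<lambda>Q. pscale f (contr v u Q))"
  using contr_map[of "pscale f" v u] by (simp add: fun_eq_iff)

lemma kos_pscale: "pk.kos Y A (\<lambda>Q. pscale f (u Q)) = (\<lambda>Q. pscale f (pk.kos Y A u Q))"
  unfolding pk.kos_def contr_pscale
  by (auto simp: fun_eq_iff sum_fun_apply sum_distrib_left mult.left_commute)

lemma precycles_scale: "y \<in> precycles i \<Longrightarrow> (\<lambda>Q. pscale (mconst c) (y Q)) \<in> precycles i"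
  using d_image_scale[of "mconst c" _ 0] fgr_const[of _ n "B 0" "gs 0" d c]
    supp_fam_map[of "{..<n}" i y "pscale (mconst c)"]
  by (simp add: precycles_def Cx_def kos_pscale fun_eq_iff)

text \<open>The contraction anticommutes with each contraction inside \<open>kos\<close>, and it
  commutes with scalars; this is why (pre)cycles are stable under contraction.\<close>

lemma kos_contr:
  fixes Y :: "nat \<Rightarrow> 'k mpoly" and u :: "nat set \<Rightarrow> nat \<Rightarrow> 'k mpoly"
  shows "pk.kos Y A (contr v u) = - contr v (pk.kos Y A u)"
proof (rule ext)
  fix Q
  have s: "contr v (\<lambda>R. \<Sum>w\<in>A. f w R) Q = (\<Sum>w\<in>A. contr v (f w) Q)"
    for f :: "nat \<Rightarrow> nat set \<Rightarrow> nat \<Rightarrow> 'k mpoly"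
    by (auto simp: contr_def signed_def sum_negf)
  have "pk.kos Y A (contr v u) Q = (\<Sum>w\<in>A. - pscale (Y w) (contr v (contr w u) Q))"
    unfolding pk.kos_def contr_contr[of _ v] by (simp add: pk.act_minus)
  also have "\<dots> = (- contr v (pk.kos Y A u)) Q"
    unfolding pk.kos_def by (simp only: uminus_apply s contr_pscale sum_negf)
  finally show "pk.kos Y A (contr v u) Q = (- contr v (pk.kos Y A u)) Q" .
qed

lemma precycles_contr: 
  assumes "y \<in> precycles (Suc i)"
  shows "contr v y \<in> precycles i"
proof -
  have "contr v (ks y) Q \<in> \<delta> 0 ` fpolys n (B 1)" for Q
    using assms d_image_uminus[of _ 0] d_image_0[of 0] by (simp add: precycles_def contr_def signed_def)
  then have "ks (contr v y) Q \<in> \<delta> 0 ` fpolys n (B 1)" for Q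
    unfolding kos_contr using d_image_uminus[of _ 0] by simp
  then show ?thesis
    using assms by (auto simp: precycles_def Cx_def intro: supp_fam_contr contr_in_fgr)
qed

lemma contr_H: "y \<in> precycles i \<Longrightarrow> contr v (\<lambda>Q. H (y Q)) = (\<lambda>Q. H (contr v y Q))"
  using H_minus[OF precycles_fgr] by (intro ext) (simp add: contr_def signed_def)

lemma contr_closed_cycles: "contr_closed {..<n} cycles"
  unfolding contr_closed_def
proof (intro conjI allI ballI)
  fix i
  show "fam.subspace (cycles i)"
  proof (rule fam.subspaceI)
    show "0 \<in> cycles i" unfolding cycles_def
      using precycles_0[of i] by (intro image_eqI[of _ _ 0]) (auto simp: fun_eq_iff)
  next
    fix x y assume "x \<in> cycles i" "y \<in> cycles i"
    then obtain a b where a: "a \<in> precycles i" "x = (\<lambda>Q. H (a Q))" and b: "b \<in> precycles i" "y = (\<lambda>Q. H (b Q))"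
      by (auto simp: cycles_def)
    have "a - (0 - b) \<in> precycles i" by (intro precycles_diff precycles_0 a b)
    moreover have "x + y = (\<lambda>Q. H ((a - (0 - b)) Q))"
      using H_add[OF precycles_fgr[OF a(1)] precycles_fgr[OF b(1)]] by (simp add: a(2) b(2) fun_eq_iff)
    ultimately show "x + y \<in> cycles i" unfolding cycles_def by blast
  next
    fix c x assume "x \<in> cycles i"
    then obtain a where a: "a \<in> precycles i" "x = (\<lambda>Q. H (a Q))" by (auto simp: cycles_def)
    have "fscale c x = (\<lambda>Q. H (pscale (mconst c) (a Q)))"
      using H_scale[OF precycles_fgr[OF a(1)]] by (simp add: a(2) fscale_def)
    then show "fscale c x \<in> cycles i" unfolding cycles_def
      by (intro image_eqI[where x = "\<lambda>Q. pscale (mconst c) (a Q)"] precycles_scale[OF a(1)])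
  qed
  show "supp_fam {..<n} i u" if "u \<in> cycles i" for u
    using that supp_fam_map[of "{..<n}" i _ H] by (auto simp: cycles_def precycles_def Cx_def)
  show "contr v u \<in> cycles i" if "v \<in> {..<n}" "u \<in> cycles (Suc i)" for v u
    using that(2) precycles_contr unfolding cycles_def by (auto simp: contr_H intro!: image_eqI)
qed

text \<open>A family supported on subsets of \<open>{..<n}\<close> is a finite sum of families
  concentrated at one set, with values in the finitely generated span of \<open>W\<close>.\<close>

lemma cycles_spanned: "\<exists>W. finite W \<and> cycles i \<subseteq> fam.span W"
proof -
  obtain W where W: "finite W" "H ` fgr n (B 0) (gs 0) d \<subseteq> span W" using H_spanned by blast
  define e where "e Q w = (\<lambda>R. if R = Q then w else 0)" for Q :: "nat set" and w :: 'v
  let ?W = "(\<lambda>(Q, w). e Q w) ` (Pow {..<n} \<times> W)"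
  have eW: "e Q w \<in> fam.span ?W" if Q: "Q \<subseteq> {..<n}" and w: "w \<in> span W" for Q w
    using w
  proof (induction rule: span_induct_alt)
    case base
    have "e Q 0 = 0" by (simp add: e_def fun_eq_iff)
    then show ?case using fam.span_zero by metis
  next
    case (step c x y)
    have "e Q (scale c x + y) = fscale c (e Q x) + e Q y"
      by (auto simp: e_def fscale_def fun_eq_iff)
    moreover have "e Q x \<in> fam.span ?W" using step(1) Q by (intro fam.span_base) auto
    ultimately show ?case using step(2) fam.span_add fam.span_scale by metis
  qed
  have "u \<in> fam.span ?W" if uc: "u \<in> cycles i" for u
  proof -
    have "supp_fam {..<n} i u" using contr_closed_cycles that by (auto simp: contr_closed_def)
    then have "u = (\<Sum>Q\<in>Pow {..<n}. e Q (u Q))"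
      unfolding fun_eq_iff sum_fun_apply e_def by (auto simp: supp_fam_def)
    also have "\<dots> \<in> fam.span ?W"
    proof (intro fam.span_sum eW)
      fix Q
      obtain y where "y \<in> precycles i" "u = (\<lambda>Q. H (y Q))" using uc by (auto simp: cycles_def)
      then show "u Q \<in> span W" using W(2) precycles_fgr by blast
    qed auto
    finally show ?thesis .
  qed
  then show ?thesis using W(1) by (intro exI[of _ ?W]) auto
qed

text \<open>Cycles of the complex modulo the variables, expressed on \<open>F i\<close> itself:
  reduction modulo the variables kills exactly the families without constant terms. At
  \<open>i = 0\<close> every element is a cycle.\<close>

definition tor_cycles :: "nat \<Rightarrow> (nat \<Rightarrow> 'k mpoly) set" where
  "tor_cycles i = {w \<in> fgr n (B i) (gs i) (int i + d). i = 0 \<or> (\<forall>b. coef (\<delta> (i - 1) w b) 0 = 0)}"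

text \<open>The witness \<open>v\<close> may be inhomogeneous, to match boundaries of the whole
  tensor complex.\<close>

definition tor_boundary :: "nat \<Rightarrow> (nat \<Rightarrow> 'k mpoly) \<Rightarrow> bool" where
  "tor_boundary i w \<longleftrightarrow> (\<exists>v\<in>fpolys n (B (Suc i)). \<forall>b. coef ((w - \<delta> i v) b) 0 = 0)"

text \<open>A relation rather than a map, since the staircase involves choices at every step. It
  becomes a bijection after passing to classes of \<open>w\<close> modulo boundaries.\<close>

definition linked :: "nat \<Rightarrow> (nat \<Rightarrow> 'k mpoly) \<Rightarrow> (nat set \<Rightarrow> 'v) \<Rightarrow> bool" where
  "linked i w u \<longleftrightarrow> (\<exists>y\<in>precycles i. dc.zigzag i 0 (int i + d) y (at_empty w) \<and> u = (\<lambda>Q. H (y Q)))"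

lemma Cx_0_iff: "u \<in> Cx {..<n} l 0 j \<longleftrightarrow> (\<exists>w\<in>fgr n (B l) (gs l) j. u = at_empty w)"
  unfolding Cx_def using supp_fam_0_eq[of "{..<n}" u] supp_fam_at_empty
  by (auto simp: at_empty_def) 

lemma at_empty_diff: "at_empty (w - w') = at_empty w - at_empty w'"
  by (auto simp: at_empty_def fun_eq_iff)

lemma Df_at_empty: "Df l (at_empty w) = at_empty (\<delta> l w)"
  by (auto simp: at_empty_def Df_def fun_eq_iff)

lemma linked_diff:
  assumes "linked i w u" and "linked i w' u'"
  shows "linked i (w - w') (u - u')"
proof -
  obtain y where y: "y \<in> precycles i" "dc.zigzag i 0 (int i + d) y (at_empty w)" "u = (\<lambda>Q. H (y Q))"
    using assms(1) by (auto simp: linked_def)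
  obtain y' where y': "y' \<in> precycles i" "dc.zigzag i 0 (int i + d) y' (at_empty w')" "u' = (\<lambda>Q. H (y' Q))"
    using assms(2) by (auto simp: linked_def)
  have "u - u' = (\<lambda>Q. H ((y - y') Q))"
    using H_diff[OF precycles_fgr[OF y(1)] precycles_fgr[OF y'(1)]] by (simp add: y(3) y'(3) fun_eq_iff)
  then show ?thesis
    unfolding linked_def at_empty_diff
    using precycles_diff[OF y(1) y'(1)] dc.zigzag_diff[OF y(2) y'(2)] by blast
qed

lemma linked_scale:
  assumes "linked i w u"
  shows "linked i (pscale (mconst c) w) (fscale c u)"
proof -
  let ?s = "\<lambda>u Q. pscale (mconst c) (u Q)"
  obtain y where y: "y \<in> precycles i" "dc.zigzag i 0 (int i + d) y (at_empty w)" "u = (\<lambda>Q. H (y Q))"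
    using assms by (auto simp: linked_def)
  have "dc.zigzag i 0 (int i + d) (?s y) (?s (at_empty w))"
  proof (rule dc.zigzag_map[OF _ _ _ y(2)])
    show "?s x \<in> Cx {..<n} l m j" if "x \<in> Cx {..<n} l m j" for x l m j
      using that supp_fam_map[of "{..<n}" m x "pscale (mconst c)"]
      by (auto simp: Cx_def fgr_const fun_eq_iff)
    show "Df l (?s x) = ?s (Df l x)" if "x \<in> Cx {..<n} (Suc l) m j" for x l m j
      using d_scale[OF mpolys_const Cx_fpolys[OF that]] by (simp add: Df_def)
  qed (rule kos_pscale)
  moreover have "?s (at_empty w) = at_empty (pscale (mconst c) w)"
    by (auto simp: at_empty_def fun_eq_iff)
  moreover have "fscale c u = (\<lambda>Q. H (?s y Q))"
    using H_scale[OF precycles_fgr[OF y(1)]] by (simp add: y(3) fscale_def)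
  ultimately show ?thesis unfolding linked_def using precycles_scale[OF y(1)] by metis
qed

lemma linked_right:
  assumes "linked i w u"
  shows "w \<in> tor_cycles i"
proof -
  obtain y where y: "dc.zigzag i 0 (int i + d) y (at_empty w)"
    using assms by (auto simp: linked_def)
  have w: "w \<in> fgr n (B i) (gs i) (int i + d)"
    using dc.zigzag_right[OF y] by (metis Cx_0_iff at_empty_empty)
  have "\<forall>b. coef (\<delta> (i - 1) w b) 0 = 0" if nz: "i \<noteq> 0"
  proof -
    obtain l where l: "i = Suc l" using nz not0_implies_Suc by blast
    obtain x where x: "dc.zigzag l 1 (int i + d - 1) y x" "ks x = at_empty (\<delta> l w)"
      using y unfolding l by (auto simp: Df_at_empty)
    have "x \<in> Cx {..<n} l 1 (int i + d - 1)" using dc.zigzag_right[OF x(1)] .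
    then have "\<forall>b. coef (\<delta> l w b) 0 = 0"
      using const_free_iff_kos[of "\<delta> l w" n "B l" "gs l" "int i + d" "\<lambda>_ _. 0"] x(2) d_graded[of w l] w l
      by (auto simp: Cx_def)
    then show ?thesis by (simp add: l)
  qed
  then show ?thesis using w by (auto simp: tor_cycles_def)
qed

lemma linked_left_total:
  assumes "w \<in> tor_cycles i"
  shows "\<exists>u. linked i w u"
proof -
  have w: "w \<in> fgr n (B i) (gs i) (int i + d)" using assms by (auto simp: tor_cycles_def)
  have "i = 0 \<or> (\<exists>x'\<in>Cx {..<n} (i - 1) (Suc 0) (int i + d - 1). ks x' = Df (i - 1) (at_empty w))"
  proof (cases i)
    case (Suc l)
    have "\<delta> l w \<in> fgr n (B l) (gs l) (int i + d)" using w Suc by (auto intro: d_graded)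
    moreover have "\<forall>b. coef (\<delta> l w b) 0 = 0" using assms Suc by (auto simp: tor_cycles_def)
    ultimately show ?thesis
      using const_free_iff_kos[of "\<delta> l w" n "B l" "gs l" "int i + d" "\<lambda>_ _. 0"] Suc
      by (auto simp: Cx_def Df_at_empty)
  qed simp
  moreover have "at_empty w \<in> Cx {..<n} i 0 (int i + d)" using w Cx_0_iff by blast
  ultimately obtain y where y: "dc.zigzag i 0 (int i + d) y (at_empty w)"
    using dc.zigzag_from_right by blast
  have y0: "y \<in> Cx {..<n} 0 i d" using dc.zigzag_left[OF y] by simp
  have "ks y Q \<in> \<delta> 0 ` fpolys n (B 1)" for Q
  proof (cases i)
    case 0
    then have "ks y = 0" using y0 by (intro pk.kos_supp_0) (auto simp: Cx_def)
    then show ?thesis using d_image_0[of 0] by simp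
  next
    case (Suc l)
    \<comment> \<open>The recursion of \<open>zigzag\<close> exposes the right end, whereas the
      equation needed is the one at the left end, so it is dug out by induction.\<close>
    have im: "\<exists>m j x'. x' \<in> Cx {..<n} 1 m j \<and> ks y = Df 0 x'" if "dc.zigzag (Suc l) m j y x" for l m j x
      using that
    proof (induction l arbitrary: m j x)
      case 0
      then have "x \<in> Cx {..<n} 1 m j \<and> ks y = Df 0 x"
        unfolding dc.zigzag.simps One_nat_def by blast
      then show ?case by blast
    next
      case (Suc l)
      then show ?case unfolding dc.zigzag.simps(2)[of "Suc l"] by blast
    qed
    obtain m j x' where "x' \<in> Cx {..<n} 1 m j" "ks y = Df 0 x'" using im[of l] y Suc by blast
    then show ?thesis using Df_in_image[of x' "{..<n}" 0 m j Q] by simp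
  qed
  then show ?thesis using y y0 by (auto simp: linked_def precycles_def)
qed

lemma linked_right_total:
  assumes "u \<in> cycles i"
  shows "\<exists>w. linked i w u"
proof -
  obtain y where y: "y \<in> precycles i" "u = (\<lambda>Q. H (y Q))" using assms by (auto simp: cycles_def)
  have y0: "y \<in> Cx {..<n} 0 i d" using y(1) by (simp add: precycles_def)
  have "i = 0 \<or> ks y \<in> Df 0 ` Cx {..<n} 1 (i - 1) (d + 1)"
  proof (cases i)
    case (Suc l)
    have "ks y \<in> Cx {..<n} 0 l (d + 1)" using y0 Suc by (intro kos_in_Cx) auto
    then obtain x where "x \<in> Cx {..<n} (Suc 0) l (d + 1)" "Df 0 x = ks y"
      using lift_Df[of "ks y" "{..<n}" 0 l "d + 1"] y(1) by (auto simp: precycles_def)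
    then show ?thesis using Suc by (auto intro!: image_eqI[of _ _ x])
  qed simp
  then obtain x where x: "dc.zigzag i 0 (int i + d) y x"
    using dc.zigzag_from_left[of y 0 i "int i + d"] y0 by auto
  obtain w where "x = at_empty w" using dc.zigzag_right[OF x] Cx_0_iff by blast
  then show ?thesis using x y by (auto simp: linked_def)
qed

text \<open>Vanishing of \<open>u\<close> says that \<open>y\<close> has values in the image of
  \<open>\<delta> 0\<close>; the two boundary lemmas for zigzags carry this to \<open>w\<close>
  being a boundary modulo the variables, and back.\<close>

lemma linked_zero_iff:
  assumes "linked i w u"
  shows "u = 0 \<longleftrightarrow> tor_boundary i w"
proof -
  let ?J = "int i + d"
  obtain y where y: "y \<in> precycles i" "dc.zigzag i 0 ?J y (at_empty w)" "u = (\<lambda>Q. H (y Q))"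
    using assms by (auto simp: linked_def)
  have y0: "y \<in> Cx {..<n} 0 i d" using y(1) by (simp add: precycles_def)
  have w: "w \<in> fgr n (B i) (gs i) ?J" using linked_right[OF assms] by (simp add: tor_cycles_def)
  have u0: "u = 0 \<longleftrightarrow> (\<forall>Q. y Q \<in> \<delta> 0 ` fpolys n (B 1))"
    using H_kernel[OF precycles_fgr[OF y(1)]] by (simp add: y(3) fun_eq_iff)
  show ?thesis
  proof
    assume "u = 0"
    then obtain x where "x \<in> Cx {..<n} (Suc 0) i d" "Df 0 x = y"
      using lift_Df[OF y0] u0 by auto
    then have "y \<in> Df 0 ` Cx {..<n} 1 (0 + i) (?J - int i)" by auto
    then obtain x x' where x: "x \<in> Cx {..<n} i (Suc 0) (?J - 1)" "x' \<in> Cx {..<n} (Suc i) 0 ?J"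
      "at_empty w = ks x + Df i x'"
      using dc.zigzag_left_boundary[OF y(2)] by blast
    obtain v where v: "v \<in> fgr n (B (Suc i)) (gs (Suc i)) ?J" "x' = at_empty v"
      using x(2) Cx_0_iff by blast
    have "ks x = at_empty (w - \<delta> i v)"
      using x(3) unfolding v(2) Df_at_empty at_empty_diff by simp
    then have "\<forall>b. coef ((w - \<delta> i v) b) 0 = 0"
      using const_free_iff_kos[of "w - \<delta> i v" n "B i" "gs i" ?J "\<lambda>_ _. 0"] x(1) w v(1)
      by (auto simp: Cx_def fgr_diff d_graded)
    moreover have "v \<in> fpolys n (B (Suc i))" using v(1) by (simp add: fgr_def)
    ultimately show "tor_boundary i w" unfolding tor_boundary_def by blast
  next
    assume "tor_boundary i w"
    then obtain v0 where v0: "v0 \<in> fpolys n (B (Suc i))" "\<And>b. coef ((w - \<delta> i v0) b) 0 = 0"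
      by (auto simp: tor_boundary_def)
    \<comment> \<open>As \<open>w\<close> is homogeneous, the component of \<open>v0\<close> in the
      degree of \<open>w\<close> is a witness as well.\<close>
    define v where "v = prj (gs (Suc i)) ?J v0"
    have v: "v \<in> fgr n (B (Suc i)) (gs (Suc i)) ?J" unfolding v_def by (rule prj_in_fgr[OF v0(1)])
    have "w - \<delta> i v = prj (gs i) ?J (w - \<delta> i v0)"
      using w unfolding v_def d_prj[OF v0(1)] prj_diff by (simp add: fgr_def)
    then have "coef ((w - \<delta> i v) b) 0 = 0" for b
      using v0(2)[of b] by (simp add: prj_def coef_hpart del: minus_apply)
    moreover have wv: "w - \<delta> i v \<in> fgr n (B i) (gs i) ?J" using w v d_graded fgr_diff by blast
    ultimately obtain x where x: "x \<in> Cx {..<n} i (Suc 0) (?J - 1)" "ks x = at_empty (w - \<delta> i v)"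
      using const_free_iff_kos[OF wv, of "\<lambda>_ _. 0"] by (auto simp: Cx_def)
    have "at_empty w = ks x + Df i (at_empty v)"
      unfolding x(2) Df_at_empty at_empty_diff by simp
    moreover have "at_empty v \<in> Cx {..<n} (Suc i) 0 ?J" using v Cx_0_iff by blast
    ultimately obtain t t' where t: "t \<in> Cx {..<n} 0 (Suc (0 + i)) (?J - int i - 1)"
      "t' \<in> Cx {..<n} 1 (0 + i) (?J - int i)" "y = ks t + Df 0 t'"
      using dc.zigzag_right_boundary[OF y(2) x(1)] by blast
    \<comment> \<open>The special feature of the linear strand: \<open>t\<close> has coefficients of
      degree \<open>d - 1\<close>, which all lie in the image of \<open>\<delta> 0\<close>, so the
      Koszul boundary \<open>ks t\<close> becomes trivial in the cokernel.\<close>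
    have "t Q \<in> \<delta> 0 ` fpolys n (B (Suc 0))" for Q
      using t(1) low by (auto simp: Cx_def)
    then have "ks t Q \<in> \<delta> 0 ` fpolys n (B (Suc 0))" for Q
      by (intro kos_in_image) auto
    moreover have "Df 0 t' Q \<in> \<delta> 0 ` fpolys n (B (Suc 0))" for Q
      using t(2) by (intro Df_in_image) auto
    ultimately have "y Q \<in> \<delta> 0 ` fpolys n (B 1)" for Q
      unfolding t(3) using d_image_add[of "ks t Q" 0 "Df 0 t' Q"] by simp
    then show "u = 0" using u0 by blast
  qed
qed

lemma linked_left: "linked i w u \<Longrightarrow> u \<in> cycles i"
  by (auto simp: linked_def cycles_def)

text \<open>The map \<open>\<psi>\<close> presents \<open>V\<close> as cycles modulo boundaries,
  with no reference to tensor products. Relating \<open>\<psi> w\<close> to \<open>u\<close>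
  whenever \<open>w\<close> and \<open>u\<close> are linked gives the isomorphism.\<close>

lemma vdim_eq_dim_cycles:
  fixes V :: "('k, 'w) module"
  assumes onto: "\<psi> ` tor_cycles i = carrier V"
    and eq: "\<And>w w'. w \<in> tor_cycles i \<Longrightarrow> w' \<in> tor_cycles i \<Longrightarrow> \<psi> w = \<psi> w' \<longleftrightarrow> tor_boundary i (w - w')"
    and add: "\<And>w w'. w \<in> tor_cycles i \<Longrightarrow> w' \<in> tor_cycles i \<Longrightarrow> \<psi> w \<oplus>\<^bsub>V\<^esub> \<psi> w' = \<psi> (w + w')"
    and smult: "\<And>c w. w \<in> tor_cycles i \<Longrightarrow> c \<odot>\<^bsub>V\<^esub> \<psi> w = \<psi> (pscale (mconst c) w)"
    and zero: "\<zero>\<^bsub>V\<^esub> = \<psi> 0"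
  shows "vdim (ring_of_type_algebra :: 'k ring) V = fam.dim (cycles i)"
proof -
  obtain W where W: "finite W" "cycles i \<subseteq> fam.span W" using cycles_spanned by blast
  define T where "T x u \<longleftrightarrow> (\<exists>w. x = \<psi> w \<and> linked i w u)" for x u
  have l0: "linked i 0 0"
  proof -
    obtain w where "linked i w 0"
      using linked_right_total contr_closed_cycles fam.subspace_0 unfolding contr_closed_def by blast
    then show ?thesis using linked_diff[of i w 0 w 0] by simp
  qed
  have ladd: "linked i (w + w') (u + u')" if "linked i w u" "linked i w' u'" for w w' u u'
    using linked_diff[OF that(1) linked_diff[OF l0 that(2)]] by simp
  show ?thesis
  proof (rule fam.vdim_eq_dim_rel[of V T, OF _ _ _ _ _ _ _ _ W(2,1)])
    show "\<exists>u. T x u" if x: "x \<in> carrier V" for x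
    proof -
      obtain w where "w \<in> tor_cycles i" "x = \<psi> w" using x onto by blast
      then show ?thesis using linked_left_total unfolding T_def by blast
    qed
    show "\<exists>x. T x u" if "u \<in> cycles i" for u
      using linked_right_total[OF that] unfolding T_def by blast
    show "x \<in> carrier V \<and> u \<in> cycles i" if "T x u" for x u
      using that linked_left linked_right onto by (auto simp: T_def)
    show "u = u'" if "T x u" "T x u'" for x u u'
    proof -
      obtain w w' where w: "x = \<psi> w" "linked i w u" "x = \<psi> w'" "linked i w' u'"
        using \<open>T x u\<close> \<open>T x u'\<close> unfolding T_def by blast
      then have "tor_boundary i (w - w')" using eq[of w w'] linked_right by auto
      then have "u - u' = 0" using linked_zero_iff[OF linked_diff[OF w(2,4)]] by blast
      then show ?thesis by simp
    qed
    show "x = x'" if "T x u" "T x' u" for x x' u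
    proof -
      obtain w w' where w: "x = \<psi> w" "linked i w u" "x' = \<psi> w'" "linked i w' u"
        using \<open>T x u\<close> \<open>T x' u\<close> unfolding T_def by blast
      then have "tor_boundary i (w - w')" using linked_zero_iff[OF linked_diff[OF w(2,4)]] by simp
      then show ?thesis using eq[of w w'] linked_right w by auto
    qed
    show "T (x \<oplus>\<^bsub>V\<^esub> y) (u + u')" if "T x u" "T y u'" for x y u u'
      using that add ladd linked_right unfolding T_def by metis
    show "T (c \<odot>\<^bsub>V\<^esub> x) (fscale c u)" if "T x u" for c x u
      using that smult linked_scale linked_right unfolding T_def by metis
    show "T \<zero>\<^bsub>V\<^esub> 0" using l0 zero by (auto simp: T_def)
  qed
qed

end

section \<open>Tensor products with the residue field\<close>

lemma free_module_simps:
  fixes u :: "'i \<Rightarrow> 'k::field mpoly"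
  shows "carrier (free_module (mpoly_ring n) I) = (fpolys n I :: ('i \<Rightarrow> 'k mpoly) set)"
    "\<zero>\<^bsub>free_module (mpoly_ring n) I\<^esub> = (0 :: 'i \<Rightarrow> 'k mpoly)"
    "u \<oplus>\<^bsub>free_module (mpoly_ring n) I\<^esub> v = u + v"
    "f \<odot>\<^bsub>free_module (mpoly_ring n) I\<^esub> u = pscale f u"
  by (simp_all add: free_module_def fpolys_def carrier_mpoly_ring mpoly_ring_simps pscale_def fun_eq_iff)

lemma abelian_group_free_module: "abelian_group (free_module (mpoly_ring n) I :: ('k::field mpoly, 'i \<Rightarrow> 'k mpoly) module)"
proof (rule abelian_groupI)
  fix x :: "'i \<Rightarrow> 'k mpoly" assume "x \<in> carrier (free_module (mpoly_ring n) I)"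
  then show "\<exists>y\<in>carrier (free_module (mpoly_ring n) I). y \<oplus>\<^bsub>free_module (mpoly_ring n) I\<^esub> x = \<zero>\<^bsub>free_module (mpoly_ring n) I\<^esub>"
    unfolding free_module_simps by (intro bexI[of _ "- x"] fpolys_uminus) (auto simp: fun_eq_iff)
qed (unfold free_module_simps, auto intro: fpolys_add simp: fun_eq_iff)

lemma free_module_uminus:
  assumes "x \<in> fpolys n I"
  shows "\<ominus>\<^bsub>free_module (mpoly_ring n) I\<^esub> x = - (x :: 'i \<Rightarrow> 'k::field mpoly)"
proof -
  interpret abelian_group "free_module (mpoly_ring n) I :: ('k mpoly, 'i \<Rightarrow> 'k mpoly) module"
    by (rule abelian_group_free_module)
  show ?thesis
    by (rule minus_equality) (use assms in \<open>simp_all only: free_module_simps fpolys_uminus left_minus\<close>)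
qed

lemma free_module_minus:
  assumes "y \<in> fpolys n I"
  shows "x \<ominus>\<^bsub>free_module (mpoly_ring n) I\<^esub> y = x - (y :: 'i \<Rightarrow> 'k::field mpoly)"
  unfolding a_minus_def free_module_uminus[OF assms] free_module_simps by simp

lemma submodule_free_iff:
  fixes H :: "('i \<Rightarrow> 'k::field mpoly) set"
  shows "submodule H (mpoly_ring n) (free_module (mpoly_ring n) I) \<longleftrightarrow>
    H \<subseteq> fpolys n I \<and> 0 \<in> H \<and> (\<forall>x\<in>H. \<forall>y\<in>H. x + y \<in> H) \<and> (\<forall>x\<in>H. - x \<in> H) \<and>
    (\<forall>f\<in>mpolys n. \<forall>x\<in>H. pscale f x \<in> H)"
proof -
  have gen: "submodule H R M \<longleftrightarrow> H \<subseteq> carrier M \<and> \<zero>\<^bsub>M\<^esub> \<in> H \<and> (\<forall>x\<in>H. \<forall>y\<in>H. x \<oplus>\<^bsub>M\<^esub> y \<in> H) \<and>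
      (\<forall>x\<in>H. \<ominus>\<^bsub>M\<^esub> x \<in> H) \<and> (\<forall>f\<in>carrier R. \<forall>x\<in>H. f \<odot>\<^bsub>M\<^esub> x \<in> H)"
    for R :: "'k mpoly ring" and M :: "('k mpoly, 'i \<Rightarrow> 'k mpoly) module"
    by (auto simp: submodule_def submodule_axioms_def subgroup_def a_inv_def)
  have inv: "(\<forall>x\<in>H. \<ominus>\<^bsub>free_module (mpoly_ring n) I\<^esub> x \<in> H) \<longleftrightarrow> (\<forall>x\<in>H. - x \<in> H)" if "H \<subseteq> fpolys n I"
    using free_module_uminus[OF subsetD[OF that]] by simp
  show ?thesis
    unfolding gen free_module_simps carrier_mpoly_ring
    by (rule conj_cong[OF refl]) (simp only: inv)
qed

lemma basis_vec_mpoly: "basis_vec (mpoly_ring n) p = (\<lambda>q. if q = p then 1 else 0)"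
  by (simp add: basis_vec_def mpoly_ring_simps cong: if_cong)

lemma basis_vec_in_fpolys: "p \<in> I \<Longrightarrow> basis_vec (mpoly_ring n) p \<in> fpolys n I"
  by (auto simp: basis_vec_mpoly fpolys_def)

lemma residue_field_simps:
  "carrier residue_field = UNIV" "c \<oplus>\<^bsub>residue_field\<^esub> c' = c + c'" "\<zero>\<^bsub>residue_field\<^esub> = 0"
  "f \<odot>\<^bsub>residue_field\<^esub> c = coef f 0 * c" "hom_part residue_field j = (if j = 0 then UNIV else {0})"
  by (simp_all add: residue_field_def)

text \<open>The parameter \<open>ty\<close> serves to fix the type of the coefficients.\<close>

locale residue_tensor =
  fixes n :: nat and B :: "nat set" and g :: "nat \<Rightarrow> int" and ty :: "'k::field itself"
begin

abbreviation Rn :: "'k mpoly ring" where "Rn \<equiv> mpoly_ring n"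
abbreviation Fr :: "('k mpoly, nat \<Rightarrow> 'k mpoly) graded_module" where "Fr \<equiv> graded_free n B g"
abbreviation I :: "((nat \<Rightarrow> 'k mpoly) \<times> 'k) set" where "I \<equiv> fpolys n B \<times> UNIV"
abbreviation e :: "(nat \<Rightarrow> 'k mpoly) \<times> 'k \<Rightarrow> (nat \<Rightarrow> 'k mpoly) \<times> 'k \<Rightarrow> 'k mpoly" where
  "e \<equiv> basis_vec Rn"
abbreviation Nl :: "((nat \<Rightarrow> 'k mpoly) \<times> 'k \<Rightarrow> 'k mpoly) set" where
  "Nl \<equiv> tensor_null Rn Fr residue_field"
abbreviation Tn where "Tn \<equiv> tensor Rn Fr (residue_field :: ('k mpoly, 'k) graded_module)"

lemma relations_eq:
  "tensor_relations Rn Fr residue_field =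
     {e (x + x', c) - (e (x, c) + e (x', c)) | x x' c. x \<in> fpolys n B \<and> x' \<in> fpolys n B} \<union>
     {e (x, c + c') - (e (x, c) + e (x, c')) | x c c'. x \<in> fpolys n B} \<union>
     {e (pscale r x, c) - pscale r (e (x, c)) | r x c. r \<in> mpolys n \<and> x \<in> fpolys n B} \<union>
     {e (x, coef r 0 * c) - pscale r (e (x, c)) | r x c. r \<in> mpolys n \<and> x \<in> fpolys n B}"
proof -
  let ?M = "free_module Rn I"
  have a: "u \<ominus>\<^bsub>?M\<^esub> (v \<oplus>\<^bsub>?M\<^esub> w) = u - (v + w)" if "v \<in> fpolys n I" "w \<in> fpolys n I" for u v w
    using free_module_minus[OF fpolys_add[OF that]] by (simp only: free_module_simps)
  have b: "u \<ominus>\<^bsub>?M\<^esub> (r \<odot>\<^bsub>?M\<^esub> w) = u - pscale r w" if "r \<in> mpolys n" "w \<in> fpolys n I" for u r w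
    using free_module_minus[OF fpolys_pscale[OF that]] by (simp only: free_module_simps)
  have E: "e (x, c) \<in> fpolys n I" if "x \<in> fpolys n B" for x c
    using that by (intro basis_vec_in_fpolys) auto
  have 1: "{e (x + x', c) \<ominus>\<^bsub>?M\<^esub> (e (x, c) \<oplus>\<^bsub>?M\<^esub> e (x', c)) | x x' c. x \<in> fpolys n B \<and> x' \<in> fpolys n B}
    = {e (x + x', c) - (e (x, c) + e (x', c)) | x x' c. x \<in> fpolys n B \<and> x' \<in> fpolys n B}"
    by (intro Collect_cong ex_cong1) (auto simp: a E)
  have 2: "{e (x, c + c') \<ominus>\<^bsub>?M\<^esub> (e (x, c) \<oplus>\<^bsub>?M\<^esub> e (x, c')) | x c c'. x \<in> fpolys n B}
    = {e (x, c + c') - (e (x, c) + e (x, c')) | x c c'. x \<in> fpolys n B}"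
    by (intro Collect_cong ex_cong1) (auto simp: a E)
  have 3: "{e (pscale r x, c) \<ominus>\<^bsub>?M\<^esub> r \<odot>\<^bsub>?M\<^esub> e (x, c) | r x c. r \<in> mpolys n \<and> x \<in> fpolys n B}
    = {e (pscale r x, c) - pscale r (e (x, c)) | r x c. r \<in> mpolys n \<and> x \<in> fpolys n B}"
    by (intro Collect_cong ex_cong1) (auto simp: b E)
  have 4: "{e (x, coef r 0 * c) \<ominus>\<^bsub>?M\<^esub> r \<odot>\<^bsub>?M\<^esub> e (x, c) | r x c. r \<in> mpolys n \<and> x \<in> fpolys n B}
    = {e (x, coef r 0 * c) - pscale r (e (x, c)) | r x c. r \<in> mpolys n \<and> x \<in> fpolys n B}"
    by (intro Collect_cong ex_cong1) (auto simp: b E)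
  show ?thesis
    by (simp only: tensor_relations_def Let_def graded_free_simps residue_field_simps carrier_mpoly_ring
        UNIV_I simp_thms 1 2 3 4)
qed

lemma null_least:
  assumes "submodule H Rn (free_module Rn I)" and "tensor_relations Rn Fr residue_field \<subseteq> H"
  shows "Nl \<subseteq> H"
  unfolding tensor_null_def submodule_gen_def graded_free_simps residue_field_simps
  using assms by blast

lemma relations_in: "tensor_relations Rn Fr residue_field \<subseteq> fpolys n I"
  unfolding relations_eq
  by (auto intro!: fpolys_diff fpolys_add fpolys_pscale basis_vec_in_fpolys)

lemma submodule_null: "submodule Nl Rn (free_module Rn I)"
proof -
  have top: "submodule (fpolys n I) Rn (free_module Rn I)"
    unfolding submodule_free_iff by (auto intro: fpolys_add fpolys_uminus fpolys_pscale)
  have eq: "Nl = \<Inter> {H. submodule H Rn (free_module Rn I) \<and> tensor_relations Rn Fr residue_field \<subseteq> H}"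
    unfolding tensor_null_def submodule_gen_def graded_free_simps residue_field_simps ..
  show ?thesis
    unfolding submodule_free_iff
  proof (intro conjI)
    show "Nl \<subseteq> fpolys n I" by (rule null_least[OF top relations_in])
  qed (unfold eq submodule_free_iff, blast+)
qed

lemma
  shows null_0: "0 \<in> Nl"
    and null_add: "\<phi> \<in> Nl \<Longrightarrow> \<psi> \<in> Nl \<Longrightarrow> \<phi> + \<psi> \<in> Nl"
    and null_uminus: "\<phi> \<in> Nl \<Longrightarrow> - \<phi> \<in> Nl"
    and null_pscale: "r \<in> mpolys n \<Longrightarrow> \<phi> \<in> Nl \<Longrightarrow> pscale r \<phi> \<in> Nl"
  using submodule_null unfolding submodule_free_iff by blast+

lemma relations_null: "tensor_relations Rn Fr residue_field \<subseteq> Nl"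
  unfolding tensor_null_def submodule_gen_def graded_free_simps residue_field_simps by blast

definition eqv :: "((nat \<Rightarrow> 'k mpoly) \<times> 'k \<Rightarrow> 'k mpoly) \<Rightarrow> ((nat \<Rightarrow> 'k mpoly) \<times> 'k \<Rightarrow> 'k mpoly) \<Rightarrow> bool" where
  "eqv \<phi> \<psi> \<longleftrightarrow> \<phi> - \<psi> \<in> Nl"

lemma eqv_refl: "eqv \<phi> \<phi>"
  using null_0 by (simp add: eqv_def)

lemma eqv_sym: "eqv \<phi> \<psi> \<Longrightarrow> eqv \<psi> \<phi>"
  using null_uminus[of "\<phi> - \<psi>"] by (simp add: eqv_def)

lemma eqv_trans: "eqv \<phi> \<psi> \<Longrightarrow> eqv \<psi> \<chi> \<Longrightarrow> eqv \<phi> \<chi>"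
  using null_add[of "\<phi> - \<psi>" "\<psi> - \<chi>"] by (simp add: eqv_def)

lemma eqv_add: "eqv \<phi> \<psi> \<Longrightarrow> eqv \<phi>' \<psi>' \<Longrightarrow> eqv (\<phi> + \<phi>') (\<psi> + \<psi>')"
  using null_add[of "\<phi> - \<psi>" "\<phi>' - \<psi>'"] by (simp only: eqv_def add_diff_add)

lemma eqv_pscale:
  assumes "r \<in> mpolys n" and "eqv \<phi> \<psi>"
  shows "eqv (pscale r \<phi>) (pscale r \<psi>)"
proof -
  have "pscale r (\<phi> - \<psi>) = pscale r \<phi> - pscale r \<psi>" by (auto simp: fun_eq_iff right_diff_distrib)
  then show ?thesis using null_pscale[OF assms(1), of "\<phi> - \<psi>"] assms(2) by (simp only: eqv_def)
qed

lemma eqv_e_add: "x \<in> fpolys n B \<Longrightarrow> x' \<in> fpolys n B \<Longrightarrow> eqv (e (x + x', c)) (e (x, c) + e (x', c))"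
  unfolding eqv_def by (rule subsetD[OF relations_null]) (unfold relations_eq, blast)

lemma eqv_e_pscale: "r \<in> mpolys n \<Longrightarrow> x \<in> fpolys n B \<Longrightarrow> eqv (e (pscale r x, c)) (pscale r (e (x, c)))"
  unfolding eqv_def by (rule subsetD[OF relations_null]) (unfold relations_eq, blast)

lemma eqv_e_coef: "r \<in> mpolys n \<Longrightarrow> x \<in> fpolys n B \<Longrightarrow> eqv (e (x, coef r 0 * c)) (pscale r (e (x, c)))"
  unfolding eqv_def by (rule subsetD[OF relations_null]) (unfold relations_eq, blast)

lemma eqv_e_const:
  assumes "x \<in> fpolys n B"
  shows "eqv (e (x, c)) (e (pscale (mconst c) x, 1))"
  using eqv_trans[OF eqv_e_coef[OF mpolys_const assms, of c 1] eqv_sym[OF eqv_e_pscale[OF mpolys_const assms, of c 1]]]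
  by simp

lemma eqv_e_0: "eqv 0 (e (0, 1))"
proof -
  have z: "pscale 0 u = 0" for u :: "'i \<Rightarrow> 'k mpoly" by (auto simp: fun_eq_iff)
  show ?thesis using eqv_sym[OF eqv_e_pscale[OF mpolys_0 fpolys_0, of 1]] unfolding z .
qed

text \<open>A scalar in the right factor moves to the left one, and pure tensors with the same right
  factor add up; so every tensor is of the form \<open>x \<otimes> 1\<close>.\<close>

lemma eqv_e_exists:
  assumes "\<phi> \<in> fpolys n I"
  shows "\<exists>x\<in>fpolys n B. eqv \<phi> (e (x, 1))"
proof -
  have "finite {p. \<phi> p \<noteq> 0}" using assms by (simp add: fpolys_def)
  then show ?thesis using assms
  proof (induction "{p. \<phi> p \<noteq> 0}" arbitrary: \<phi> rule: finite_induct)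
    case empty
    then have "\<phi> = 0" by (auto simp: fun_eq_iff)
    then show ?case by (intro bexI[of _ 0]) (simp_all only: eqv_e_0 fpolys_0)
  next
    case (insert p S)
    define \<phi>' where "\<phi>' = \<phi>(p := 0)"
    have S: "S = {q. \<phi>' q \<noteq> 0}" using insert.hyps by (auto simp: \<phi>'_def)
    have "\<phi>' \<in> fpolys n I"
      using insert.prems insert.hyps(1) S by (auto simp: fpolys_def \<phi>'_def)
    then obtain x where x: "x \<in> fpolys n B" "eqv \<phi>' (e (x, 1))" using insert.hyps(3)[OF S] by blast
    obtain y c where p: "p = (y, c)" by (cases p)
    have "p \<in> I" using insert.prems insert.hyps(4) unfolding fpolys_def by blast
    then have y: "y \<in> fpolys n B" using p by simp
    have f: "\<phi> p \<in> mpolys n" using insert.prems unfolding fpolys_def by blast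
    define z where "z = pscale (\<phi> p) (pscale (mconst c) y)"
    have cy: "pscale (mconst c) y \<in> fpolys n B" using y by (intro fpolys_pscale) auto
    have z: "z \<in> fpolys n B" unfolding z_def by (intro fpolys_pscale f cy)
    have "eqv (pscale (\<phi> p) (e p)) (pscale (\<phi> p) (e (pscale (mconst c) y, 1)))"
      unfolding p by (intro eqv_pscale eqv_e_const y) (use f p in simp)
    then have "eqv (pscale (\<phi> p) (e p)) (e (z, 1))"
      unfolding z_def by (rule eqv_trans[OF _ eqv_sym[OF eqv_e_pscale[OF f cy]]])
    then have "eqv (pscale (\<phi> p) (e p) + \<phi>') (e (z, 1) + e (x, 1))" using x(2) by (rule eqv_add)
    moreover have "pscale (\<phi> p) (e p) + \<phi>' = \<phi>"
      by (auto simp: fun_eq_iff basis_vec_mpoly \<phi>'_def)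
    ultimately have "eqv \<phi> (e (z + x, 1))" using eqv_trans[OF _ eqv_sym[OF eqv_e_add[OF z x(1), of 1]]] by simp
    then show ?case using fpolys_add[OF z x(1)] by blast
  qed
qed

text \<open>The functional \<open>x \<otimes> c \<mapsto> x\<^sub>b(0) c\<close> on formal linear combinations of pairs\<close>

definition contract_at :: "nat \<Rightarrow> ((nat \<Rightarrow> 'k mpoly) \<times> 'k \<Rightarrow> 'k mpoly) \<Rightarrow> 'k" where
  "contract_at b \<phi> = (\<Sum>p\<in>{p. \<phi> p \<noteq> 0}. coef (\<phi> p) 0 * (coef (fst p b) 0 * snd p))"

lemma contract_at_superset:
  "finite P \<Longrightarrow> {p. \<phi> p \<noteq> 0} \<subseteq> P \<Longrightarrow> contract_at b \<phi> = (\<Sum>p\<in>P. coef (\<phi> p) 0 * (coef (fst p b) 0 * snd p))"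
  unfolding contract_at_def by (intro sum.mono_neutral_left) auto

lemma contract_at_e: "contract_at b (e (x, c)) = coef (x b) 0 * c"
  using contract_at_superset[of "{(x, c)}" "e (x, c)" b] by (auto simp: basis_vec_mpoly)

lemma contract_at_diff:
  assumes "finite {p. \<phi> p \<noteq> 0}" and "finite {p. \<psi> p \<noteq> 0}"
  shows "contract_at b (\<phi> - \<psi>) = contract_at b \<phi> - contract_at b \<psi>"
proof -
  let ?P = "{p. \<phi> p \<noteq> 0} \<union> {p. \<psi> p \<noteq> 0}"
  have P: "finite ?P" "{p. (\<phi> - \<psi>) p \<noteq> 0} \<subseteq> ?P" "{p. \<phi> p \<noteq> 0} \<subseteq> ?P" "{p. \<psi> p \<noteq> 0} \<subseteq> ?P"
    using assms by auto
  show ?thesis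
    unfolding contract_at_superset[OF P(1,2)] contract_at_superset[OF P(1,3)] contract_at_superset[OF P(1,4)]
    by (simp add: lookup_minus left_diff_distrib sum_subtractf)
qed

lemma contract_at_pscale:
  assumes "finite {p. \<phi> p \<noteq> 0}"
  shows "contract_at b (pscale r \<phi>) = coef r 0 * contract_at b \<phi>"
  using contract_at_superset[OF assms, of "pscale r \<phi>" b] contract_at_superset[OF assms, of \<phi> b]
  by (auto simp: coef_0_mult sum_distrib_left mult.assoc)

text \<open>The combinations on which \<open>contract_at b\<close> vanishes form a submodule
  containing all bilinearity relations. Thus the functional descends to the tensor product and can
  detect nonzero tensors.\<close>

lemma null_contract_at:
  assumes "\<phi> \<in> Nl"
  shows "contract_at b \<phi> = 0"
proof -
  let ?H = "{\<phi> \<in> fpolys n I. contract_at b \<phi> = 0}"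
  have fin: "finite {p. \<phi> p \<noteq> 0}" if "\<phi> \<in> fpolys n I" for \<phi> :: "(nat \<Rightarrow> 'k mpoly) \<times> 'k \<Rightarrow> 'k mpoly"
    using that by (simp add: fpolys_def)
  have v0: "contract_at b 0 = 0" by (simp add: contract_at_def)
  have vd: "contract_at b (\<phi> - \<psi>) = contract_at b \<phi> - contract_at b \<psi>" if "\<phi> \<in> fpolys n I" "\<psi> \<in> fpolys n I" for \<phi> \<psi>
    using contract_at_diff fin that by blast
  have vm: "contract_at b (- \<phi>) = - contract_at b \<phi>" if "\<phi> \<in> fpolys n I" for \<phi>
    using vd[OF fpolys_0 that] v0 by simp
  have va: "contract_at b (\<phi> + \<psi>) = contract_at b \<phi> + contract_at b \<psi>" if "\<phi> \<in> fpolys n I" "\<psi> \<in> fpolys n I" for \<phi> \<psi>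
    using vd[OF that(1) fpolys_uminus[OF that(2)]] vm[OF that(2)] by simp
  have vs: "contract_at b (pscale r \<phi>) = coef r 0 * contract_at b \<phi>" if "\<phi> \<in> fpolys n I" for r \<phi>
    using contract_at_pscale fin that by blast
  have "submodule ?H Rn (free_module Rn I)"
    unfolding submodule_free_iff using va vm vs v0 by (auto intro: fpolys_add fpolys_uminus fpolys_pscale)
  moreover have "tensor_relations Rn Fr residue_field \<subseteq> ?H"
  proof
    fix \<rho> assume r: "\<rho> \<in> tensor_relations Rn Fr residue_field"
    then have 1: "\<rho> \<in> fpolys n I" using relations_in by blast
    have E: "e (x, c) \<in> fpolys n I" if "x \<in> fpolys n B" for x c
      using that by (intro basis_vec_in_fpolys) auto
    have "contract_at b \<rho> = 0"
      using r unfolding relations_eq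
    proof (elim UnE CollectE exE conjE)
      fix x x' c assume "\<rho> = e (x + x', c) - (e (x, c) + e (x', c))" "x \<in> fpolys n B" "x' \<in> fpolys n B"
      then show ?thesis
        using vd[OF E fpolys_add[OF E E]] va[OF E E]
        by (simp only: contract_at_e fpolys_add) (simp add: lookup_add distrib_right)
    next
      fix x c c' assume "\<rho> = e (x, c + c') - (e (x, c) + e (x, c'))" "x \<in> fpolys n B"
      then show ?thesis
        using vd[OF E fpolys_add[OF E E]] va[OF E E]
        by (simp only: contract_at_e) (simp add: distrib_left)
    next
      fix r x c assume "\<rho> = e (pscale r x, c) - pscale r (e (x, c))" "r \<in> mpolys n" "x \<in> fpolys n B"
      then show ?thesis
        using vd[OF E fpolys_pscale[OF _ E]] vs[OF E]
        by (simp only: contract_at_e fpolys_pscale) (simp add: coef_0_mult)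
    next
      fix r x c assume "\<rho> = e (x, coef r 0 * c) - pscale r (e (x, c))" "r \<in> mpolys n" "x \<in> fpolys n B"
      then show ?thesis
        using vd[OF E fpolys_pscale[OF _ E]] vs[OF E]
        by (simp only: contract_at_e) (simp add: mult.left_commute)
    qed
    then show "\<rho> \<in> ?H" using 1 by blast
  qed
  ultimately have "Nl \<subseteq> ?H" by (rule null_least)
  then show ?thesis using assms by blast
qed

text \<open>The functionals \<open>contract_at b\<close> give one direction. For the other, a family
  without constant terms is a combination of variables, each of which moves to the right factor and
  acts there as zero.\<close>

lemma e_null_iff:
  assumes "x \<in> fpolys n B"
  shows "e (x, 1) \<in> Nl \<longleftrightarrow> (\<forall>b. coef (x b) 0 = 0)"
proof
  show "\<forall>b. coef (x b) 0 = 0" if "e (x, 1) \<in> Nl"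
    using null_contract_at[OF that] by (simp add: contract_at_e)
next
  assume "\<forall>b. coef (x b) 0 = 0"
  then obtain y where y: "\<And>v. y v \<in> fpolys n B" "x = (\<Sum>v<n. pscale (mvar v) (y v))"
    using const_free_decomp_fpolys[OF assms] by blast
  have null: "eqv (e (z, 0)) 0" if z: "z \<in> fpolys n B" for z
    using eqv_e_coef[OF mpolys_0 z, of 1] by (simp add: pscale_def zero_fun_def)
  have t: "eqv (e (pscale (mvar v) (y v), 1)) 0" if "v < n" for v
  proof -
    have "eqv (e (y v, 0)) (pscale (mvar v) (e (y v, 1)))"
      using eqv_e_coef[OF mpolys_var[OF that] y(1), of v 1] by (simp add: coef_mvar_0)
    from eqv_trans[OF eqv_sym[OF this] null[OF y(1)]] show ?thesis
      by (rule eqv_trans[OF eqv_e_pscale[OF mpolys_var[OF that] y(1)]])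
  qed
  have "eqv (e (\<Sum>v\<in>J. pscale (mvar v) (y v), 1)) 0 \<and> (\<Sum>v\<in>J. pscale (mvar v) (y v)) \<in> fpolys n B"
    if "finite J" "J \<subseteq> {..<n}" for J
    using that
  proof (induction J)
    case empty
    show ?case unfolding sum.empty by (intro conjI eqv_sym[OF eqv_e_0] fpolys_0)
  next
    case (insert v J)
    then have 1: "eqv (e (\<Sum>v\<in>J. pscale (mvar v) (y v), 1)) 0" "(\<Sum>v\<in>J. pscale (mvar v) (y v)) \<in> fpolys n B"
      by blast+
    have 2: "pscale (mvar v) (y v) \<in> fpolys n B" using insert.prems y(1) by (intro fpolys_pscale mpolys_var) auto
    have "eqv (e (pscale (mvar v) (y v), 1) + e (\<Sum>v\<in>J. pscale (mvar v) (y v), 1)) (0 + 0)"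
      using insert.prems 1(1) t by (intro eqv_add) auto
    then have "eqv (e (pscale (mvar v) (y v) + (\<Sum>v\<in>J. pscale (mvar v) (y v)), 1)) 0"
      using eqv_trans[OF eqv_e_add[OF 2 1(2), of 1]] by simp
    then show ?case unfolding sum.insert[OF insert.hyps] using fpolys_add[OF 2 1(2)] by blast
  qed
  from this[of "{..<n}"] have "eqv (e (x, 1)) 0" using y(2) by simp
  then show "e (x, 1) \<in> Nl" by (simp add: eqv_def)
qed

end

section \<open>The tensor product described by the elements \<open>x \<otimes> 1\<close>\<close>

context residue_tensor
begin

definition coset :: "((nat \<Rightarrow> 'k mpoly) \<times> 'k \<Rightarrow> 'k mpoly) \<Rightarrow> ((nat \<Rightarrow> 'k mpoly) \<times> 'k \<Rightarrow> 'k mpoly) set" where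
  "coset \<phi> = (\<lambda>h. h + \<phi>) ` Nl"

definition pure1 :: "(nat \<Rightarrow> 'k mpoly) \<Rightarrow> ((nat \<Rightarrow> 'k mpoly) \<times> 'k \<Rightarrow> 'k mpoly) set" where
  "pure1 x = coset (e (x, 1))"

lemma r_coset_eq: "Nl +>\<^bsub>free_module Rn I\<^esub> \<phi> = coset \<phi>"
  by (auto simp: a_r_coset_def' coset_def free_module_simps)

lemma mem_coset: "\<psi> \<in> coset \<phi> \<longleftrightarrow> eqv \<psi> \<phi>"
proof
  assume "eqv \<psi> \<phi>"
  then have "\<psi> - \<phi> \<in> Nl" "\<psi> = (\<psi> - \<phi>) + \<phi>" by (auto simp: eqv_def)
  then show "\<psi> \<in> coset \<phi>" unfolding coset_def by blast
qed (auto simp: coset_def eqv_def)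

lemma coset_eq_iff: "coset \<phi> = coset \<psi> \<longleftrightarrow> eqv \<phi> \<psi>"
  using mem_coset eqv_refl eqv_sym eqv_trans by blast

lemma e_in: "x \<in> fpolys n B \<Longrightarrow> e (x, c) \<in> fpolys n I"
  by (intro basis_vec_in_fpolys) auto

lemma coset_pure1: "\<phi> \<in> fpolys n I \<Longrightarrow> \<exists>x\<in>fpolys n B. coset \<phi> = pure1 x"
  using eqv_e_exists by (simp add: pure1_def coset_eq_iff)

lemma pure1_eq_iff:
  assumes "x \<in> fpolys n B" and "y \<in> fpolys n B"
  shows "pure1 x = pure1 y \<longleftrightarrow> (\<forall>b. coef ((x - y) b) 0 = 0)"
proof -
  have xy: "x - y \<in> fpolys n B" using assms by (rule fpolys_diff)
  have "eqv (e (x, 1)) (e (x - y, 1) + e (y, 1))"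
    using eqv_e_add[OF xy assms(2), of 1] by simp
  then have 1: "eqv (e (x, 1) - e (y, 1)) (e (x - y, 1))"
    by (simp add: eqv_def algebra_simps)
  have "pure1 x = pure1 y \<longleftrightarrow> eqv (e (x, 1) - e (y, 1)) 0"
    unfolding pure1_def coset_eq_iff eqv_def by simp
  also have "\<dots> \<longleftrightarrow> eqv (e (x - y, 1)) 0" using 1 eqv_sym eqv_trans by blast
  also have "\<dots> \<longleftrightarrow> (\<forall>b. coef ((x - y) b) 0 = 0)"
    using e_null_iff[OF xy] by (simp add: eqv_def)
  finally show ?thesis .
qed

lemma tensor_simps:
  "carrier Tn = coset ` fpolys n I"
  "\<zero>\<^bsub>Tn\<^esub> = Nl"
  "P \<oplus>\<^bsub>Tn\<^esub> Q = P <+>\<^bsub>free_module Rn I\<^esub> Q"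
  "r \<odot>\<^bsub>Tn\<^esub> P = (\<Union>\<phi>\<in>P. coset (pscale r \<phi>))"
  by (auto simp: tensor_def with_grading_def module.extend_def graded_module.fields_def Let_def
      quotient_module_def graded_free_simps residue_field_simps A_RCOSETS_def' r_coset_eq free_module_simps)

lemma carrier_tensor: "carrier Tn = pure1 ` fpolys n B"
proof
  show "carrier Tn \<subseteq> pure1 ` fpolys n B" unfolding tensor_simps using coset_pure1 by blast
  show "pure1 ` fpolys n B \<subseteq> carrier Tn" unfolding tensor_simps pure1_def using e_in by blast
qed

lemma zero_tensor: "\<zero>\<^bsub>Tn\<^esub> = pure1 0"
proof -
  have "coset 0 = Nl" by (auto simp: coset_def)
  then show ?thesis unfolding tensor_simps pure1_def using eqv_e_0 coset_eq_iff by metis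
qed

lemma add_tensor:
  assumes "x \<in> fpolys n B" and "y \<in> fpolys n B"
  shows "pure1 x \<oplus>\<^bsub>Tn\<^esub> pure1 y = pure1 (x + y)"
proof -
  have sum: "coset \<phi> <+>\<^bsub>free_module Rn I\<^esub> coset \<psi> = coset (\<phi> + \<psi>)" for \<phi> \<psi>
  proof (rule Set.set_eqI)
    fix \<chi>
    show "\<chi> \<in> coset \<phi> <+>\<^bsub>free_module Rn I\<^esub> coset \<psi> \<longleftrightarrow> \<chi> \<in> coset (\<phi> + \<psi>)"
    proof
      assume "\<chi> \<in> coset \<phi> <+>\<^bsub>free_module Rn I\<^esub> coset \<psi>"
      then obtain a b where "eqv a \<phi>" "eqv b \<psi>" "\<chi> = a + b"
        unfolding set_add_def' free_module_simps by (auto simp: mem_coset)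
      then show "\<chi> \<in> coset (\<phi> + \<psi>)" unfolding mem_coset by (simp only: eqv_add)
    next
      assume "\<chi> \<in> coset (\<phi> + \<psi>)"
      then have "eqv (\<chi> - \<psi>) \<phi>" by (simp add: mem_coset eqv_def algebra_simps)
      moreover have "\<chi> = (\<chi> - \<psi>) + \<psi>" by simp
      ultimately show "\<chi> \<in> coset \<phi> <+>\<^bsub>free_module Rn I\<^esub> coset \<psi>"
        unfolding set_add_def' free_module_simps using mem_coset eqv_refl by blast
    qed
  qed
  show ?thesis
    unfolding tensor_simps pure1_def sum coset_eq_iff by (rule eqv_sym[OF eqv_e_add[OF assms]])
qed

lemma smult_tensor:
  assumes "r \<in> mpolys n" and "x \<in> fpolys n B"
  shows "r \<odot>\<^bsub>Tn\<^esub> pure1 x = pure1 (pscale r x)"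
proof -
  have "coset (pscale r \<phi>) = coset (pscale r (e (x, 1)))" if "\<phi> \<in> pure1 x" for \<phi>
    using that eqv_pscale[OF assms(1)] by (simp add: pure1_def mem_coset coset_eq_iff)
  moreover have "e (x, 1) \<in> pure1 x" by (simp add: pure1_def mem_coset eqv_refl)
  ultimately have "(\<Union>\<phi>\<in>pure1 x. coset (pscale r \<phi>)) = coset (pscale r (e (x, 1)))" by blast
  also have "\<dots> = pure1 (pscale r x)"
    unfolding pure1_def coset_eq_iff by (rule eqv_sym[OF eqv_e_pscale[OF assms]])
  finally show ?thesis unfolding tensor_simps .
qed

lemma pure_tensor_eq:
  assumes "x \<in> fpolys n B"
  shows "pure_tensor Rn Fr residue_field x c = pure1 (pscale (mconst c) x)"
  unfolding pure_tensor_def graded_free_simps residue_field_simps r_coset_eq pure1_def coset_eq_iff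
  by (rule eqv_e_const[OF assms])

text \<open>The homogeneous parts are generated as groups, so inverses occur in
  \<open>generate\<close>; no group structure on the record is available, and the inverse is
  determined from its definition by \<open>THE\<close>.\<close>

lemma inv_tensor:
  assumes "x \<in> fpolys n B"
  shows "inv\<^bsub>add_monoid Tn\<^esub> pure1 x = pure1 (- x)"
  unfolding m_inv_def
proof (rule the_equality)
  have m: "- x \<in> fpolys n B" using assms by (rule fpolys_uminus)
  show "pure1 (- x) \<in> carrier (add_monoid Tn) \<and> pure1 x \<otimes>\<^bsub>add_monoid Tn\<^esub> pure1 (- x) = \<one>\<^bsub>add_monoid Tn\<^esub> \<and>
      pure1 (- x) \<otimes>\<^bsub>add_monoid Tn\<^esub> pure1 x = \<one>\<^bsub>add_monoid Tn\<^esub>"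
    using add_tensor[OF assms m] add_tensor[OF m assms] m by (simp add: carrier_tensor zero_tensor)
  fix P
  assume P: "P \<in> carrier (add_monoid Tn) \<and> pure1 x \<otimes>\<^bsub>add_monoid Tn\<^esub> P = \<one>\<^bsub>add_monoid Tn\<^esub> \<and>
      P \<otimes>\<^bsub>add_monoid Tn\<^esub> pure1 x = \<one>\<^bsub>add_monoid Tn\<^esub>"
  then obtain y where y: "y \<in> fpolys n B" "P = pure1 y" by (auto simp: carrier_tensor)
  have "pure1 (x + y) = pure1 0" using P add_tensor[OF assms y(1)] by (simp add: y(2) zero_tensor)
  then have "\<forall>b. coef ((x + y - 0) b) 0 = 0"
    using pure1_eq_iff[OF fpolys_add[OF assms y(1)] fpolys_0] by blast
  then have "\<forall>b. coef ((y - (- x)) b) 0 = 0" by (simp add: add.commute)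
  then show "P = pure1 (- x)" unfolding y(2) using pure1_eq_iff[OF y(1) m] by blast
qed

text \<open>A homogeneous generator \<open>x \<otimes> c\<close> is zero unless \<open>c\<close> has
  degree \<open>0\<close>, in which case \<open>c\<close> is absorbed into \<open>x\<close>. The
  generators already form a group.\<close>

lemma hom_part_tensor: "hom_part Tn j = pure1 ` fgr n B g j"
proof -
  let ?Q = "quotient_module (free_module Rn I) Nl"
  let ?G = "{pure_tensor Rn Fr residue_field x y | x y a b.
    x \<in> hom_part Fr a \<and> y \<in> hom_part residue_field b \<and> a + b = j}"
  have same: "carrier ?Q = carrier Tn" "add ?Q = add Tn" "\<zero>\<^bsub>?Q\<^esub> = \<zero>\<^bsub>Tn\<^esub>"
    by (simp_all add: tensor_def with_grading_def module.extend_def Let_def graded_free_simps residue_field_simps)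
  have inv_same: "inv\<^bsub>add_monoid ?Q\<^esub> P = inv\<^bsub>add_monoid Tn\<^esub> P" for P
    by (simp add: m_inv_def same)
  have h: "hom_part Tn j = generate (add_monoid ?Q) ?G"
    by (simp add: tensor_def with_grading_def module.extend_def graded_module.fields_def Let_def
        graded_free_simps residue_field_simps)
  have fgrF: "x \<in> fpolys n B" if "x \<in> fgr n B g a" for x a using that by (simp add: fgr_def)
  have G: "P \<in> pure1 ` fgr n B g j" if PG: "P \<in> ?G" for P
  proof -
    obtain x c a b where x: "P = pure_tensor Rn Fr residue_field x c" "x \<in> fgr n B g a"
      "c \<in> hom_part residue_field b" "a + b = j" using PG by (auto simp: graded_free_simps)
    have P: "P = pure1 (pscale (mconst c) x)" unfolding x(1) by (rule pure_tensor_eq[OF fgrF[OF x(2)]])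
    show ?thesis
    proof (cases "b = 0")
      case True
      then show ?thesis unfolding P using x(2,4) by (intro imageI fgr_const) simp
    next
      case False
      then have "c = 0" using x(3) by (simp add: residue_field_simps)
      then have "pscale (mconst c) x = 0" by (simp add: fun_eq_iff)
      then show ?thesis unfolding P by (metis fgr_0 imageI)
    qed
  qed
  show ?thesis
  proof
    show "pure1 ` fgr n B g j \<subseteq> hom_part Tn j"
    proof
      fix P assume "P \<in> pure1 ` fgr n B g j"
      then obtain x where x: "x \<in> fgr n B g j" "P = pure1 x" by blast
      have "pscale (mconst 1) x = x" by (simp add: fun_eq_iff)
      then have "P = pure_tensor Rn Fr residue_field x 1"
        using pure_tensor_eq[OF fgrF[OF x(1)], of 1] x(2) by metis
      then have "P \<in> ?G"
        using x(1) by (intro CollectI exI[of _ x] exI[of _ 1] exI[of _ j] exI[of _ 0])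
          (simp add: graded_free_simps residue_field_simps)
      then show "P \<in> hom_part Tn j" unfolding h by (rule generate.incl)
    qed
    show "hom_part Tn j \<subseteq> pure1 ` fgr n B g j"
    proof
      fix P assume "P \<in> hom_part Tn j"
      then have "P \<in> generate (add_monoid ?Q) ?G" unfolding h .
      then show "P \<in> pure1 ` fgr n B g j"
      proof (induction rule: generate.induct)
        case one
        show ?case using imageI[OF fgr_0, of pure1] by (simp add: same zero_tensor)
      next
        case (incl P)
        then show ?case by (rule G)
      next
        case (inv P)
        then obtain x where "x \<in> fgr n B g j" "P = pure1 x" using G by blast
        then show ?case unfolding inv_same using inv_tensor[OF fgrF] fgr_uminus by (metis imageI)
      next
        case (eng P Q)
        then obtain x y where xy: "x \<in> fgr n B g j" "P = pure1 x" "y \<in> fgr n B g j" "Q = pure1 y" by blast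
        have "pure1 x \<oplus>\<^bsub>Tn\<^esub> pure1 y = pure1 (x + y)"
          by (rule add_tensor[OF fgrF[OF xy(1)] fgrF[OF xy(3)]])
        then show ?case using fgr_add[OF xy(1,3)] by (simp add: same xy(2,4))
      qed
    qed
  qed
qed

end

text \<open>As \<open>tensor_map\<close> is defined by \<open>THE\<close>, existence and uniqueness
  are due. The map is defined through representatives, independently of their choice because
  \<open>f\<close> preserves families without constant terms; it is unique because every tensor is
  pure and the map is extensional.\<close>

lemma tensor_map_pure1:
  fixes f :: "(nat \<Rightarrow> 'k::field mpoly) \<Rightarrow> nat \<Rightarrow> 'k mpoly"
  assumes f: "\<And>x. x \<in> fpolys n B \<Longrightarrow> f x \<in> fpolys n B'"
    and add: "\<And>x y. x \<in> fpolys n B \<Longrightarrow> y \<in> fpolys n B \<Longrightarrow> f (x + y) = f x + f y"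
    and scale: "\<And>r x. r \<in> mpolys n \<Longrightarrow> x \<in> fpolys n B \<Longrightarrow> f (pscale r x) = pscale r (f x)"
    and x: "x \<in> fpolys n B"
  shows "tensor_map (mpoly_ring n) (graded_free n B g) (graded_free n B' g') residue_field f
      (residue_tensor.pure1 n B g x) = residue_tensor.pure1 n B' g' (f x)"
proof -
  interpret a: residue_tensor n B g "TYPE('k)" .
  interpret b: residue_tensor n B' g' "TYPE('k)" .
  have const_free: "\<forall>b. coef (f z b) 0 = 0" if z: "z \<in> fpolys n B" "\<forall>b. coef (z b) 0 = 0" for z
  proof -
    obtain c where c: "\<And>v. c v \<in> fpolys n B" "z = (\<Sum>v<n. pscale (mvar v) (c v))"
      using const_free_decomp_fpolys[OF z(1)] z(2) by blast
    have f0: "f 0 = 0" using add[OF fpolys_0 fpolys_0] by simp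
    have "(\<Sum>v\<in>J. pscale (mvar v) (c v)) \<in> fpolys n B \<and> (\<forall>b. coef (f (\<Sum>v\<in>J. pscale (mvar v) (c v)) b) 0 = 0)"
      if "finite J" "J \<subseteq> {..<n}" for J
      using that
    proof (induction J)
      case empty
      show ?case unfolding sum.empty f0 by (intro conjI fpolys_0) simp
    next
      case (insert v J)
      have 1: "(\<Sum>v\<in>J. pscale (mvar v) (c v)) \<in> fpolys n B"
        "\<forall>b. coef (f (\<Sum>v\<in>J. pscale (mvar v) (c v)) b) 0 = 0"
        using insert.IH insert.prems by blast+
      have v: "mvar v \<in> mpolys n" using insert.prems by (intro mpolys_var) auto
      have 2: "pscale (mvar v) (c v) \<in> fpolys n B" by (rule fpolys_pscale[OF v c(1)])
      show ?case
        unfolding sum.insert[OF insert.hyps] add[OF 2 1(1)] scale[OF v c(1)]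
        by (intro conjI fpolys_add[OF 2 1(1)]) (use 1(2) in \<open>simp add: lookup_add coef_0_mult coef_mvar_0\<close>)
    qed
    from this[of "{..<n}"] show ?thesis using c(2) by simp
  qed
  have fdiff: "f (u - v) = f u - f v" if "u \<in> fpolys n B" "v \<in> fpolys n B" for u v
    using add[OF fpolys_diff[OF that] that(2)] by simp
  have wd: "b.pure1 (f u) = b.pure1 (f v)" if "u \<in> fpolys n B" "v \<in> fpolys n B" "a.pure1 u = a.pure1 v" for u v
    using const_free[OF fpolys_diff[OF that(1,2)]] that a.pure1_eq_iff[OF that(1,2)]
      b.pure1_eq_iff[OF f[OF that(1)] f[OF that(2)]] fdiff[OF that(1,2)] by simp
  define h where "h = restrict (\<lambda>P. b.pure1 (f (SOME u. u \<in> fpolys n B \<and> a.pure1 u = P))) (carrier a.Tn)"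
  have h: "h (a.pure1 u) = b.pure1 (f u)" if u: "u \<in> fpolys n B" for u
  proof -
    define w where "w = (SOME v. v \<in> fpolys n B \<and> a.pure1 v = a.pure1 u)"
    have w: "w \<in> fpolys n B \<and> a.pure1 w = a.pure1 u"
      unfolding w_def by (rule someI[of _ u]) (use u in simp)
    have "a.pure1 u \<in> carrier a.Tn" unfolding a.carrier_tensor using u by (rule imageI)
    then have "h (a.pure1 u) = b.pure1 (f w)" by (simp add: h_def w_def)
    then show ?thesis using wd[of w u] w u by simp
  qed
  let ?P = "\<lambda>h. h \<in> module_homs (mpoly_ring n) a.Tn b.Tn \<and> h \<in> extensional (carrier a.Tn) \<and>
        (\<forall>x\<in>carrier a.Fr. \<forall>y\<in>carrier residue_field.
          h (pure_tensor (mpoly_ring n) a.Fr residue_field x y) = pure_tensor (mpoly_ring n) b.Fr residue_field (f x) y)"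
  have "(THE h. ?P h) = h"
  proof (rule the_equality)
    have "h \<in> module_homs (mpoly_ring n) a.Tn b.Tn"
      unfolding module_homs_def a.carrier_tensor b.carrier_tensor carrier_mpoly_ring
      using h f by (auto simp: a.add_tensor b.add_tensor a.smult_tensor b.smult_tensor fpolys_add fpolys_pscale add scale)
    moreover have "h \<in> extensional (carrier a.Tn)" by (simp add: h_def)
    moreover have "h (pure_tensor (mpoly_ring n) a.Fr residue_field u c)
        = pure_tensor (mpoly_ring n) b.Fr residue_field (f u) c" if u: "u \<in> fpolys n B" for u c
      unfolding a.pure_tensor_eq[OF u] b.pure_tensor_eq[OF f[OF u]] h[OF fpolys_pscale[OF mpolys_const u]]
        scale[OF mpolys_const u] ..
    ultimately show "?P h" by (simp add: graded_free_simps)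
  next
    fix h' assume h': "?P h'"
    show "h' = h"
    proof (rule extensionalityI)
      show "h' \<in> extensional (carrier a.Tn)" using h' by blast
      show "h \<in> extensional (carrier a.Tn)" by (simp add: h_def)
      fix P assume "P \<in> carrier a.Tn"
      then obtain u where u: "u \<in> fpolys n B" "P = a.pure1 u" by (auto simp: a.carrier_tensor)
      have 1: "pscale (mconst 1) v = v" for v :: "nat \<Rightarrow> 'k mpoly" by (simp add: fun_eq_iff)
      have "h' (pure_tensor (mpoly_ring n) a.Fr residue_field u 1)
          = pure_tensor (mpoly_ring n) b.Fr residue_field (f u) 1"
        using h' u(1) by (simp add: graded_free_simps residue_field_simps)
      then show "h' P = h P"
        unfolding a.pure_tensor_eq[OF u(1)] b.pure_tensor_eq[OF f[OF u(1)]] 1 u(2) h[OF u(1)] .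
    qed
  qed
  then show ?thesis unfolding tensor_map_def using h[OF x] by simp
qed

section \<open>Tor in the linear degree as a space of Koszul cycles\<close>

context linear_strand
begin

abbreviation Ten where "Ten l \<equiv> tensor (mpoly_ring n) (graded_free n (B l) (gs l)) (residue_field :: ('k mpoly, 'k) graded_module)"
abbreviation pure_at where "pure_at l \<equiv> residue_tensor.pure1 n (B l) (gs l)"
abbreviation tmap where "tmap l \<equiv> tensor_map (mpoly_ring n) (graded_free n (B (Suc l)) (gs (Suc l)))
    (graded_free n (B l) (gs l)) (residue_field :: ('k mpoly, 'k) graded_module) (\<delta> l)"

lemma tmap_pure: "x \<in> fpolys n (B (Suc l)) \<Longrightarrow> tmap l (pure_at (Suc l) x) = pure_at l (\<delta> l x)"
  by (rule tensor_map_pure1) (auto intro: d_in d_add d_scale)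

lemma pure_at_eq_iff:
  "x \<in> fpolys n (B l) \<Longrightarrow> y \<in> fpolys n (B l) \<Longrightarrow> pure_at l x = pure_at l y \<longleftrightarrow> (\<forall>b. coef ((x - y) b) 0 = 0)"
  by (rule residue_tensor.pure1_eq_iff)

lemma vdim_tensor_homology:
  "vdim (ring_of_type_algebra :: 'k ring)
     (hom_component (tensor_homology n (\<lambda>l. graded_free n (B l) (gs l)) \<delta> residue_field i) (int i + d))
   = fam.dim (cycles i)"
proof -
  interpret t: residue_tensor n "B i" "gs i" "TYPE('k)" .
  define Z where "Z = (case i of 0 \<Rightarrow> carrier (Ten 0) | Suc l \<Rightarrow> {z \<in> carrier (Ten (Suc l)). tmap l z = \<zero>\<^bsub>Ten l\<^esub>})"
  define Bd where "Bd = tmap i ` carrier (Ten (Suc i))"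
  define S where "S = graded_sub (Ten i) Z"
  define V where "V = hom_component (tensor_homology n (\<lambda>l. graded_free n (B l) (gs l)) \<delta> residue_field i) (int i + d)"
  \<comment> \<open>\<open>\<psi> w\<close> is the homology class of \<open>w \<otimes> 1\<close>,
    spelled out as a set: the quotient consists of cosets whose elements are themselves cosets in
    the tensor product.\<close>
  define \<psi> where "\<psi> w = (\<lambda>v. pure_at i (\<delta> i v + w)) ` fpolys n (B (Suc i))" for w
  have addS: "P \<oplus>\<^bsub>S\<^esub> Q = P \<oplus>\<^bsub>Ten i\<^esub> Q" and smS: "f \<odot>\<^bsub>S\<^esub> P = f \<odot>\<^bsub>Ten i\<^esub> P" for P Q f
    by (simp_all add: S_def graded_sub_def)
  have V: "carrier V = (\<lambda>P. Bd +>\<^bsub>S\<^esub> P) ` (hom_part (Ten i) (int i + d) \<inter> Z)"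
    "\<zero>\<^bsub>V\<^esub> = Bd" "P \<oplus>\<^bsub>V\<^esub> Q = P <+>\<^bsub>S\<^esub> Q" "c \<odot>\<^bsub>V\<^esub> P = (\<Union>x\<in>P. Bd +>\<^bsub>S\<^esub> (mconst c \<odot>\<^bsub>S\<^esub> x))" for P Q c
    by (simp_all add: V_def hom_component_def tensor_homology_def Let_def graded_quotient_def
        quotient_module_def with_grading_def module.extend_def graded_module.fields_def
        Z_def[symmetric] Bd_def[symmetric] S_def[symmetric])
      (simp_all add: S_def graded_sub_def)
  have Bd: "Bd = (\<lambda>v. pure_at i (\<delta> i v)) ` fpolys n (B (Suc i))"
    unfolding Bd_def residue_tensor.carrier_tensor image_image by (rule image_cong) (auto simp: tmap_pure)
  have coset: "Bd +>\<^bsub>S\<^esub> pure_at i w = \<psi> w" if "w \<in> fpolys n (B i)" for w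
    unfolding a_r_coset_def' Bd \<psi>_def addS using t.add_tensor[OF d_in that] by auto
  have cyc: "w \<in> tor_cycles i \<longleftrightarrow> w \<in> fgr n (B i) (gs i) (int i + d) \<and> pure_at i w \<in> Z" for w
  proof (cases i)
    case 0
    have "pure_at i w \<in> Z" if "w \<in> fgr n (B i) (gs i) (int i + d)"
      using that unfolding Z_def 0 by (auto simp: residue_tensor.carrier_tensor fgr_def)
    then show ?thesis using 0 by (auto simp: tor_cycles_def)
  next
    case (Suc l)
    have "pure_at i w \<in> Z \<longleftrightarrow> (\<forall>b. coef (\<delta> l w b) 0 = 0)" if "w \<in> fgr n (B i) (gs i) (int i + d)"
    proof -
      have w: "w \<in> fpolys n (B (Suc l))" using that Suc by (simp add: fgr_def)
      have "pure_at i w \<in> Z \<longleftrightarrow> pure_at l (\<delta> l w) = pure_at l 0"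
        using w unfolding Z_def Suc nat.case residue_tensor.zero_tensor residue_tensor.carrier_tensor
        by (auto simp: tmap_pure)
      then show ?thesis using pure_at_eq_iff[OF d_in[OF w] fpolys_0] by simp
    qed
    then show ?thesis using Suc by (auto simp: tor_cycles_def)
  qed
  have cF: "w \<in> fpolys n (B i)" if "w \<in> tor_cycles i" for w
    using that by (simp add: tor_cycles_def fgr_def)
  have dv: "\<delta> i v + w \<in> fpolys n (B i)" if "v \<in> fpolys n (B (Suc i))" "w \<in> fpolys n (B i)" for v w
    using that by (intro fpolys_add d_in)
  have "vdim (ring_of_type_algebra :: 'k ring) V = fam.dim (cycles i)"
  proof (rule vdim_eq_dim_cycles[of \<psi>])
    show "\<psi> ` tor_cycles i = carrier V"
    proof -
      have hZ: "hom_part (Ten i) (int i + d) \<inter> Z = pure_at i ` tor_cycles i"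
        unfolding t.hom_part_tensor using cyc by auto
      show ?thesis unfolding V hZ image_image by (rule image_cong) (simp_all add: coset cF)
    qed
  next
    fix w w' assume w: "w \<in> tor_cycles i" "w' \<in> tor_cycles i"
    show "\<psi> w = \<psi> w' \<longleftrightarrow> tor_boundary i (w - w')"
    proof
      assume eq: "\<psi> w = \<psi> w'"
      have "pure_at i (\<delta> i 0 + w) \<in> \<psi> w" unfolding \<psi>_def by (rule imageI[OF fpolys_0])
      then have "pure_at i w \<in> \<psi> w'" using eq by simp
      then obtain v where v: "v \<in> fpolys n (B (Suc i))" "pure_at i w = pure_at i (\<delta> i v + w')"
        unfolding \<psi>_def by blast
      then have "\<forall>b. coef ((w - (\<delta> i v + w')) b) 0 = 0" using pure_at_eq_iff[OF cF dv] w cF by blast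
      then have "\<forall>b. coef ((w - w' - \<delta> i v) b) 0 = 0" by (simp add: algebra_simps)
      then show "tor_boundary i (w - w')" using v(1) by (auto simp: tor_boundary_def)
    next
      have sub: "\<psi> w \<subseteq> \<psi> w'" if tb: "v \<in> fpolys n (B (Suc i))" "\<And>b. coef ((w - w' - \<delta> i v) b) 0 = 0"
        and w: "w \<in> tor_cycles i" "w' \<in> tor_cycles i" for w w' v
      proof
        fix P assume "P \<in> \<psi> w"
        then obtain u where u: "u \<in> fpolys n (B (Suc i))" "P = pure_at i (\<delta> i u + w)" by (auto simp: \<psi>_def)
        have uv: "u + v \<in> fpolys n (B (Suc i))" using u(1) tb(1) by (rule fpolys_add)
        have "coef ((\<delta> i u + w - (\<delta> i (u + v) + w')) b) 0 = coef ((w - w' - \<delta> i v) b) 0" for b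
          using d_add[OF u(1) tb(1)] by (simp add: algebra_simps)
        then have "P = pure_at i (\<delta> i (u + v) + w')"
          unfolding u(2) using pure_at_eq_iff[OF dv[OF u(1) cF[OF w(1)]] dv[OF uv cF[OF w(2)]]] tb(2) by simp
        then show "P \<in> \<psi> w'" using uv by (auto simp: \<psi>_def)
      qed
      assume "tor_boundary i (w - w')"
      then obtain v where v: "v \<in> fpolys n (B (Suc i))" "\<And>b. coef ((w - w' - \<delta> i v) b) 0 = 0"
        by (auto simp: tor_boundary_def)
      have "coef ((w' - w - \<delta> i (- v)) b) 0 = - coef ((w - w' - \<delta> i v) b) 0" for b
        using d_minus[OF v(1)] by (simp add: lookup_minus lookup_add)
      then have "coef ((w' - w - \<delta> i (- v)) b) 0 = 0" for b using v(2) by simp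
      then show "\<psi> w = \<psi> w'" using sub[OF v w] sub[OF fpolys_uminus[OF v(1)] _ w(2,1)] by blast
    qed
    show "\<psi> w \<oplus>\<^bsub>V\<^esub> \<psi> w' = \<psi> (w + w')"
    proof
      show "\<psi> w \<oplus>\<^bsub>V\<^esub> \<psi> w' \<subseteq> \<psi> (w + w')"
      proof
        fix P assume "P \<in> \<psi> w \<oplus>\<^bsub>V\<^esub> \<psi> w'"
        then obtain a b where ab: "a \<in> fpolys n (B (Suc i))" "b \<in> fpolys n (B (Suc i))"
          "P = pure_at i (\<delta> i a + w) \<oplus>\<^bsub>Ten i\<^esub> pure_at i (\<delta> i b + w')"
          unfolding V set_add_def' addS by (auto simp: \<psi>_def)
        have "P = pure_at i ((\<delta> i a + w) + (\<delta> i b + w'))"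
          unfolding ab(3) by (rule t.add_tensor[OF dv[OF ab(1) cF[OF w(1)]] dv[OF ab(2) cF[OF w(2)]]])
        also have "(\<delta> i a + w) + (\<delta> i b + w') = \<delta> i (a + b) + (w + w')"
          unfolding d_add[OF ab(1,2)] by (rule add.commute[THEN trans], simp only: ac_simps)
        finally have P: "P = pure_at i (\<delta> i (a + b) + (w + w'))" .
        show "P \<in> \<psi> (w + w')" unfolding \<psi>_def P by (rule imageI[OF fpolys_add[OF ab(1,2)]])
      qed
      show "\<psi> (w + w') \<subseteq> \<psi> w \<oplus>\<^bsub>V\<^esub> \<psi> w'"
      proof
        fix P assume "P \<in> \<psi> (w + w')"
        then obtain a where a: "a \<in> fpolys n (B (Suc i))" "P = pure_at i (\<delta> i a + (w + w'))" by (auto simp: \<psi>_def)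
        have "pure_at i (\<delta> i a + w) \<oplus>\<^bsub>Ten i\<^esub> pure_at i (\<delta> i 0 + w') = pure_at i ((\<delta> i a + w) + (\<delta> i 0 + w'))"
          by (rule t.add_tensor[OF dv[OF a(1) cF[OF w(1)]] dv[OF fpolys_0 cF[OF w(2)]]])
        also have "(\<delta> i a + w) + (\<delta> i 0 + w') = \<delta> i a + (w + w')" by (simp only: d_0 add_0 ac_simps)
        finally have "P = pure_at i (\<delta> i a + w) \<oplus>\<^bsub>Ten i\<^esub> pure_at i (\<delta> i 0 + w')" unfolding a(2) by (rule sym)
        then show "P \<in> \<psi> w \<oplus>\<^bsub>V\<^esub> \<psi> w'"
          unfolding V set_add_def' addS \<psi>_def using a(1) fpolys_0 by blast
      qed
    qed
  next
    fix c w assume w: "w \<in> tor_cycles i"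
    let ?c = "mconst c :: 'k mpoly"
    have cw: "pscale ?c w \<in> fpolys n (B i)" by (rule fpolys_pscale[OF mpolys_const cF[OF w]])
    \<comment> \<open>Scalar multiplication in a quotient is a union over all representatives; each
      of them is shown to give the same coset.\<close>
    have "Bd +>\<^bsub>S\<^esub> (?c \<odot>\<^bsub>S\<^esub> P) = \<psi> (pscale ?c w)" if PP: "P \<in> \<psi> w" for P
    proof -
      obtain a where a: "a \<in> fpolys n (B (Suc i))" "P = pure_at i (\<delta> i a + w)" using PP by (auto simp: \<psi>_def)
      have aw: "\<delta> i a + w \<in> fpolys n (B i)" by (rule dv[OF a(1) cF[OF w]])
      have ca: "pscale ?c a \<in> fpolys n (B (Suc i))" by (rule fpolys_pscale[OF mpolys_const a(1)])
      have "pscale ?c (\<delta> i a + w) = \<delta> i (pscale ?c a) + pscale ?c w"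
        unfolding d_scale[OF mpolys_const a(1)] by (simp add: fun_eq_iff distrib_left)
      then have "?c \<odot>\<^bsub>S\<^esub> P = pure_at i (\<delta> i (pscale ?c a) + pscale ?c w)"
        unfolding smS a(2) t.smult_tensor[OF mpolys_const aw] by simp
      then have "Bd +>\<^bsub>S\<^esub> (?c \<odot>\<^bsub>S\<^esub> P) = \<psi> (\<delta> i (pscale ?c a) + pscale ?c w)"
        using coset[OF dv[OF ca cw]] by simp
      also have "\<dots> = \<psi> (pscale ?c w)"
      proof
        show "\<psi> (\<delta> i (pscale ?c a) + pscale ?c w) \<subseteq> \<psi> (pscale ?c w)"
        proof
          fix P assume "P \<in> \<psi> (\<delta> i (pscale ?c a) + pscale ?c w)"
          then obtain b where b: "b \<in> fpolys n (B (Suc i))" "P = pure_at i (\<delta> i b + (\<delta> i (pscale ?c a) + pscale ?c w))"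
            by (auto simp: \<psi>_def)
          have "\<delta> i b + (\<delta> i (pscale ?c a) + pscale ?c w) = \<delta> i (b + pscale ?c a) + pscale ?c w"
            unfolding d_add[OF b(1) ca] by (simp only: add.assoc)
          then show "P \<in> \<psi> (pscale ?c w)" unfolding b(2) \<psi>_def using fpolys_add[OF b(1) ca] by (metis imageI)
        qed
        show "\<psi> (pscale ?c w) \<subseteq> \<psi> (\<delta> i (pscale ?c a) + pscale ?c w)"
        proof
          fix P assume "P \<in> \<psi> (pscale ?c w)"
          then obtain b where b: "b \<in> fpolys n (B (Suc i))" "P = pure_at i (\<delta> i b + pscale ?c w)"
            by (auto simp: \<psi>_def)
          have "\<delta> i b + pscale ?c w = \<delta> i (b - pscale ?c a) + (\<delta> i (pscale ?c a) + pscale ?c w)"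
            unfolding d_diff[OF b(1) ca] add.assoc[symmetric] diff_add_cancel ..
          then have "P = pure_at i (\<delta> i (b - pscale ?c a) + (\<delta> i (pscale ?c a) + pscale ?c w))"
            unfolding b(2) by (rule arg_cong)
          then show "P \<in> \<psi> (\<delta> i (pscale ?c a) + pscale ?c w)"
            unfolding \<psi>_def by (rule image_eqI[OF _ fpolys_diff[OF b(1) ca]])
        qed
      qed
      finally show ?thesis .
    qed
    moreover have "\<psi> w \<noteq> {}" unfolding \<psi>_def using fpolys_0 by blast
    ultimately show "c \<odot>\<^bsub>V\<^esub> \<psi> w = \<psi> (pscale ?c w)" unfolding V by blast
  next
    show "\<zero>\<^bsub>V\<^esub> = \<psi> 0" unfolding V Bd \<psi>_def by simp
  qed
  then show ?thesis unfolding V_def .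
qed

end

section \<open>Koszul cycles in free modules\<close>

abbreviation kscale :: "'k::field \<Rightarrow> (nat \<Rightarrow> 'k mpoly) \<Rightarrow> nat \<Rightarrow> 'k mpoly" where
  "kscale \<equiv> \<lambda>c. pscale (mconst c)"

interpretation ps: family_space kscale
  by unfold_locales
    (auto simp: fun_eq_iff distrib_left single_add distrib_right mult.assoc[symmetric] mconst_mult)

abbreviation koszul :: "nat \<Rightarrow> (nat set \<Rightarrow> nat \<Rightarrow> 'k::field mpoly) \<Rightarrow> nat set \<Rightarrow> nat \<Rightarrow> 'k mpoly" where
  "koszul n \<equiv> pk.kos (echelon_form n {..<n} (\<lambda>_ _. 0)) {..<n}"

text \<open>
  Among the elements of \<open>W 0\<close> choose one containing a monomial whose degree in the variables
  other than \<open>x\<^sub>v\<close> is minimal. In a Koszul cycle \<open>u\<close>, the term \<open>x\<^sub>v u {v}\<close> is a combination of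
  elements of \<open>W 0\<close> with coefficients among the other variables, so it cannot contain this monomial.
\<close>

lemma contr_image_strict:
  fixes W :: "nat \<Rightarrow> (nat set \<Rightarrow> nat \<Rightarrow> 'k::field mpoly) set"
  assumes W: "ps.contr_closed {..<n} W" and cyc: "\<forall>a. \<forall>u\<in>W a. koszul n u = 0"
    and v: "v \<in> {..<n}" and ex: "\<exists>w\<in>W 0. w \<noteq> 0"
  shows "\<exists>w\<in>W 0. w \<notin> contr v ` W 1"
proof -
  define occ where "occ t \<longleftrightarrow> fst t \<in> W 0 \<and> coef (fst t {} (fst (snd t))) (snd (snd t)) \<noteq> 0"
    for t :: "(nat set \<Rightarrow> nat \<Rightarrow> 'k mpoly) \<times> nat \<times> (nat \<Rightarrow>\<^sub>0 nat)"
  define size where "size t = mdeg (snd (snd t)) - coef (snd (snd t)) v"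
    for t :: "(nat set \<Rightarrow> nat \<Rightarrow> 'k mpoly) \<times> nat \<times> (nat \<Rightarrow>\<^sub>0 nat)"
  obtain w1 where w1: "w1 \<in> W 0" "w1 \<noteq> 0" using ex by blast
  have "supp_fam {..<n} 0 w1" using W w1(1) by (simp add: ps.contr_closed_def)
  then have e1: "w1 = at_empty (w1 {})" by (rule supp_fam_0_eq)
  have "at_empty 0 = (0 :: nat set \<Rightarrow> nat \<Rightarrow> 'k mpoly)" by (auto simp: at_empty_def fun_eq_iff)
  then have "w1 {} \<noteq> 0" using e1 w1(2) by metis
  then obtain b1 where "w1 {} b1 \<noteq> 0" by (auto simp: fun_eq_iff)
  then obtain m1 where "coef (w1 {} b1) m1 \<noteq> 0" by (auto simp: poly_mapping_eq_iff fun_eq_iff)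
  then have "occ (w1, b1, m1)" using w1(1) by (simp add: occ_def)
  then have "\<exists>t. occ t \<and> (\<forall>t'. occ t' \<longrightarrow> size t \<le> size t')" by (rule ex_has_least_nat)
  then obtain t where t: "occ t" "\<And>t'. occ t' \<Longrightarrow> size t \<le> size t'" by blast
  obtain w b m where wbm: "t = (w, b, m)" by (cases t)
  have w: "w \<in> W 0" "coef (w {} b) m \<noteq> 0" using t(1) by (auto simp: occ_def wbm)
  have "w \<notin> contr v ` W 1"
  proof
    assume "w \<in> contr v ` W 1"
    then obtain u where u: "u \<in> W 1" "w = contr v u" by blast
    have "koszul n u {} = 0" using cyc u(1) by simp
    then have "(\<Sum>x<n. pscale (mvar x) (contr x u {})) = 0"
      unfolding pk.kos_def echelon_form_full by simp
    then have "(\<Sum>x<n. pscale (mvar x) (contr x u {})) b = 0" by simp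
    then have "(\<Sum>x<n. mvar x * contr x u {} b) = 0" unfolding sum_fun_apply pscale_apply .
    then have "(\<Sum>x<n. coef (mvar x * contr x u {} b) (mterm v 1 + m)) = 0"
      unfolding lookup_sum[symmetric] by simp
    moreover have "coef (mvar x * contr x u {} b) (mterm v 1 + m) = 0" if x: "x < n" "x \<noteq> v" for x
    proof (rule ccontr)
      assume "coef (mvar x * contr x u {} b) (mterm v 1 + m) \<noteq> 0"
      then obtain m' where m': "mterm v 1 + m = mterm x 1 + m'" "coef (contr x u {} b) m' \<noteq> 0"
        unfolding mvar_def by (rule coef_term_mult_nonzero)
      have "contr x u \<in> W 0" using W u(1) x(1) by (simp add: ps.contr_closed_def)
      then have "occ (contr x u, b, m')" using m'(2) by (simp add: occ_def)
      then have le: "mdeg m - coef m v \<le> mdeg m' - coef m' v" using t(2) by (auto simp: size_def wbm)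
      \<comment> \<open>Compared with \<open>m\<close>, the monomial \<open>m'\<close> has one more
        factor \<open>x\<^sub>v\<close> and one factor \<open>x\<^sub>x\<close> less, so its size is
        smaller than the minimum.\<close>
      have "mdeg m' = mdeg m" using arg_cong[OF m'(1), of mdeg] by (simp only: mdeg_add mdeg_single)
      moreover have "coef m' v = Suc (coef m v)"
        using arg_cong[OF m'(1), of "\<lambda>m. coef m v"] x(2) by (simp add: lookup_add lookup_single when_def)
      ultimately show False using le coef_le_mdeg[of m' v] by linarith
    qed
    then have "(\<Sum>x<n. coef (mvar x * contr x u {} b) (mterm v 1 + m)) = coef (mvar v * contr v u {} b) (mterm v 1 + m)"
      using v by (intro sum.remove[THEN trans]) (auto intro!: sum.neutral)
    moreover have "coef (mvar v * contr v u {} b) (mterm v 1 + m) = coef (w {} b) m"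
      unfolding mvar_def coef_term_mult by (simp add: u(2))
    ultimately show False using w(2) by simp
  qed
  then show ?thesis using w(1) by blast
qed

text \<open>The linear dependence expresses \<open>z Q\<close> by values of \<open>z\<close> at sets with fewer elements outside \<open>A\<close>.\<close>

lemma zero_if_zero_on_subsets:
  fixes z :: "nat set \<Rightarrow> nat \<Rightarrow> 'k::field mpoly"
  assumes supp: "supp_fam {..<n} p z"
    and dep: "\<And>v. v < n \<Longrightarrow> contr v z = (\<Sum>a\<in>A. ps.fscale (l v a) (contr a z))"
    and zero: "\<And>Q. Q \<subseteq> A \<Longrightarrow> z Q = 0"
  shows "z = 0"
proof -
  have "z Q = 0" for Q
  proof (induction "card (Q - A)" arbitrary: Q rule: less_induct)
    case less
    show ?case
    proof (cases "Q \<subseteq> A \<or> \<not> Q \<subseteq> {..<n}")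
      case True
      then show ?thesis using zero supp unfolding supp_fam_def by blast
    next
      case False
      then obtain v where v: "v \<in> Q" "v \<notin> A" "v < n" by auto
      have fin: "finite Q" using False finite_subset by blast
      have "contr a z (Q - {v}) = 0" if a: "a \<in> A" for a
      proof (cases "a \<in> Q - {v}")
        case False
        have "insert a (Q - {v}) - A = (Q - A) - {v}" using a v by auto
        then have "card (insert a (Q - {v}) - A) < card (Q - A)"
          using card_Diff1_less[of "Q - A" v] v fin by simp
        then have "z (insert a (Q - {v})) = 0" by (rule less)
        then show ?thesis by (simp add: contr_def)
      qed (simp add: contr_def)
      then have "ps.fscale (l v a) (contr a z) (Q - {v}) b = 0" if "a \<in> A" for a b
        using that by (simp add: ps.fscale_def)
      then have "(\<Sum>a\<in>A. ps.fscale (l v a) (contr a z)) (Q - {v}) = 0"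
        by (intro ext) (simp add: sum_fun_apply)
      then have "contr v z (Q - {v}) = 0" using dep[OF v(3)] by simp
      then show ?thesis using v by (simp add: contr_def insert_absorb)
    qed
  qed
  then show ?thesis by (simp add: fun_eq_iff)
qed

section \<open>Koszul cycles in higher syzygy modules\<close>

context free_complex
begin

text \<open>
  The image of \<open>\<delta> l\<close> is an \<open>(l + 1)\<close>-st syzygy module, so its \<open>p\<close>-th Koszul homology is that of the cokernel of
  \<open>\<delta> 0\<close> in position \<open>p + l + 1\<close>, which exceeds the number of elements of \<open>A\<close>.
\<close>

lemma syzygy_cycle_zero:
  assumes A: "A \<subseteq> {..<n}" "card A < p + Suc l" and l: "0 < l" and p: "0 < p"
    and z: "z \<in> Cx A l p j" "pk.kos (echelon_form n A c) A z = 0"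
    and im: "\<And>Q. z Q \<in> \<delta> l ` fpolys n (B (Suc l))"
    and low: "\<delta> l ` fpolys n (B (Suc l)) \<inter> fgr n (B l) (gs l) (j - 1) \<subseteq> {0}"
  shows "z = 0"
proof -
  let ?k = "pk.kos (echelon_form n A c) A"
  interpret d: double_complex "Cx A" Df ?k by (rule double_complex_Cx[OF A(1)])
  obtain p' where p': "p = Suc p'" using p gr0_implies_Suc by blast
  obtain l' where l': "l = Suc l'" using l gr0_implies_Suc by blast
  obtain t where t: "t \<in> Cx A l (Suc p) (j - 1)" "?k t = z" using d.ks_exact z unfolding p' by blast
  \<comment> \<open>As \<open>z\<close> has values in the image of \<open>\<delta> l\<close>, it is
    killed by the next differential; hence \<open>Df l' t\<close> is a Koszul cycle, and a zigzag
    can start at \<open>t\<close>.\<close>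
  have "Df l' z = 0"
  proof (rule ext)
    fix Q
    obtain v where "v \<in> fpolys n (B (Suc (Suc l')))" "z Q = \<delta> (Suc l') v" using im[of Q] unfolding l' by blast
    then show "Df l' z Q = 0 Q" by (simp add: Df_def d_d)
  qed
  then have "?k (Df l' t) = 0" using d.ks_D[of t l' "Suc p" "j - 1"] t l' by simp
  moreover have "Df l' t \<in> Cx A l' (Suc p) (j - 1)" using t(1) unfolding l' by (rule d.D_in)
  ultimately have "\<exists>x\<in>Cx A l' (Suc (Suc p)) (j - 1 - 1). ?k x = Df l' t" by (intro d.ks_exact)
  then obtain y where y: "d.zigzag l (Suc p) (j - 1) y t"
    using d.zigzag_from_right[OF t(1)] by (auto simp: l')
  have "y \<in> Cx A 0 (Suc p + l) (j - 1 - int l)" by (rule d.zigzag_left[OF y])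
  then have sy: "supp_fam A (Suc p + l) y" by (simp add: Cx_def)
  have "y Q = 0" for Q
  proof (rule ccontr)
    assume "y Q \<noteq> 0"
    then have "Q \<subseteq> A" "card Q = Suc p + l" using sy by (auto simp: supp_fam_def)
    moreover have "finite A" using A(1) finite_subset by blast
    ultimately show False using card_mono[of A Q] A(2) by simp
  qed
  then have y0: "y = 0" by (simp add: fun_eq_iff)
  have "Df 0 0 = 0" by (rule ext) (simp add: Df_def)
  then have "y \<in> Df 0 ` Cx A 1 (Suc p + l) (j - 1 - int l)"
    unfolding y0 using d.zero_in by (metis imageI)
  then obtain u u' where u: "u \<in> Cx A l (Suc (Suc p)) (j - 1 - 1)" "u' \<in> Cx A (Suc l) (Suc p) (j - 1)"
    "t = ?k u + Df l u'" using d.zigzag_left_boundary[OF y] by blast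
  \<comment> \<open>Since \<open>z\<close> is the Koszul boundary of \<open>t\<close>, it is also
    that of \<open>Df l u'\<close>, whose values lie in the syzygy module in degree
    \<open>j - 1\<close>; by \<open>low\<close> there is nothing there.\<close>
  have "Df l u' Q = 0" for Q
  proof -
    have "Df l u' \<in> Cx A l (Suc p) (j - 1)" by (rule d.D_in[OF u(2)])
    then have "Df l u' Q \<in> fgr n (B l) (gs l) (j - 1)" by (simp add: Cx_def)
    then show ?thesis using low Df_in_image[OF u(2)] by blast
  qed
  then have "Df l u' = 0" by (simp add: fun_eq_iff)
  then have "t = ?k u" using u(3) by simp
  then show "z = 0" using t(2) pk.kos_kos by metis
qed

text \<open>Let \<open>A\<close> index a maximal independent set of contractions. The linear
  relations make the part of \<open>z\<close> on subsets of \<open>A\<close> a cycle for the echelon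
  forms of \<open>A\<close>. If \<open>A\<close> is too small, \<open>syzygy_cycle_zero\<close>
  kills this part, and the same relations recover all of \<open>z\<close> from it.\<close>

lemma syzygy_contractions_bound:
  assumes l: "0 < l" and p: "0 < p"
    and z: "z \<in> Cx {..<n} l p j" "koszul n z = 0" "z \<noteq> 0"
    and im: "\<And>Q. z Q \<in> \<delta> l ` fpolys n (B (Suc l))"
    and low: "\<delta> l ` fpolys n (B (Suc l)) \<inter> fgr n (B l) (gs l) (j - 1) \<subseteq> {0}"
  shows "\<exists>S. S \<subseteq> (\<lambda>v. contr v z) ` {..<n} \<and> ps.fam.independent S \<and> p + Suc l \<le> card S"
proof -
  obtain A and c :: "nat \<Rightarrow> nat \<Rightarrow> 'k" where A: "A \<subseteq> {..<n}" "inj_on (\<lambda>v. contr v z) A"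
    "ps.fam.independent ((\<lambda>v. contr v z) ` A)"
    and dep: "\<And>v. v \<in> {..<n} \<Longrightarrow> contr v z = (\<Sum>a\<in>A. ps.fscale (c v a) (contr a z))"
    using ps.fam.extract_spanning_indices[of "{..<n}" "\<lambda>v. contr v z"] by auto
  have finA: "finite A" using A(1) finite_subset by blast
  have "p + Suc l \<le> card A"
  proof (rule ccontr)
    assume "\<not> p + Suc l \<le> card A"
    then have card: "card A < p + Suc l" by simp
    \<comment> \<open>This truncation is the expression of \<open>z\<close> in the new coordinates,
      in which only the indices of \<open>A\<close> occur.\<close>
    define z' where "z' = (\<lambda>Q. if Q \<subseteq> A then z Q else 0)"
    have supp: "supp_fam {..<n} p z" using z(1) by (simp add: Cx_def)
    then have supp': "supp_fam A p z'" by (auto simp: supp_fam_def z'_def)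
    then have z': "z' \<in> Cx A l p j" using z(1) by (auto simp: Cx_def z'_def)
    have "pk.kos (echelon_form n A c) A z' Q = 0" for Q
    proof (cases "Q \<subseteq> A")
      case True
      have "pk.kos (echelon_form n A c) A z' Q = pk.kos (echelon_form n A c) A z Q"
        by (rule pk.kos_cong[OF _ True]) (simp add: z'_def)
      also have "\<dots> = koszul n z Q"
      proof (rule ext)
        fix i
        \<comment> \<open>Contractions by indices outside \<open>A\<close> are replaced by their
          combinations; exchanging the sums collects the coefficients of \<open>contr a z\<close>
          into \<open>echelon_form n A c a\<close>.\<close>
        have "(\<Sum>v\<in>{..<n} - A. mvar v * contr v z Q i) = (\<Sum>v\<in>{..<n} - A. \<Sum>a\<in>A. mvar v * (mconst (c v a) * contr a z Q i))"
        proof (rule sum.cong)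
          fix v assume "v \<in> {..<n} - A"
          then have "contr v z Q i = (\<Sum>a\<in>A. ps.fscale (c v a) (contr a z)) Q i" using dep[of v] by simp
          also have "\<dots> = (\<Sum>a\<in>A. mconst (c v a) * contr a z Q i)"
            unfolding sum_fun_apply by (simp add: ps.fscale_def)
          finally show "mvar v * contr v z Q i = (\<Sum>a\<in>A. mvar v * (mconst (c v a) * contr a z Q i))"
            by (simp add: sum_distrib_left)
        qed simp
        also have "\<dots> = (\<Sum>a\<in>A. (\<Sum>v\<in>{..<n} - A. mconst (c v a) * mvar v) * contr a z Q i)"
          by (subst sum.swap) (simp add: sum_distrib_left sum_distrib_right ac_simps)
        finally have "(\<Sum>a\<in>A. echelon_form n A c a * contr a z Q i)
            = (\<Sum>a\<in>A. mvar a * contr a z Q i) + (\<Sum>v\<in>{..<n} - A. mvar v * contr v z Q i)"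
          by (simp add: echelon_form_def distrib_right sum.distrib)
        also have "\<dots> = (\<Sum>v<n. mvar v * contr v z Q i)"
          using sum.subset_diff[OF A(1), of "\<lambda>v. mvar v * contr v z Q i"] by (simp add: add.commute)
        finally show "pk.kos (echelon_form n A c) A z Q i = koszul n z Q i"
          unfolding pk.kos_def sum_fun_apply pscale_apply echelon_form_full .
      qed
      finally show ?thesis using z(2) by simp
    next
      case False
      obtain p' where p': "p = Suc p'" using p gr0_implies_Suc by blast
      have "supp_fam A p' (pk.kos (echelon_form n A c) A z')"
        by (rule pk.supp_fam_kos[OF supp'[unfolded p']])
      then show ?thesis using False unfolding supp_fam_def by blast
    qed
    then have "pk.kos (echelon_form n A c) A z' = 0" by (simp add: fun_eq_iff)
    moreover have "z' Q \<in> \<delta> l ` fpolys n (B (Suc l))" for Q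
      using im d_image_0 by (simp add: z'_def)
    ultimately have z0: "z' = 0" using syzygy_cycle_zero[OF A(1) card l p z' _ _ low] by blast
    have zQ: "z Q = 0" if Q: "Q \<subseteq> A" for Q
    proof -
      have "z Q = z' Q" using Q by (simp add: z'_def)
      then show ?thesis unfolding z0 by simp
    qed
    have "z = 0" by (rule zero_if_zero_on_subsets[OF supp _ zQ]) (use dep in auto)
    then show False using z(3) by blast
  qed
  then show ?thesis using A card_image[OF A(2)] by (intro exI[of _ "(\<lambda>v. contr v z) ` A"]) auto
qed

end

section \<open>Resolutions\<close>

lemma free_complex_of_resolution:
  assumes "graded_free_resolution n M (\<lambda>l. graded_free n (B l) (gs l)) \<epsilon> \<delta>"
  shows "free_complex n B gs \<delta>"
proof -
  have hom: "\<delta> l \<in> graded_homs (mpoly_ring n) (graded_free n (B (Suc l)) (gs (Suc l))) (graded_free n (B l) (gs l))" for l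
    using assms by (simp add: graded_free_resolution_def)
  have ker: "\<delta> (Suc l) ` fpolys n (B (Suc (Suc l))) = {v \<in> fpolys n (B (Suc l)). \<delta> l v = 0}" for l
    using assms unfolding graded_free_resolution_def graded_free_simps by blast
  show ?thesis
  proof
    fix l
    show "\<delta> l v \<in> fpolys n (B l)" if "v \<in> fpolys n (B (Suc l))" for v
      using hom[of l] that by (auto simp: graded_homs_def module_homs_def graded_free_simps)
    show "\<delta> l (u + v) = \<delta> l u + \<delta> l v" if "u \<in> fpolys n (B (Suc l))" "v \<in> fpolys n (B (Suc l))" for u v
      using hom[of l] that by (auto simp: graded_homs_def module_homs_def graded_free_simps)
    show "\<delta> l (pscale f v) = pscale f (\<delta> l v)" if "f \<in> mpolys n" "v \<in> fpolys n (B (Suc l))" for f v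
      using hom[of l] that by (auto simp: graded_homs_def module_homs_def graded_free_simps carrier_mpoly_ring)
    show "\<delta> l v \<in> fgr n (B l) (gs l) j" if "v \<in> fgr n (B (Suc l)) (gs (Suc l)) j" for v j
      using hom[of l] that by (auto simp: graded_homs_def graded_free_simps)
    show "\<delta> l (\<delta> (Suc l) v) = 0" if "v \<in> fpolys n (B (Suc (Suc l)))" for v
      using ker[of l] that by blast
    show "v \<in> \<delta> (Suc l) ` fpolys n (B (Suc (Suc l)))" if "v \<in> fpolys n (B (Suc l))" "\<delta> l v = 0" for v
      using ker[of l] that by blast
  qed
qed

lemma finite_monomials: "finite {m. monom_keys m \<subseteq> {..<n} \<and> mdeg m \<le> k}"
proof (rule inj_on_finite)
  let ?f = "\<lambda>m. restrict (coef m) {..<n}"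
  show "inj_on ?f {m. monom_keys m \<subseteq> {..<n} \<and> mdeg m \<le> k}"
  proof (rule inj_onI)
    fix m m' assume m: "m \<in> {m. monom_keys m \<subseteq> {..<n} \<and> mdeg m \<le> k}" "m' \<in> {m. monom_keys m \<subseteq> {..<n} \<and> mdeg m \<le> k}"
      and eq: "?f m = ?f m'"
    show "m = m'"
    proof (rule poly_mapping_eqI)
      fix v
      show "coef m v = coef m' v"
      proof (cases "v < n")
        case True
        then show ?thesis using fun_cong[OF eq, of v] by simp
      next
        case False
        then have "v \<notin> monom_keys m" "v \<notin> monom_keys m'" using m by auto
        then show ?thesis by (simp add: in_keys_iff)
      qed
    qed
  qed
  show "?f ` {m. monom_keys m \<subseteq> {..<n} \<and> mdeg m \<le> k} \<subseteq> {..<n} \<rightarrow>\<^sub>E {..k}"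
    by (auto intro: order_trans[OF coef_le_mdeg] split: if_splits)
  show "finite ({..<n} \<rightarrow>\<^sub>E {..k})" by (intro finite_PiE) auto
qed

locale graded_resolution =
  fixes n :: nat and M :: "('k::field mpoly, 'b) graded_module" and B :: "nat \<Rightarrow> nat set" and gs :: "nat \<Rightarrow> nat \<Rightarrow> int"
    and \<epsilon> :: "(nat \<Rightarrow> 'k mpoly) \<Rightarrow> 'b" and \<delta> :: "nat \<Rightarrow> (nat \<Rightarrow> 'k mpoly) \<Rightarrow> nat \<Rightarrow> 'k mpoly"
  assumes M: "is_graded_module n M" and fg: "finitely_generated (mpoly_ring n) M"
    and res: "graded_free_resolution n M (\<lambda>l. graded_free n (B l) (gs l)) \<epsilon> \<delta>"
begin

sublocale free_complex n B gs \<delta>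
  by (rule free_complex_of_resolution[OF res])

sublocale M: Module.module "mpoly_ring n" M
  using M by (simp add: is_graded_module_def)

lemma
  shows eps_in: "v \<in> fpolys n (B 0) \<Longrightarrow> \<epsilon> v \<in> carrier M"
    and eps_add: "u \<in> fpolys n (B 0) \<Longrightarrow> v \<in> fpolys n (B 0) \<Longrightarrow> \<epsilon> (u + v) = \<epsilon> u \<oplus>\<^bsub>M\<^esub> \<epsilon> v"
    and eps_scale: "f \<in> mpolys n \<Longrightarrow> v \<in> fpolys n (B 0) \<Longrightarrow> \<epsilon> (pscale f v) = f \<odot>\<^bsub>M\<^esub> \<epsilon> v"
    and eps_graded: "v \<in> fgr n (B 0) (gs 0) j \<Longrightarrow> \<epsilon> v \<in> hom_part M j"
proof -
  have "\<epsilon> \<in> graded_homs (mpoly_ring n) (graded_free n (B 0) (gs 0)) M"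
    using res by (simp add: graded_free_resolution_def)
  then show "v \<in> fpolys n (B 0) \<Longrightarrow> \<epsilon> v \<in> carrier M"
    "u \<in> fpolys n (B 0) \<Longrightarrow> v \<in> fpolys n (B 0) \<Longrightarrow> \<epsilon> (u + v) = \<epsilon> u \<oplus>\<^bsub>M\<^esub> \<epsilon> v"
    "f \<in> mpolys n \<Longrightarrow> v \<in> fpolys n (B 0) \<Longrightarrow> \<epsilon> (pscale f v) = f \<odot>\<^bsub>M\<^esub> \<epsilon> v"
    "v \<in> fgr n (B 0) (gs 0) j \<Longrightarrow> \<epsilon> v \<in> hom_part M j"
    by (auto simp: graded_homs_def module_homs_def graded_free_simps carrier_mpoly_ring image_subset_iff)
qed

lemma eps_surj: "\<epsilon> ` fpolys n (B 0) = carrier M"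
  and eps_kernel: "\<delta> 0 ` fpolys n (B 1) = {v \<in> fpolys n (B 0). \<epsilon> v = \<zero>\<^bsub>M\<^esub>}"
  using res unfolding graded_free_resolution_def graded_free_simps by blast+

lemma eps_0: "\<epsilon> 0 = \<zero>\<^bsub>M\<^esub>"
  using eps_kernel d_image_0[of 0] by auto

lemma eps_minus: "v \<in> fpolys n (B 0) \<Longrightarrow> \<epsilon> (- v) = \<ominus>\<^bsub>M\<^esub> \<epsilon> v"
  using eps_add[OF fpolys_uminus, of v v] eps_0
  by (intro M.minus_equality[symmetric]) (auto intro: eps_in fpolys_uminus)

lemma eps_eq_iff:
  assumes "u \<in> fpolys n (B 0)" and "v \<in> fpolys n (B 0)"
  shows "\<epsilon> u = \<epsilon> v \<longleftrightarrow> u - v \<in> \<delta> 0 ` fpolys n (B 1)"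
proof
  have d: "u - v \<in> fpolys n (B 0)" by (rule fpolys_diff[OF assms])
  assume e: "\<epsilon> u = \<epsilon> v"
  have "\<epsilon> (u - v) = \<epsilon> (u + - v)" by simp
  also have "\<dots> = \<epsilon> (v + - v)" unfolding eps_add[OF assms(1) fpolys_uminus[OF assms(2)]]
    eps_add[OF assms(2) fpolys_uminus[OF assms(2)]] e ..
  also have "\<dots> = \<zero>\<^bsub>M\<^esub>" using eps_0 by simp
  finally show "u - v \<in> \<delta> 0 ` fpolys n (B 1)" using eps_kernel d by blast
next
  have d: "u - v \<in> fpolys n (B 0)" by (rule fpolys_diff[OF assms])
  assume "u - v \<in> \<delta> 0 ` fpolys n (B 1)"
  then have "\<epsilon> (u - v) = \<zero>\<^bsub>M\<^esub>" using eps_kernel by blast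
  then show "\<epsilon> u = \<epsilon> v" using eps_add[OF d assms(2)] eps_in[OF assms(2)] by simp
qed

lemma eps_sum:
  assumes "finite J" and "\<And>i. i \<in> J \<Longrightarrow> f i \<in> fpolys n (B 0)"
  shows "\<epsilon> (\<Sum>i\<in>J. f i) = (\<Oplus>\<^bsub>M\<^esub>i\<in>J. \<epsilon> (f i))"
  using assms
proof (induction J)
  case empty
  show ?case by (simp only: sum.empty M.finsum_empty eps_0)
next
  case (insert i J)
  have "(\<Sum>i\<in>J. f i) \<in> fpolys n (B 0)" using insert.prems by (intro fpolys_sum) auto
  then show ?case
    unfolding sum.insert[OF insert.hyps] using insert eps_in by (subst M.finsum_insert) (auto simp: eps_add)
qed

text \<open>An element \<open>x\<close> of degree \<open>j\<close> has two decompositions: itself in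
  degree \<open>j\<close>, and the images of the components of a preimage. Uniqueness identifies
  them, so the component of degree \<open>j\<close> of the preimage already maps to
  \<open>x\<close>.\<close>

lemma hom_part_eq: "hom_part M j = \<epsilon> ` fgr n (B 0) (gs 0) j"
proof
  show "\<epsilon> ` fgr n (B 0) (gs 0) j \<subseteq> hom_part M j" using eps_graded by blast
  have sub: "additive_subgroup (hom_part M i) M" for i using M by (simp add: is_graded_module_def)
  have zero: "\<zero>\<^bsub>M\<^esub> \<in> hom_part M i" for i using additive_subgroup.zero_closed[OF sub] .
  have carr: "hom_part M i \<subseteq> carrier M" for i using additive_subgroup.a_subset[OF sub] .
  show "hom_part M j \<subseteq> \<epsilon> ` fgr n (B 0) (gs 0) j"
  proof
    fix x assume x: "x \<in> hom_part M j"
    then have xM: "x \<in> carrier M" using carr by blast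
    then obtain v where v: "v \<in> fpolys n (B 0)" "x = \<epsilon> v" using eps_surj by blast
    obtain J where J: "finite J" "v = (\<Sum>i\<in>J. prj (gs 0) i v)" "\<And>i. i \<notin> J \<Longrightarrow> prj (gs 0) i v = 0"
      using sum_prj[OF v(1)] by blast
    define c1 where "c1 i = (if i = j then x else \<zero>\<^bsub>M\<^esub>)" for i
    define c2 where "c2 i = \<epsilon> (prj (gs 0) i v)" for i
    let ?D = "\<lambda>c. (\<forall>j. c j \<in> hom_part M j) \<and> finite {j. c j \<noteq> \<zero>\<^bsub>M\<^esub>} \<and>
         x = (\<Oplus>\<^bsub>M\<^esub>j\<in>{j. c j \<noteq> \<zero>\<^bsub>M\<^esub>}. c j)"
    have uni: "\<exists>!c. ?D c" using M xM by (simp add: is_graded_module_def)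
    have supp: "(\<Oplus>\<^bsub>M\<^esub>j\<in>{j. c j \<noteq> \<zero>\<^bsub>M\<^esub>}. c j) = (\<Oplus>\<^bsub>M\<^esub>j\<in>I. c j)"
      if "finite I" "{j. c j \<noteq> \<zero>\<^bsub>M\<^esub>} \<subseteq> I" "\<And>j. c j \<in> carrier M" for c and I :: "int set"
      using that by (intro M.add.finprod_mono_neutral_cong_left) auto
    have "?D c1"
    proof (intro conjI allI)
      show "c1 i \<in> hom_part M i" for i using x zero by (simp add: c1_def)
      have s: "{i. c1 i \<noteq> \<zero>\<^bsub>M\<^esub>} \<subseteq> {j}" by (auto simp: c1_def)
      show "finite {i. c1 i \<noteq> \<zero>\<^bsub>M\<^esub>}" using s finite_subset by blast
      show "x = (\<Oplus>\<^bsub>M\<^esub>i\<in>{i. c1 i \<noteq> \<zero>\<^bsub>M\<^esub>}. c1 i)"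
        using supp[OF _ s] xM by (simp add: c1_def)
    qed
    moreover have "?D c2"
    proof (intro conjI allI)
      show "c2 i \<in> hom_part M i" for i unfolding c2_def by (intro eps_graded prj_in_fgr v(1))
      have s: "{i. c2 i \<noteq> \<zero>\<^bsub>M\<^esub>} \<subseteq> J" using J(3) eps_0 unfolding c2_def by (metis (mono_tags, lifting) mem_Collect_eq subsetI)
      show "finite {i. c2 i \<noteq> \<zero>\<^bsub>M\<^esub>}" using s J(1) finite_subset by blast
      have c: "c2 i \<in> carrier M" for i unfolding c2_def by (intro eps_in prj_in_fpolys v(1))
      have "x = (\<Oplus>\<^bsub>M\<^esub>i\<in>J. c2 i)"
        using eps_sum[OF J(1), of "\<lambda>i. prj (gs 0) i v"] prj_in_fpolys[OF v(1)] J(2) v(2) by (simp add: c2_def)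
      then show "x = (\<Oplus>\<^bsub>M\<^esub>i\<in>{i. c2 i \<noteq> \<zero>\<^bsub>M\<^esub>}. c2 i)" using supp[OF J(1) s c] by simp
    qed
    moreover obtain c where "\<And>c'. ?D c' \<Longrightarrow> c' = c" using uni by (elim ex1E) blast
    ultimately have "c1 = c2" by metis
    then have "x = \<epsilon> (prj (gs 0) j v)" unfolding c1_def c2_def by (metis (mono_tags))
    then show "x \<in> \<epsilon> ` fgr n (B 0) (gs 0) j" using prj_in_fgr[OF v(1)] by blast
  qed
qed

lemma d_image_prj:
  assumes "v \<in> \<delta> 0 ` fpolys n (B 1)"
  shows "prj (gs 0) j v \<in> \<delta> 0 ` fpolys n (B 1)"
proof -
  obtain u where u: "u \<in> fpolys n (B 1)" "v = \<delta> 0 u" using assms by blast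
  then have "prj (gs 0) j v = \<delta> 0 (prj (gs 1) j u)" using d_prj[of u 0 j] by simp
  then show ?thesis using prj_in_fpolys[OF u(1)] by blast
qed

text \<open>The basis of \<open>F 0\<close> may be infinite, so finiteness has to come from
  \<open>M\<close>: generators are lifted to \<open>F 0\<close>, and the image of their linear
  combinations is a submodule that contains them all.\<close>

lemma generators:
  obtains G where "finite G" "G \<subseteq> fpolys n (B 0)"
    "\<And>y. y \<in> fpolys n (B 0) \<Longrightarrow> \<exists>f\<in>UNIV \<rightarrow> mpolys n. y - (\<Sum>a\<in>G. pscale (f a) a) \<in> \<delta> 0 ` fpolys n (B 1)"
proof -
  obtain A where A: "finite A" "A \<subseteq> carrier M" "submodule_gen (mpoly_ring n) M A = carrier M"
    using fg by (auto simp: finitely_generated_def)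
  obtain G where G: "finite G" "G \<subseteq> fpolys n (B 0)" "A = \<epsilon> ` G"
    using finite_subset_image[OF A(1), of \<epsilon> "fpolys n (B 0)"] A(2) eps_surj by metis
  define Q where "Q = {(\<Sum>a\<in>G. pscale (f a) a) | f. f \<in> UNIV \<rightarrow> mpolys n}"
  have Q_in: "Q \<subseteq> fpolys n (B 0)"
    using G(2) by (auto simp: Q_def intro!: fpolys_sum fpolys_pscale)
  have QI: "(\<Sum>a\<in>G. pscale (f a) a) \<in> Q" if "\<And>a. f a \<in> mpolys n" for f
    using that unfolding Q_def by blast
  have Q0: "0 \<in> Q"
  proof -
    have "(\<Sum>a\<in>G. pscale 0 a) = 0" by (rule ext) (simp add: sum_fun_apply)
    then show ?thesis using QI[of "\<lambda>_. 0"] by simp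
  qed
  have Qadd: "x + y \<in> Q" if xy: "x \<in> Q" "y \<in> Q" for x y
  proof -
    obtain f g where f: "f \<in> UNIV \<rightarrow> mpolys n" "x = (\<Sum>a\<in>G. pscale (f a) a)"
      and g: "g \<in> UNIV \<rightarrow> mpolys n" "y = (\<Sum>a\<in>G. pscale (g a) a)" using xy unfolding Q_def by blast
    have "x + y = (\<Sum>a\<in>G. pscale (f a + g a) a)"
      unfolding f(2) g(2) by (rule ext) (simp add: sum_fun_apply distrib_right sum.distrib)
    moreover have "f a + g a \<in> mpolys n" for a using f(1) g(1) by (intro mpolys_add) auto
    ultimately show ?thesis using QI[of "\<lambda>a. f a + g a"] by simp
  qed
  have Qscale: "pscale r x \<in> Q" if r: "r \<in> mpolys n" "x \<in> Q" for r x
  proof -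
    obtain f where f: "f \<in> UNIV \<rightarrow> mpolys n" "x = (\<Sum>a\<in>G. pscale (f a) a)" using r(2) unfolding Q_def by blast
    have "pscale r x = (\<Sum>a\<in>G. pscale (r * f a) a)"
      unfolding f(2) by (rule ext) (simp add: sum_fun_apply sum_distrib_left mult.assoc)
    moreover have "r * f a \<in> mpolys n" for a using f(1) r(1) by (intro mpolys_mult) auto
    ultimately show ?thesis using QI[of "\<lambda>a. r * f a"] by simp
  qed
  have Quminus: "- x \<in> Q" if "x \<in> Q" for x
  proof -
    have "- x = pscale (- 1) x" by (simp add: fun_eq_iff)
    then show ?thesis using Qscale[OF mpolys_uminus[OF mpolys_1] that] by simp
  qed
  have "submodule (\<epsilon> ` Q) (mpoly_ring n) M"
  proof (rule M.submoduleI)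
    show "\<epsilon> ` Q \<subseteq> carrier M" using Q_in eps_in by blast
    show "\<zero>\<^bsub>M\<^esub> \<in> \<epsilon> ` Q" using Q0 eps_0 by (metis imageI)
    show "\<ominus>\<^bsub>M\<^esub> a \<in> \<epsilon> ` Q" if a: "a \<in> \<epsilon> ` Q" for a
    proof -
      obtain q where q: "q \<in> Q" "a = \<epsilon> q" using a by blast
      then have "\<ominus>\<^bsub>M\<^esub> a = \<epsilon> (- q)" using eps_minus Q_in by auto
      then show ?thesis using Quminus[OF q(1)] by blast
    qed
    show "a \<oplus>\<^bsub>M\<^esub> b \<in> \<epsilon> ` Q" if ab: "a \<in> \<epsilon> ` Q" "b \<in> \<epsilon> ` Q" for a b
    proof -
      obtain q q' where q: "q \<in> Q" "a = \<epsilon> q" "q' \<in> Q" "b = \<epsilon> q'" using ab by blast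
      have "\<epsilon> (q + q') = \<epsilon> q \<oplus>\<^bsub>M\<^esub> \<epsilon> q'" by (rule eps_add) (use q Q_in in auto)
      then have "a \<oplus>\<^bsub>M\<^esub> b = \<epsilon> (q + q')" using q by simp
      then show ?thesis using Qadd[OF q(1,3)] by blast
    qed
    show "r \<odot>\<^bsub>M\<^esub> a \<in> \<epsilon> ` Q" if r: "r \<in> carrier (mpoly_ring n)" "a \<in> \<epsilon> ` Q" for r a
    proof -
      obtain q where q: "q \<in> Q" "a = \<epsilon> q" using r by blast
      then have "r \<odot>\<^bsub>M\<^esub> a = \<epsilon> (pscale r q)" using eps_scale[of r q] Q_in r(1) by (auto simp: carrier_mpoly_ring)
      then show ?thesis using Qscale q(1) r(1) by (auto simp: carrier_mpoly_ring)
    qed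
  qed
  moreover have "A \<subseteq> \<epsilon> ` Q"
  proof -
    have "a \<in> Q" if a: "a \<in> G" for a
    proof -
      have "(\<Sum>b\<in>G. pscale (if b = a then 1 else 0) b) i = a i" for i
      proof -
        have "(\<Sum>b\<in>G. (if b = a then 1 else 0) * b i) = (\<Sum>b\<in>G. if b = a then b i else 0)"
          by (rule sum.cong) auto
        then show ?thesis using G(1) a by (simp add: sum_fun_apply)
      qed
      then have "(\<Sum>b\<in>G. pscale (if b = a then 1 else 0) b) = a" by (rule ext)
      then show ?thesis using QI[of "\<lambda>b. if b = a then 1 else 0"] by simp
    qed
    then show ?thesis unfolding G(3) by blast
  qed
  ultimately have "carrier M \<subseteq> \<epsilon> ` Q" using A(3) unfolding submodule_gen_def by blast
  then have "\<exists>q\<in>Q. y - q \<in> \<delta> 0 ` fpolys n (B 1)" if y: "y \<in> fpolys n (B 0)" for y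
  proof -
    obtain q where "q \<in> Q" "\<epsilon> y = \<epsilon> q" using \<open>carrier M \<subseteq> \<epsilon> ` Q\<close> eps_in[OF y] by blast
    then show ?thesis using eps_eq_iff[OF y, of q] Q_in by blast
  qed
  then show ?thesis using that[OF G(1,2)] unfolding Q_def by blast
qed

end

section \<open>The lowest component and its embedding\<close>

context graded_resolution
begin

text \<open>In each degree \<open>M\<close> is spanned over \<open>K\<close> by monomials times
  homogeneous components of the generators. Only finitely many monomials matter, as these components
  vanish below a common degree \<open>jmin\<close>; below \<open>jmin\<close> nothing
  remains.\<close>

lemma homogeneous_generators:
  "\<exists>jmin. \<forall>j. \<exists>W. finite W \<and> W \<subseteq> fgr n (B 0) (gs 0) j \<and> (j < jmin \<longrightarrow> W = {}) \<and>
     (\<forall>y\<in>fgr n (B 0) (gs 0) j. \<exists>s\<in>ps.span W. y - s \<in> \<delta> 0 ` fpolys n (B 1))"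
proof -
  obtain G where G: "finite G" "G \<subseteq> fpolys n (B 0)"
    "\<And>y. y \<in> fpolys n (B 0) \<Longrightarrow> \<exists>f\<in>UNIV \<rightarrow> mpolys n. y - (\<Sum>a\<in>G. pscale (f a) a) \<in> \<delta> 0 ` fpolys n (B 1)"
    using generators by blast
  have "\<exists>J. finite J \<and> (\<forall>j. j \<notin> J \<longrightarrow> prj (gs 0) j a = 0)" if a: "a \<in> G" for a
    using sum_prj[of a n "B 0" "gs 0"] G(2) a by (metis subsetD)
  then obtain J where J: "\<And>a. a \<in> G \<Longrightarrow> finite (J a)" "\<And>a j. a \<in> G \<Longrightarrow> j \<notin> J a \<Longrightarrow> prj (gs 0) j a = 0"
    by metis
  obtain jmin where jmin: "\<And>j. j \<in> (\<Union>a\<in>G. J a) \<Longrightarrow> jmin \<le> j"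
    using bdd_below_finite[of "\<Union>a\<in>G. J a"] G(1) J(1) unfolding bdd_below_def by blast
  have vanish: "prj (gs 0) j a = 0" if "a \<in> G" "j < jmin" for a j
    using J(2)[OF that(1)] jmin[of j] that by fastforce
  \<comment> \<open>A monomial of larger degree would multiply a component of degree below
    \<open>jmin\<close>, which is zero.\<close>
  define mon where "mon j = {m. monom_keys m \<subseteq> {..<n} \<and> int (mdeg m) \<le> j - jmin}" for j
  define gen :: "int \<Rightarrow> (nat \<Rightarrow> 'k mpoly) \<Rightarrow> (nat \<Rightarrow>\<^sub>0 nat) \<Rightarrow> nat \<Rightarrow> 'k mpoly"
    where "gen j a m = pscale (mterm m 1) (prj (gs 0) (j - int (mdeg m)) a)" for j a m
  define W where "W j = (\<lambda>(a, m). gen j a m) ` (G \<times> mon j)" for j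
  have fin: "finite (W j)" for j
  proof -
    have "mon j \<subseteq> {m. monom_keys m \<subseteq> {..<n} \<and> mdeg m \<le> nat (j - jmin)}" by (auto simp: mon_def)
    then have "finite (mon j)" using finite_monomials finite_subset by blast
    then show ?thesis using G(1) by (simp add: W_def)
  qed
  have sub: "W j \<subseteq> fgr n (B 0) (gs 0) j" for j
  proof -
    have "gen j a m \<in> fgr n (B 0) (gs 0) j" if am: "a \<in> G" "m \<in> mon j" for a m
    proof -
      have "mterm m 1 \<in> mpolys n" using am(2) by (intro mpolys_term) (simp add: mon_def)
      then have "gen j a m \<in> fpolys n (B 0)" unfolding gen_def using G(2) am(1)
        by (intro fpolys_pscale prj_in_fpolys) auto
      then show ?thesis unfolding fgr_def gen_def by (simp add: prj_term prj_prj)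
    qed
    then show ?thesis by (auto simp: W_def)
  qed
  have empty: "W j = {}" if "j < jmin" for j using that by (auto simp: W_def mon_def)
  have span: "\<exists>s\<in>ps.span (W j). y - s \<in> \<delta> 0 ` fpolys n (B 1)" if y: "y \<in> fgr n (B 0) (gs 0) j" for y j
  proof -
    obtain f where f: "f \<in> UNIV \<rightarrow> mpolys n" "y - (\<Sum>a\<in>G. pscale (f a) a) \<in> \<delta> 0 ` fpolys n (B 1)"
      using G(3)[of y] y by (auto simp: fgr_def)
    let ?s = "prj (gs 0) j (\<Sum>a\<in>G. pscale (f a) a)"
    have "pscale (f a) a = (\<Sum>m\<in>monom_keys (f a). pscale (mterm m (coef (f a) m)) a)" for a
    proof (rule ext)
      fix i
      have "f a * a i = (\<Sum>m\<in>monom_keys (f a). mterm m (coef (f a) m)) * a i" using sum_terms[of "f a"] by simp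
      then show "pscale (f a) a i = (\<Sum>m\<in>monom_keys (f a). pscale (mterm m (coef (f a) m)) a) i"
        by (simp add: sum_fun_apply sum_distrib_right)
    qed
    then have "?s = (\<Sum>a\<in>G. \<Sum>m\<in>monom_keys (f a). prj (gs 0) j (pscale (mterm m (coef (f a) m)) a))"
      by (simp only: prj_sum)
    moreover have "prj (gs 0) j (pscale (mterm m (coef (f a) m)) a) \<in> ps.span (W j)"
      if am: "a \<in> G" "m \<in> monom_keys (f a)" for a m
    proof -
      have "mterm m (coef (f a) m) = mconst (coef (f a) m) * mterm m 1" by (simp add: mult_single)
      then have eq: "prj (gs 0) j (pscale (mterm m (coef (f a) m)) a) = pscale (mconst (coef (f a) m)) (gen j a m)"
        unfolding prj_term gen_def by (simp add: fun_eq_iff mult.assoc)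
      have "gen j a m \<in> ps.span (W j)"
      proof (cases "int (mdeg m) \<le> j - jmin")
        case True
        have "monom_keys m \<subseteq> {..<n}" using f(1) am(2) by (auto simp: mpolys_def)
        then have "m \<in> mon j" using True by (simp add: mon_def)
        then show ?thesis using am(1) by (intro ps.span_base) (auto simp: W_def)
      next
        case False
        then have "gen j a m = 0" unfolding gen_def using vanish[OF am(1), of "j - int (mdeg m)"]
          by (simp add: fun_eq_iff)
        then show ?thesis using ps.span_zero by metis
      qed
      then show ?thesis unfolding eq by (rule ps.span_scale)
    qed
    ultimately have "?s \<in> ps.span (W j)" by (simp only: ps.span_sum)
    moreover have "y - ?s = prj (gs 0) j (y - (\<Sum>a\<in>G. pscale (f a) a))"
      using y by (simp add: prj_diff fgr_def)
    moreover have "prj (gs 0) j (y - (\<Sum>a\<in>G. pscale (f a) a)) \<in> \<delta> 0 ` fpolys n (B 1)"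
      by (rule d_image_prj[OF f(2)])
    ultimately show ?thesis by (intro bexI[of _ ?s]) (simp_all only:)
  qed
  show ?thesis
  proof (intro exI[of _ jmin] allI)
    fix j
    show "\<exists>W. finite W \<and> W \<subseteq> fgr n (B 0) (gs 0) j \<and> (j < jmin \<longrightarrow> W = {}) \<and>
      (\<forall>y\<in>fgr n (B 0) (gs 0) j. \<exists>s\<in>ps.span W. y - s \<in> \<delta> 0 ` fpolys n (B 1))"
      by (rule exI[of _ "W j"], intro conjI, rule fin, rule sub, rule impI, rule empty, assumption,
          rule ballI, rule span, assumption)
  qed
qed

text \<open>The bound \<open>jmin\<close> makes the least nonzero degree exist, so
  \<open>THE\<close> is well defined for nonzero \<open>M\<close>. For \<open>M = 0\<close> its
  value is unspecified, but then every component is zero.\<close>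

lemma hom_part_below_initial: "hom_part M (initial_degree M - 1) = {\<zero>\<^bsub>M\<^esub>}"
proof -
  have zero: "\<zero>\<^bsub>M\<^esub> \<in> hom_part M j" for j
    unfolding hom_part_eq using eps_0 fgr_0 by (metis imageI)
  obtain jmin where j: "\<forall>j. \<exists>W. finite W \<and> W \<subseteq> fgr n (B 0) (gs 0) j \<and> (j < jmin \<longrightarrow> W = {}) \<and>
     (\<forall>y\<in>fgr n (B 0) (gs 0) j. \<exists>s\<in>ps.span W. y - s \<in> \<delta> 0 ` fpolys n (B 1))"
    using homogeneous_generators by (rule exE)
  have low: "fgr n (B 0) (gs 0) j \<subseteq> \<delta> 0 ` fpolys n (B 1)" if jm: "j < jmin" for j
  proof
    fix y :: "nat \<Rightarrow> 'k mpoly" assume y: "y \<in> fgr n (B 0) (gs 0) j"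
    obtain W :: "(nat \<Rightarrow> 'k mpoly) set" where W: "j < jmin \<longrightarrow> W = {}"
      "\<forall>y\<in>fgr n (B 0) (gs 0) j. \<exists>s\<in>ps.span W. y - s \<in> \<delta> 0 ` fpolys n (B 1)"
      using spec[OF j, of j] by (elim exE conjE) (rule that)
    then have "\<exists>s\<in>ps.span {}. y - s \<in> \<delta> 0 ` fpolys n (B 1)" using jm y by blast
    then show "y \<in> \<delta> 0 ` fpolys n (B 1)" by simp
  qed
  have bounded: "hom_part M j = {\<zero>\<^bsub>M\<^esub>}" if "j < jmin" for j
    using low[OF that] eps_kernel zero unfolding hom_part_eq by blast
  show ?thesis
  proof (cases "\<exists>j. hom_part M j \<noteq> {\<zero>\<^bsub>M\<^esub>}")
    case False
    then show ?thesis by blast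
  next
    case True
    then obtain j' where j': "hom_part M j' \<noteq> {\<zero>\<^bsub>M\<^esub>}" by (elim exE)
    define P where "P k \<longleftrightarrow> hom_part M (jmin + int k) \<noteq> {\<zero>\<^bsub>M\<^esub>}" for k
    have "P (nat (j' - jmin))" using j' bounded[of j'] by (cases "j' < jmin") (auto simp: P_def)
    then have L: "P (LEAST k. P k)" by (rule LeastI)
    have L': "\<not> P k" if "k < (LEAST k. P k)" for k using that by (rule not_less_Least)
    define d where "d = jmin + int (LEAST k. P k)"
    have d: "hom_part M d \<noteq> {\<zero>\<^bsub>M\<^esub>}" using L by (simp add: P_def d_def)
    have below: "hom_part M i = {\<zero>\<^bsub>M\<^esub>}" if "i < d" for i
    proof (cases "i < jmin")
      case False
      then have "nat (i - jmin) < (LEAST k. P k)" "jmin + int (nat (i - jmin)) = i" using that by (auto simp: d_def)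
      then show ?thesis using L'[of "nat (i - jmin)"] by (simp add: P_def)
    qed (rule bounded)
    have "initial_degree M = d"
      unfolding initial_degree_def
    proof (rule the_equality)
      fix d' assume d': "hom_part M d' \<noteq> {\<zero>\<^bsub>M\<^esub>} \<and> (\<forall>i<d'. hom_part M i = {\<zero>\<^bsub>M\<^esub>})"
      then show "d' = d" using d below by (meson linorder_neqE)
    qed (use d below in blast)
    then show ?thesis using below[of "d - 1"] by simp
  qed
qed

lemma linear_strandI:
  fixes H :: "(nat \<Rightarrow> 'k mpoly) \<Rightarrow> nat \<Rightarrow> 'k mpoly"
  defines "d \<equiv> initial_degree M"
  assumes add: "\<And>x y. x \<in> fgr n (B 0) (gs 0) d \<Longrightarrow> y \<in> fgr n (B 0) (gs 0) d \<Longrightarrow> H (x + y) = H x + H y"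
    and scale: "\<And>c x. x \<in> fgr n (B 0) (gs 0) d \<Longrightarrow> H (pscale (mconst c) x) = pscale (mconst c) (H x)"
    and kernel: "\<And>x. x \<in> fgr n (B 0) (gs 0) d \<Longrightarrow> H x = 0 \<longleftrightarrow> x \<in> \<delta> 0 ` fpolys n (B 1)"
  shows "linear_strand n B gs \<delta> kscale d H"
proof -
  have "\<exists>W. finite W \<and> H ` fgr n (B 0) (gs 0) d \<subseteq> ps.span W"
  proof -
    obtain W where W: "finite W" "W \<subseteq> fgr n (B 0) (gs 0) d"
      "\<And>y. y \<in> fgr n (B 0) (gs 0) d \<Longrightarrow> \<exists>s\<in>ps.span W. y - s \<in> \<delta> 0 ` fpolys n (B 1)"
    proof -
      obtain jmin where "\<forall>j. \<exists>W. finite W \<and> W \<subseteq> fgr n (B 0) (gs 0) j \<and> (j < jmin \<longrightarrow> W = {}) \<and>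
        (\<forall>y\<in>fgr n (B 0) (gs 0) j. \<exists>s\<in>ps.span W. y - s \<in> \<delta> 0 ` fpolys n (B 1))"
        using homogeneous_generators by (rule exE)
      from spec[OF this, of d] show ?thesis by (elim exE conjE) (rule that, auto)
    qed
    have H0: "H 0 = 0" using add[OF fgr_0 fgr_0] by simp
    have H_span: "s \<in> fgr n (B 0) (gs 0) d \<and> H s \<in> ps.span (H ` W)" if "s \<in> ps.span W" for s
      using that
    proof (induction rule: ps.span_induct_alt)
      case base
      show ?case unfolding H0 by (intro conjI fgr_0 ps.span_zero)
    next
      case (step c x y)
      have x: "x \<in> fgr n (B 0) (gs 0) d" using step(1) W(2) by blast
      have cx: "pscale (mconst c) x \<in> fgr n (B 0) (gs 0) d" by (rule fgr_const[OF x])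
      have y: "y \<in> fgr n (B 0) (gs 0) d" "H y \<in> ps.span (H ` W)" using step(2) by blast+
      have "H x \<in> ps.span (H ` W)" using step(1) by (intro ps.span_base) blast
      then show ?case
        unfolding add[OF cx y(1)] scale[OF x] by (intro conjI fgr_add[OF cx y(1)] ps.span_add ps.span_scale y(2))
    qed
    have "H y \<in> ps.span (H ` W)" if y: "y \<in> fgr n (B 0) (gs 0) d" for y
    proof -
      obtain s where s: "s \<in> ps.span W" "y - s \<in> \<delta> 0 ` fpolys n (B 1)" using W(3)[OF y] by blast
      have sd: "s \<in> fgr n (B 0) (gs 0) d" using H_span[OF s(1)] by blast
      have ys: "y - s \<in> fgr n (B 0) (gs 0) d" by (rule fgr_diff[OF y sd])
      have "H y = H ((y - s) + s)" by simp
      also have "\<dots> = H s" unfolding add[OF ys sd] using kernel[OF ys] s(2) by simp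
      finally have e: "H y = H s" .
      show ?thesis unfolding e using H_span[OF s(1)] by (rule conjunct2)
    qed
    then show ?thesis using W(1) by (intro exI[of _ "H ` W"]) blast
  qed
  moreover have "fgr n (B 0) (gs 0) (d - 1) \<subseteq> \<delta> 0 ` fpolys n (B 1)"
    using hom_part_below_initial hom_part_eq[of "d - 1"] eps_kernel fgr_subset[of n "B 0" "gs 0" "d - 1"]
    unfolding d_def by blast
  ultimately show ?thesis
    using add scale kernel
    by (intro linear_strand.intro linear_strand_axioms.intro free_complex_axioms ps.family_space_axioms)
qed

text \<open>For a linear projection \<open>g\<close> onto the image of \<open>\<delta> 0\<close>,
  the map \<open>v - g v\<close> has exactly this image as its kernel. It thus realizes the cokernel
  inside the type of \<open>F 0\<close>.\<close>

lemma linear_strand_exists: "\<exists>H. linear_strand n B gs \<delta> kscale (initial_degree M) H"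
proof -
  let ?E = "\<delta> 0 ` fpolys n (B 1)"
  have E: "ps.subspace ?E"
  proof (rule ps.subspaceI)
    show "0 \<in> ?E" unfolding One_nat_def by (rule d_image_0)
    show "x + y \<in> ?E" if "x \<in> ?E" "y \<in> ?E" for x y
      using that unfolding One_nat_def by (rule d_image_add)
    show "pscale (mconst c) x \<in> ?E" if "x \<in> ?E" for x c
      using mpolys_const that unfolding One_nat_def by (rule d_image_scale)
  qed
  interpret pp: vector_space_pair "kscale :: 'k \<Rightarrow> _"
    "kscale :: 'k \<Rightarrow> _" ..
  obtain g where g: "range g \<subseteq> ?E" "Vector_Spaces.linear kscale kscale g" "\<And>v. v \<in> ?E \<Longrightarrow> g v = v"
    using pp.linear_exists_left_inverse_on[of id ?E] ps.linear_id E by auto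
  interpret g: Vector_Spaces.linear kscale kscale g by (rule g(2))
  have "linear_strand n B gs \<delta> kscale (initial_degree M) (\<lambda>v. v - g v)"
  proof (rule linear_strandI)
    show "x + y - g (x + y) = (x - g x) + (y - g y)" for x y unfolding g.add by (simp add: algebra_simps)
    show "pscale (mconst c) x - g (pscale (mconst c) x) = pscale (mconst c) (x - g x)" for c x
      unfolding g.scale by (simp add: fun_eq_iff right_diff_distrib)
    show "x - g x = 0 \<longleftrightarrow> x \<in> ?E" for x using g(1,3) by (metis eq_iff_diff_eq_0 range_subsetD)
  qed
  then show ?thesis by (intro exI[where x = "\<lambda>v. v - g v"])
qed

end

lemma resolution_transfer:
  fixes P :: "('k::field mpoly, 'c) graded_module" and M :: "('k mpoly, 'b) graded_module"
  assumes res: "graded_free_resolution n P (\<lambda>l. graded_free n (B l) (gs l)) \<epsilon> \<delta>"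
    and iso: "graded_iso (mpoly_ring n) M P" and M: "is_graded_module n M"
  shows "\<exists>\<epsilon>'. graded_free_resolution n M (\<lambda>l. graded_free n (B l) (gs l)) \<epsilon>' \<delta>"
proof -
  interpret M: Module.module "mpoly_ring n" M using M by (simp add: is_graded_module_def)
  interpret free_complex n B gs \<delta> by (rule free_complex_of_resolution[OF res])
  have carr: "hom_part M j \<subseteq> carrier M" for j
    using M additive_subgroup.a_subset unfolding is_graded_module_def by blast
  obtain h where hom: "h \<in> graded_homs (mpoly_ring n) M P" and bij: "bij_betw h (carrier M) (carrier P)"
    and hp: "\<And>j. h ` hom_part M j = hom_part P j"
    using iso unfolding graded_iso_def by blast
  have h_in: "h x \<in> carrier P" if "x \<in> carrier M" for x using bij that by (auto simp: bij_betw_def)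
  have h_add: "h (x \<oplus>\<^bsub>M\<^esub> y) = h x \<oplus>\<^bsub>P\<^esub> h y" if "x \<in> carrier M" "y \<in> carrier M" for x y
    using hom that by (auto simp: graded_homs_def module_homs_def)
  have h_scale: "h (r \<odot>\<^bsub>M\<^esub> x) = r \<odot>\<^bsub>P\<^esub> h x" if "r \<in> mpolys n" "x \<in> carrier M" for r x
    using hom that by (auto simp: graded_homs_def module_homs_def carrier_mpoly_ring)
  define g where "g = inv_into (carrier M) h"
  have g: "g y \<in> carrier M" "h (g y) = y" if "y \<in> carrier P" for y
    using that bij by (auto simp: g_def bij_betw_def inv_into_into f_inv_into_f)
  have gh: "g (h x) = x" if "x \<in> carrier M" for x
    using that bij by (auto simp: g_def bij_betw_def)
  have ehom: "\<epsilon> \<in> graded_homs (mpoly_ring n) (graded_free n (B 0) (gs 0)) P"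
    using res by (simp add: graded_free_resolution_def)
  have e_in: "\<epsilon> v \<in> carrier P" if "v \<in> fpolys n (B 0)" for v
    using ehom that by (auto simp: graded_homs_def module_homs_def graded_free_simps)
  have e_add: "\<epsilon> (u + v) = \<epsilon> u \<oplus>\<^bsub>P\<^esub> \<epsilon> v" if "u \<in> fpolys n (B 0)" "v \<in> fpolys n (B 0)" for u v
    using ehom that by (auto simp: graded_homs_def module_homs_def graded_free_simps)
  have e_scale: "\<epsilon> (pscale r v) = r \<odot>\<^bsub>P\<^esub> \<epsilon> v" if "r \<in> mpolys n" "v \<in> fpolys n (B 0)" for r v
    using ehom that by (auto simp: graded_homs_def module_homs_def graded_free_simps carrier_mpoly_ring)
  have e_graded: "\<epsilon> v \<in> hom_part P j" if "v \<in> fgr n (B 0) (gs 0) j" for v j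
    using ehom that by (auto simp: graded_homs_def graded_free_simps image_subset_iff)
  have surj: "\<epsilon> ` fpolys n (B 0) = carrier P"
    and ker: "\<delta> 0 ` fpolys n (B 1) = {v \<in> fpolys n (B 0). \<epsilon> v = \<zero>\<^bsub>P\<^esub>}"
    using res unfolding graded_free_resolution_def graded_free_simps by blast+
  have e0: "\<epsilon> 0 = \<zero>\<^bsub>P\<^esub>" using ker d_image_0[of 0] by auto
  \<comment> \<open>\<open>P\<close> is not known to be a module, so the zero is reached as the
    scalar \<open>0\<close> times an element, computed in \<open>F 0\<close> through surjectivity of
    \<open>\<epsilon>\<close>.\<close>
  have h0: "h \<zero>\<^bsub>M\<^esub> = \<zero>\<^bsub>P\<^esub>"
  proof -
    obtain u where u: "u \<in> fpolys n (B 0)" "h \<zero>\<^bsub>M\<^esub> = \<epsilon> u" using surj h_in[OF M.zero_closed] by blast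
    have "h \<zero>\<^bsub>M\<^esub> = h (0 \<odot>\<^bsub>M\<^esub> \<zero>\<^bsub>M\<^esub>)" using M.smult_l_null[OF M.zero_closed] by (simp add: mpoly_ring_simps)
    also have "\<dots> = \<epsilon> (pscale 0 u)" unfolding h_scale[OF mpolys_0 M.zero_closed] u(2) e_scale[OF mpolys_0 u(1)] ..
    also have "pscale 0 u = 0" by (simp add: fun_eq_iff)
    finally show ?thesis unfolding e0 .
  qed
  have "graded_free_resolution n M (\<lambda>l. graded_free n (B l) (gs l)) (\<lambda>v. g (\<epsilon> v)) \<delta>"
    unfolding graded_free_resolution_def
  proof (intro conjI)
    show "\<forall>i. \<exists>B' g. graded_free n (B i) (gs i) = graded_free n B' g" by blast
    show "(\<lambda>v. g (\<epsilon> v)) \<in> graded_homs (mpoly_ring n) (graded_free n (B 0) (gs 0)) M"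
      unfolding graded_homs_def module_homs_def graded_free_simps carrier_mpoly_ring
    proof (intro CollectI conjI ballI allI)
      show "(\<lambda>v. g (\<epsilon> v)) \<in> fpolys n (B 0) \<rightarrow> carrier M" using e_in g by blast
      show "g (\<epsilon> (u + v)) = g (\<epsilon> u) \<oplus>\<^bsub>M\<^esub> g (\<epsilon> v)" if uv: "u \<in> fpolys n (B 0)" "v \<in> fpolys n (B 0)" for u v
        using h_add[OF g(1) g(1), OF e_in e_in, OF uv] gh g e_in uv by (metis M.add.m_closed e_add)
      show "g (\<epsilon> (pscale r v)) = r \<odot>\<^bsub>M\<^esub> g (\<epsilon> v)" if rv: "r \<in> mpolys n" "v \<in> fpolys n (B 0)" for r v
      proof -
        have "r \<odot>\<^bsub>M\<^esub> g (\<epsilon> v) \<in> carrier M" using rv g(1)[OF e_in] by (intro M.smult_closed) (auto simp: carrier_mpoly_ring)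
        then show ?thesis
          using h_scale[OF rv(1) g(1)[OF e_in[OF rv(2)]]] gh g(2)[OF e_in[OF rv(2)]] e_scale[OF rv] by metis
      qed
      show "(\<lambda>v. g (\<epsilon> v)) ` fgr n (B 0) (gs 0) j \<subseteq> hom_part M j" for j
      proof (rule image_subsetI)
        fix v :: "nat \<Rightarrow> 'k mpoly" assume "v \<in> fgr n (B 0) (gs 0) j"
        then obtain x where x: "x \<in> hom_part M j" "\<epsilon> v = h x" using e_graded hp by blast
        then have "x \<in> carrier M" using carr by blast
        then show "g (\<epsilon> v) \<in> hom_part M j" using gh x by simp
      qed
    qed
    have "(\<lambda>v. g (\<epsilon> v)) ` fpolys n (B 0) = g ` carrier P" unfolding surj[symmetric] image_image ..
    also have "\<dots> = carrier M" using g gh h_in by (force simp: image_iff)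
    finally show "(\<lambda>v. g (\<epsilon> v)) ` carrier (graded_free n (B 0) (gs 0)) = carrier M" unfolding graded_free_simps .
    have "g (\<epsilon> v) = \<zero>\<^bsub>M\<^esub> \<longleftrightarrow> \<epsilon> v = \<zero>\<^bsub>P\<^esub>" if "v \<in> fpolys n (B 0)" for v
      using g[OF e_in[OF that]] gh[OF M.zero_closed] h0 by metis
    then have "{v \<in> fpolys n (B 0). g (\<epsilon> v) = \<zero>\<^bsub>M\<^esub>} = {v \<in> fpolys n (B 0). \<epsilon> v = \<zero>\<^bsub>P\<^esub>}" by blast
    then show "\<delta> 0 ` carrier (graded_free n (B 1) (gs 1)) =
        {v \<in> carrier (graded_free n (B 0) (gs 0)). g (\<epsilon> v) = \<zero>\<^bsub>M\<^esub>}"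
      unfolding graded_free_simps ker by simp
  qed (use res in \<open>simp_all add: graded_free_resolution_def\<close>)
  then show ?thesis by blast
qed

abbreviation syzygy_module :: "nat \<Rightarrow> (nat \<Rightarrow> nat set) \<Rightarrow> (nat \<Rightarrow> nat \<Rightarrow> int) \<Rightarrow>
    (nat \<Rightarrow> (nat \<Rightarrow> 'k::field mpoly) \<Rightarrow> nat \<Rightarrow> 'k mpoly) \<Rightarrow> nat \<Rightarrow> ('k mpoly, nat \<Rightarrow> 'k mpoly) graded_module" where
  "syzygy_module n B gs \<delta> l \<equiv> graded_sub (graded_free n (B l) (gs l)) (\<delta> l ` fpolys n (B (Suc l)))"

lemma graded_sub_simps:
  "carrier (graded_sub M A) = A" "\<zero>\<^bsub>graded_sub M A\<^esub> = \<zero>\<^bsub>M\<^esub>" "x \<oplus>\<^bsub>graded_sub M A\<^esub> y = x \<oplus>\<^bsub>M\<^esub> y"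
  "r \<odot>\<^bsub>graded_sub M A\<^esub> x = r \<odot>\<^bsub>M\<^esub> x" "hom_part (graded_sub M A) j = hom_part M j \<inter> A"
  by (simp_all add: graded_sub_def)

lemma syzygy_resolution:
  assumes res: "graded_free_resolution n N (\<lambda>l. graded_free n (B l) (gs l)) \<epsilon> \<delta>"
  shows "graded_free_resolution n (syzygy_module n B gs \<delta> l)
    (\<lambda>i. graded_free n (B (Suc l + i)) (gs (Suc l + i))) (\<delta> l) (\<lambda>i. \<delta> (Suc l + i))"
proof -
  interpret free_complex n B gs \<delta> by (rule free_complex_of_resolution[OF res])
  have hom: "\<delta> i \<in> graded_homs (mpoly_ring n) (graded_free n (B (Suc i)) (gs (Suc i))) (graded_free n (B i) (gs i))" for i
    using res by (simp add: graded_free_resolution_def)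
  have ker: "\<delta> (Suc i) ` fpolys n (B (Suc (Suc i))) = {v \<in> fpolys n (B (Suc i)). \<delta> i v = 0}" for i
    using res unfolding graded_free_resolution_def graded_free_simps by blast
  have "\<delta> l \<in> graded_homs (mpoly_ring n) (graded_free n (B (Suc l)) (gs (Suc l))) (syzygy_module n B gs \<delta> l)"
    using hom[of l] unfolding graded_homs_def module_homs_def graded_sub_simps graded_free_simps
    by (auto simp: fgr_def)
  then show ?thesis
    unfolding graded_free_resolution_def
    using hom ker ker[of l] unfolding graded_free_simps graded_sub_simps by auto
qed

lemma obtain_free_resolution:
  assumes "graded_free_resolution n M F \<epsilon> \<delta>"
  obtains B gs where "F = (\<lambda>l. graded_free n (B l) (gs l))"
proof -
  have "\<forall>i. \<exists>B g. F i = graded_free n B g" using assms by (simp add: graded_free_resolution_def)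
  then obtain B gs where "\<And>i. F i = graded_free n (B i) (gs i)" by metis
  then show ?thesis using that by blast
qed

text \<open>The choice inside \<open>Tor\<close> yields an actual resolution as soon as one exists;
  it need not be the given one, so all data are obtained anew.\<close>

lemma Tor_resolution:
  assumes M: "is_graded_module n M" "finitely_generated (mpoly_ring n) M"
    and ex: "graded_free_resolution n M F \<epsilon>' \<delta>'"
  obtains B gs \<epsilon> \<delta> where "graded_resolution n M B gs \<epsilon> \<delta>"
    "\<And>i. Tor n i M (residue_field :: ('k::field mpoly, 'k) graded_module)
       = tensor_homology n (\<lambda>l. graded_free n (B l) (gs l)) \<delta> residue_field i"
proof -
  define t where "t = (SOME (F, \<epsilon>, \<delta>). graded_free_resolution n M F \<epsilon> \<delta>)"
  have t: "case t of (F, \<epsilon>, \<delta>) \<Rightarrow> graded_free_resolution n M F \<epsilon> \<delta>"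
    unfolding t_def by (rule someI[of _ "(F, \<epsilon>', \<delta>')"]) (use ex in simp)
  obtain F \<epsilon> \<delta> where t_eq: "t = (F, \<epsilon>, \<delta>)" by (cases t)
  have r: "graded_free_resolution n M F \<epsilon> \<delta>" using t t_eq by simp
  obtain B gs where F: "F = (\<lambda>l. graded_free n (B l) (gs l))" by (rule obtain_free_resolution[OF r])
  have "graded_resolution n M B gs \<epsilon> \<delta>" using M r unfolding F by (rule graded_resolution.intro)
  moreover have "Tor n i M (residue_field :: ('k mpoly, 'k) graded_module)
       = tensor_homology n (\<lambda>l. graded_free n (B l) (gs l)) \<delta> residue_field i" for i
    unfolding Tor_def t_def[symmetric] t_eq F by simp
  ultimately show ?thesis using that by blast
qed

lemma linear_betti_eq_dim_cycles:
  assumes "linear_strand n B gs \<delta> kscale (initial_degree M) H"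
    and "\<And>i. Tor n i M residue_field = tensor_homology n (\<lambda>l. graded_free n (B l) (gs l)) \<delta> residue_field i"
  shows "linear_betti n M i = ps.fam.dim (linear_strand.cycles n B gs \<delta> (initial_degree M) H i)"
proof -
  interpret S: linear_strand n B gs \<delta> kscale "initial_degree M" H by (rule assms(1))
  show ?thesis unfolding linear_betti_def graded_betti_def assms(2) by (rule S.vdim_tensor_homology)
qed

section \<open>Modules embedded in a free module\<close>

context graded_resolution
begin

context
  fixes h :: "'b \<Rightarrow> nat \<Rightarrow> 'k mpoly" and C g E
  assumes hom: "h \<in> graded_homs (mpoly_ring n) M (graded_sub (graded_free n C g) E)"
    and inj: "inj_on h (carrier M)"
begin

abbreviation "emb \<equiv> \<lambda>v. h (\<epsilon> v)"

lemma emb_add: "u \<in> fpolys n (B 0) \<Longrightarrow> v \<in> fpolys n (B 0) \<Longrightarrow> emb (u + v) = emb u + emb v"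
  using hom eps_in eps_add by (simp add: graded_homs_def module_homs_def graded_sub_simps graded_free_simps)

lemma emb_scale: "r \<in> mpolys n \<Longrightarrow> v \<in> fpolys n (B 0) \<Longrightarrow> emb (pscale r v) = pscale r (emb v)"
  using hom eps_in eps_scale
  by (simp add: graded_homs_def module_homs_def graded_sub_simps graded_free_simps carrier_mpoly_ring)

lemma emb_kernel:
  assumes "v \<in> fpolys n (B 0)"
  shows "emb v = 0 \<longleftrightarrow> v \<in> \<delta> 0 ` fpolys n (B 1)"
proof -
  have "emb 0 = 0" using emb_add[OF fpolys_0 fpolys_0] by simp
  then have "emb v = 0 \<longleftrightarrow> emb v = emb 0" by simp
  also have "\<dots> \<longleftrightarrow> \<epsilon> v = \<epsilon> 0" using inj_on_eq_iff[OF inj eps_in[OF assms] eps_in[OF fpolys_0]] .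
  also have "\<dots> \<longleftrightarrow> v \<in> \<delta> 0 ` fpolys n (B 1)" using eps_eq_iff[OF assms fpolys_0] by simp
  finally show ?thesis .
qed

text \<open>Here the inclusion into a free module plays the role of \<open>H\<close>. Being linear
  over all polynomials, not only over constants, it turns precycles into genuine Koszul cycles of
  polynomial families.\<close>

lemma emb_strand: "linear_strand n B gs \<delta> kscale (initial_degree M) emb"
  using fgr_subset by (intro linear_strandI emb_add emb_scale emb_kernel mpolys_const) blast+

lemma
  assumes "u \<in> linear_strand.cycles n B gs \<delta> (initial_degree M) emb i"
  shows emb_cycles_koszul: "koszul n u = 0"
    and emb_cycles_fgr: "u Q \<in> fgr n C g (initial_degree M)"
    and emb_cycles_image: "u Q \<in> E"
proof -
  interpret S: linear_strand n B gs \<delta> kscale "initial_degree M" emb by (rule emb_strand)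
  obtain y where y: "y \<in> S.precycles i" "u = (\<lambda>Q. emb (y Q))" using assms by (auto simp: S.cycles_def)
  have yF: "y Q \<in> fgr n (B 0) (gs 0) (initial_degree M)" for Q by (rule S.precycles_fgr[OF y(1)])
  then have yf: "y Q \<in> fpolys n (B 0)" for Q by (simp add: fgr_def)
  have im: "koszul n y Q \<in> \<delta> 0 ` fpolys n (B 1)" for Q using y(1) unfolding S.precycles_def by blast
  have "koszul n u = (\<lambda>Q. emb (koszul n y Q))"
    unfolding y(2) by (rule kos_linear[OF subset_refl yf emb_add emb_scale])
  also have "\<dots> = 0"
  proof (rule ext)
    fix Q
    have "koszul n y Q \<in> fpolys n (B 0)" using im[of Q] d_in[of _ 0] by auto
    then show "emb (koszul n y Q) = 0 Q" using emb_kernel im by simp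
  qed
  finally show "koszul n u = 0" .
  have "h ` hom_part M j \<subseteq> fgr n C g j \<inter> E" for j
    using hom by (auto simp: graded_homs_def graded_sub_simps graded_free_simps)
  then show "u Q \<in> fgr n C g (initial_degree M)" "u Q \<in> E" using eps_graded[OF yF] unfolding y(2) by blast+
qed

end

end

theorem corollary2p12:
  fixes M :: "('k::field mpoly, 'b) graded_module"
    and N :: "('k mpoly, 'c) graded_module"
    and n p k :: nat
  assumes "is_graded_module n M" and "finitely_generated (mpoly_ring n) M"
    and "p \<le> n"
    and "linear_betti n M p \<noteq> 0"
    and "is_graded_module n N" and "finitely_generated (mpoly_ring n) N"
    and "is_kth_syzygy n k N M"
  shows "(k = 0 \<longrightarrow> (\<forall>i\<le>p. linear_betti n M i \<ge> p choose i)) \<and>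
         (k = 1 \<longrightarrow> (\<forall>i\<le>p. linear_betti n M i \<ge> (p + 1) choose (i + 1))) \<and>
         (k > 1 \<and> p > 0 \<longrightarrow> linear_betti n M (p - 1) \<ge> p + k)"
proof -
  obtain F \<epsilon>N \<delta>N where resN: "graded_free_resolution n N F \<epsilon>N \<delta>N"
    and isoN: "case k of 0 \<Rightarrow> graded_iso (mpoly_ring n) M N
        | Suc l \<Rightarrow> graded_iso (mpoly_ring n) M (graded_sub (F l) (\<delta>N l ` carrier (F (Suc l))))"
    using assms(7) unfolding is_kth_syzygy_def minimal_graded_free_resolution_def by blast
  obtain BN gN where F: "F = (\<lambda>l. graded_free n (BN l) (gN l))" by (rule obtain_free_resolution[OF resN])
  note resN = resN[unfolded F]
  have isoS: "graded_iso (mpoly_ring n) M (syzygy_module n BN gN \<delta>N l)" if "k = Suc l" for l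
    using isoN that by (simp add: F graded_free_simps)
  \<comment> \<open>The resolution of \<open>N\<close>, truncated and transported along the
    isomorphism, shows that \<open>M\<close> has a resolution, without which the choice in
    \<open>Tor\<close> would be void.\<close>
  have "\<exists>F \<epsilon> \<delta>. graded_free_resolution n M F \<epsilon> \<delta>"
  proof (cases k)
    case 0
    then show ?thesis using resolution_transfer[OF resN _ assms(1)] isoN by auto
  next
    case (Suc l)
    show ?thesis using resolution_transfer[OF syzygy_resolution[OF resN] isoS[OF Suc] assms(1)] by blast
  qed
  then obtain F' \<epsilon>' \<delta>' where "graded_free_resolution n M F' \<epsilon>' \<delta>'" by blast
  \<comment> \<open>From here on \<open>B\<close>, \<open>gs\<close>, \<open>\<delta>\<close> belong
    to the resolution inside \<open>Tor\<close>, while \<open>BN\<close>, \<open>gN\<close>,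
    \<open>\<delta>N\<close> retain the resolution of \<open>N\<close>.\<close>
  then obtain B gs \<epsilon> \<delta> where R: "graded_resolution n M B gs \<epsilon> \<delta>"
    and Tor: "\<And>i. Tor n i M (residue_field :: ('k mpoly, 'k) graded_module)
       = tensor_homology n (\<lambda>l. graded_free n (B l) (gs l)) \<delta> residue_field i"
    by (rule Tor_resolution[OF assms(1,2)]) (rule that)
  interpret R: graded_resolution n M B gs \<epsilon> \<delta> by (rule R)
  interpret N: free_complex n BN gN \<delta>N by (rule free_complex_of_resolution[OF resN])
  let ?d = "initial_degree M"
  have betti_ge: "card S \<le> linear_betti n M i"
    if S: "linear_strand n B gs \<delta> kscale ?d H" and
      "S \<subseteq> linear_strand.cycles n B gs \<delta> ?d H i" "ps.fam.independent S" for S H i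
  proof -
    interpret S: linear_strand n B gs \<delta> kscale ?d H by (rule S)
    obtain W where "finite W" "S.cycles i \<subseteq> ps.fam.span W" using S.cycles_spanned by blast
    then show ?thesis
      using ps.fam.independent_card_le_dim_of_spanned[of S "S.cycles i" W] that(2,3)
        linear_betti_eq_dim_cycles[OF S Tor] by simp
  qed
  have nonzero: "\<exists>z\<in>linear_strand.cycles n B gs \<delta> ?d H p. z \<noteq> 0"
    if S: "linear_strand n B gs \<delta> kscale ?d H" for H
  proof (rule ccontr)
    assume "\<not> ?thesis"
    then have "linear_strand.cycles n B gs \<delta> ?d H p \<subseteq> ps.fam.span {}" by (simp add: subset_iff)
    then have "ps.fam.dim (linear_strand.cycles n B gs \<delta> ?d H p) \<le> card ({} :: (nat set \<Rightarrow> nat \<Rightarrow> 'k mpoly) set)"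
      by (rule ps.fam.dim_le_card) simp
    then show False using assms(4) linear_betti_eq_dim_cycles[OF S Tor, of p] by simp
  qed
  have "p choose i \<le> linear_betti n M i" if i: "i \<le> p" for i
  proof -
    obtain H where H: "linear_strand n B gs \<delta> kscale ?d H" using R.linear_strand_exists by blast
    interpret S: linear_strand n B gs \<delta> kscale ?d H by (rule H)
    obtain z where z: "z \<in> S.cycles p" "z \<noteq> 0" using nonzero[OF H] by blast
    obtain T where "T \<subseteq> S.cycles i" "ps.fam.independent T" "card T = p choose i"
      using ps.binomial_bound[OF S.contr_closed_cycles z i] by blast
    then show ?thesis using betti_ge[OF H, of T i] by simp
  qed
  moreover have "Suc p choose Suc i \<le> linear_betti n M i" if k: "k = Suc 0" and i: "i \<le> p" for i
  proof -
    obtain h where h: "h \<in> graded_homs (mpoly_ring n) M (syzygy_module n BN gN \<delta>N 0)" "inj_on h (carrier M)"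
      using isoS[OF k] by (auto simp: graded_iso_def bij_betw_def)
    note H = R.emb_strand[OF h]
    interpret S: linear_strand n B gs \<delta> kscale ?d "\<lambda>v. h (\<epsilon> v)" by (rule H)
    obtain z where z: "z \<in> S.cycles p" "z \<noteq> 0" using nonzero[OF H] by blast
    have contr: "koszul n (contr v u) = 0" if "koszul n u = 0" for v and u :: "nat set \<Rightarrow> nat \<Rightarrow> 'k mpoly"
      unfolding S.kos_contr that contr_0 by simp
    have cyc: "\<forall>a. \<forall>u\<in>S.cycles a. koszul n u = 0" using R.emb_cycles_koszul[OF h] by blast
    have "\<exists>T\<subseteq>S.cycles i. finite T \<and> ps.fam.independent T \<and> card T = Suc p choose Suc i"
      by (rule ps.binomial_bound_strict[of "{..<n}" "\<lambda>u. koszul n u = 0",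
          OF contr_image_strict contr S.contr_closed_cycles cyc z i])
    then obtain T where "T \<subseteq> S.cycles i" "ps.fam.independent T" "card T = Suc p choose Suc i"
      by (elim exE conjE) (rule that)
    then show ?thesis using betti_ge[OF H, of T i] by simp
  qed
  moreover have "p + k \<le> linear_betti n M (p - 1)" if k: "k > 1" and p: "p > 0"
  proof -
    obtain l where l: "k = Suc l" "0 < l" using k by (cases k) auto
    obtain p' where p': "p = Suc p'" using p gr0_implies_Suc by blast
    obtain h where h: "h \<in> graded_homs (mpoly_ring n) M (syzygy_module n BN gN \<delta>N l)" "inj_on h (carrier M)"
      and hp: "\<And>j. h ` hom_part M j = hom_part (syzygy_module n BN gN \<delta>N l) j"
      using isoS[OF l(1)] by (auto simp: graded_iso_def bij_betw_def)
    note H = R.emb_strand[OF h]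
    interpret S: linear_strand n B gs \<delta> kscale ?d "\<lambda>v. h (\<epsilon> v)" by (rule H)
    obtain z where z: "z \<in> S.cycles p" "z \<noteq> 0" using nonzero[OF H] by blast
    have supp: "supp_fam {..<n} p z" using S.contr_closed_cycles z(1) by (auto simp: ps.contr_closed_def)
    have zC: "z \<in> N.Cx {..<n} l p ?d" using supp R.emb_cycles_fgr[OF h z(1)] by (simp add: N.Cx_def)
    \<comment> \<open>The syzygy module inside the free module inherits from \<open>M\<close> that
      it vanishes in degree \<open>d - 1\<close>.\<close>
    have "h \<zero>\<^bsub>M\<^esub> = 0" using S.H_0 R.eps_0 by simp
    then have "h ` hom_part M (?d - 1) = {0}" unfolding R.hom_part_below_initial by simp
    then have low: "\<delta>N l ` fpolys n (BN (Suc l)) \<inter> fgr n (BN l) (gN l) (?d - 1) \<subseteq> {0}"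
      using hp[of "?d - 1"] unfolding graded_sub_simps graded_free_simps by blast
    obtain T where T: "T \<subseteq> (\<lambda>v. contr v z) ` {..<n}" "ps.fam.independent T" "p + Suc l \<le> card T"
      using N.syzygy_contractions_bound[OF l(2) p zC R.emb_cycles_koszul[OF h z(1)] z(2) R.emb_cycles_image[OF h z(1)] low]
      by blast
    \<comment> \<open>The independent contractions of the single cycle \<open>z\<close> are
      themselves cycles, one position lower.\<close>
    have "T \<subseteq> S.cycles (p - 1)"
      using T(1) S.contr_closed_cycles z(1) unfolding p' by (auto simp: ps.contr_closed_def)
    then show ?thesis using betti_ge[OF H _ T(2)] T(3) l(1) by fastforce
  qed
  ultimately show ?thesis by simp
qed

end
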